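(* Let $V\subset(\mathbb{C}^* )^n$ be an algebraic variety of dimension $k$, and let $\mathrm{Critp}(\mathrm{Log}_{|V})$ be the set of critical points of the restriction to $V$ of the logarithmic map $\mathrm{Log}$. Let $\gamma_G:V_{reg}\to\mathbb{G}_{n-k,n}$ be the generalized logarithmic Gauss map of $V$ and, for each integer $m\ge 0$, let $\sigma_m=\{E\in\mathbb{G}_{n-k,n}\mid \dim_{\mathbb{R}}(E\cap\mathbb{R}^n)=m\}$. Then: (i) If $n\geq 2k$, then $$\mathrm{Critp}(\mathrm{Log}_{|V})=\bigcup_{j=1}^{k}\gamma_G^{-1}(\sigma_{n-2k+j}).$$ (ii) If $n<2k$, then $$\mathrm{Critp}(\mathrm{Log}_{|V})=\bigcup_{j=1}^{n-k}\gamma_G^{-1}(\sigma_{j}).$$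
   Context: $V_{reg}$ denotes the set of smooth points of $V$, i.e. the points of $V$ near which $V$ is a $k$-dimensional complex submanifold of $(\mathbb{C}^* )^n$. The logarithmic map is $\mathrm{Log}:(\mathbb{C}^* )^n\to\mathbb{R}^n$, $\mathrm{Log}(z_1,\ldots,z_n)=(\log|z_1|,\ldots,\log|z_n|)$. A point $z\in V_{reg}$ is critical for $\mathrm{Log}_{|V}$ if the differential at $z$ of the smooth map $\mathrm{Log}_{|V_{reg}}:V_{reg}\to\mathbb{R}^n$, viewed as an $\mathbb{R}$-linear map from the $2k$-dimensional real vector space $T_zV$ to $\mathbb{R}^n$, has real rank strictly less than $\min\{n,2k\}$; $\mathrm{Critp}(\mathrm{Log}_{|V})\subset V_{reg}$ is the set of all such points. $\mathbb{G}_{r,n}$ denotes the Grassmannian of complex $r$-dimensional linear subspaces of $\mathbb{C}^n$. $\mathbb{R}^n\subset\mathbb{C}^n$ is the standard real part of $\mathbb{C}^n$ (vectors with real coordinates). Generalized logarithmic Gauss map: let $\{f_1,\ldots,f_l\}$ be generators of the defining ideal $\mathcal{I}(V)$ of $V$. For $z=(z_1,\ldots,z_n)\in V_{reg}$ let $g_G(z)$ be the $l\times n$ complex matrix whose $(i,j)$ entry is $z_j\frac{\partial f_i}{\partial z_j}(z)$. For $z\in V_{reg}$ this matrix has rank $n-k$, and $\gamma_G(z)\in\mathbb{G}_{n-k,n}$ is defined to be the complex linear subspace of $\mathbb{C}^n$ spanned by the rows of $g_G(z)$. *)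

theory Defs
  imports "HOL-Analysis.Analysis" "HOL-Library.Poly_Mapping"
begin

section \<open>Laurent polynomials and algebraic subsets of the complex torus\<close>

definition torus :: "(complex ^ 'n) set"
  where "torus = {z. \<forall>j. z $ j \<noteq> 0}"

text \<open>
  The ring of Laurent polynomials in the variables indexed by \<open>'n\<close>, i.e. the coordinate ring of
  the torus, is the group algebra of \<open>\<int>\<close>-valued exponent vectors; the product inherited from
  \<open>HOL-Library.Poly_Mapping\<close> is convolution, hence the usual multiplication.
\<close>

type_synonym 'n laurent = "('n \<Rightarrow>\<^sub>0 int) \<Rightarrow>\<^sub>0 complex"

definition laurent_eval :: "'n::finite laurent \<Rightarrow> complex ^ 'n \<Rightarrow> complex"
  where "laurent_eval f z =
    (\<Sum>a\<in>Poly_Mapping.keys f. Poly_Mapping.lookup f a * (\<Prod>j\<in>UNIV. (z $ j) powi Poly_Mapping.lookup a j))"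

definition laurent_partial :: "'n::finite laurent \<Rightarrow> 'n \<Rightarrow> complex ^ 'n \<Rightarrow> complex"
  where "laurent_partial f j z = deriv (\<lambda>t. laurent_eval f (\<chi> i. if i = j then t else z $ i)) (z $ j)"

definition zero_locus :: "'n::finite laurent set \<Rightarrow> (complex ^ 'n) set"
  where "zero_locus S = {z \<in> torus. \<forall>f\<in>S. laurent_eval f z = 0}"

definition algebraic_set :: "(complex ^ 'n::finite) set \<Rightarrow> bool"
  where "algebraic_set V \<longleftrightarrow> (\<exists>S. V = zero_locus S)"

definition vanishing_ideal :: "(complex ^ 'n::finite) set \<Rightarrow> 'n laurent set"
  where "vanishing_ideal V = {f. \<forall>z\<in>V. laurent_eval f z = 0}"

definition ideal_generated_by :: "nat \<Rightarrow> (nat \<Rightarrow> 'n::finite laurent) \<Rightarrow> 'n laurent set"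
  where "ideal_generated_by l f = {(\<Sum>i<l. h i * f i) | h. True}"

definition irreducible_algebraic_set :: "(complex ^ 'n::finite) set \<Rightarrow> bool"
  where "irreducible_algebraic_set Z \<longleftrightarrow>
    algebraic_set Z \<and> Z \<noteq> {} \<and>
    (\<forall>A B. algebraic_set A \<and> algebraic_set B \<and> Z = A \<union> B \<longrightarrow> Z = A \<or> Z = B)"

definition irreducible_chain :: "(complex ^ 'n::finite) set \<Rightarrow> nat \<Rightarrow> (nat \<Rightarrow> (complex ^ 'n) set) \<Rightarrow> bool"
  where "irreducible_chain V m Z \<longleftrightarrow>
    (\<forall>i\<le>m. irreducible_algebraic_set (Z i) \<and> Z i \<subseteq> V) \<and> (\<forall>i<m. Z i \<subset> Z (Suc i))"

text \<open>
  Krull dimension of the Zariski topology. A variety need be neither irreducible nor equidimensional;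
  the empty set has no dimension.
\<close>

definition has_dimension :: "(complex ^ 'n::finite) set \<Rightarrow> nat \<Rightarrow> bool"
  where "has_dimension V k \<longleftrightarrow>
    (\<exists>Z. irreducible_chain V k Z) \<and> (\<forall>m>k. \<nexists>Z. irreducible_chain V m Z)"

section \<open>Smooth points and tangent spaces\<close>

definition holomorphic_map_on :: "(complex ^ 'n::finite \<Rightarrow> complex ^ 'n) \<Rightarrow> (complex ^ 'n) set \<Rightarrow> bool"
  where "holomorphic_map_on \<phi> U \<longleftrightarrow>
    (\<forall>x\<in>U. \<exists>D. (\<phi> has_derivative D) (at x) \<and> (\<forall>c v. D (c *s v) = c *s D v))"

text \<open>
  \<open>V\<close> is a \<open>k\<close>-dimensional complex submanifold near \<open>z\<close>: some biholomorphic chart \<open>\<phi>\<close> of the ambient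
  space, with inverse \<open>\<psi>\<close>, straightens \<open>V\<close> to a \<open>k\<close>-dimensional coordinate subspace.
\<close>

definition submanifold_near :: "(complex ^ 'n::finite) set \<Rightarrow> nat \<Rightarrow> complex ^ 'n \<Rightarrow> bool"
  where "submanifold_near V k z \<longleftrightarrow>
    (\<exists>U \<phi> \<psi> (J :: 'n set).
      open U \<and> z \<in> U \<and> open (\<phi> ` U) \<and>
      holomorphic_map_on \<phi> U \<and> holomorphic_map_on \<psi> (\<phi> ` U) \<and> (\<forall>x\<in>U. \<psi> (\<phi> x) = x) \<and>
      card J = k \<and> \<phi> ` (V \<inter> U) = \<phi> ` U \<inter> {w. \<forall>j. j \<notin> J \<longrightarrow> w $ j = 0})"

definition regular_points :: "(complex ^ 'n::finite) set \<Rightarrow> nat \<Rightarrow> (complex ^ 'n) set"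
  where "regular_points V k = {z \<in> V. submanifold_near V k z}"

text \<open>
  Velocities at \<open>z\<close> of curves in \<open>V\<close>. At a point near which \<open>V\<close> is a submanifold this is its
  tangent space as a real subspace of the ambient space; it is only used at such points.
\<close>

definition tangent_space :: "(complex ^ 'n::finite) set \<Rightarrow> complex ^ 'n \<Rightarrow> (complex ^ 'n) set"
  where "tangent_space V z =
    {v. \<exists>c :: real \<Rightarrow> complex ^ 'n. c 0 = z \<and> (\<forall>\<^sub>F t in at 0. c t \<in> V) \<and>
          (c has_vector_derivative v) (at 0)}"

section \<open>Critical points of the logarithmic map\<close>

definition Log_map :: "complex ^ 'n::finite \<Rightarrow> real ^ 'n"
  where "Log_map z = (\<chi> j. ln (cmod (z $ j)))"

text \<open>
  The differential of the restriction of \<open>Log_map\<close> to the regular points of \<open>V\<close> is the restriction of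
  the ambient differential to the tangent space; its rank is the real dimension of its image.
\<close>

definition Log_rank :: "(complex ^ 'n::finite) set \<Rightarrow> complex ^ 'n \<Rightarrow> nat"
  where "Log_rank V z = dim (frechet_derivative Log_map (at z) ` tangent_space V z)"

definition Critp_Log :: "(complex ^ 'n::finite) set \<Rightarrow> nat \<Rightarrow> (complex ^ 'n) set"
  where "Critp_Log V k = {z \<in> regular_points V k. Log_rank V z < min CARD('n) (2 * k)}"

section \<open>The generalized logarithmic Gauss map\<close>

definition grassmannian :: "nat \<Rightarrow> (complex ^ 'n::finite) set set"
  where "grassmannian r = {E. vec.subspace E \<and> vec.dim E = r}"

definition real_points :: "(complex ^ 'n::finite) set"
  where "real_points = {v. \<forall>j. v $ j \<in> \<real>}"

text \<open>
  Here \<open>dim\<close> is the dimension over the reals, while \<open>vec.dim\<close> and \<open>vec.span\<close> refer to the complex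
  vector space structure.
\<close>

definition sigma_stratum :: "nat \<Rightarrow> nat \<Rightarrow> (complex ^ 'n::finite) set set"
  where "sigma_stratum r m = {E \<in> grassmannian r. dim (E \<inter> real_points) = m}"

definition log_gauss_row :: "(nat \<Rightarrow> 'n::finite laurent) \<Rightarrow> complex ^ 'n \<Rightarrow> nat \<Rightarrow> complex ^ 'n"
  where "log_gauss_row f z i = (\<chi> j. z $ j * laurent_partial (f i) j z)"

definition log_gauss :: "nat \<Rightarrow> (nat \<Rightarrow> 'n::finite laurent) \<Rightarrow> complex ^ 'n \<Rightarrow> (complex ^ 'n) set"
  where "log_gauss l f z = vec.span (log_gauss_row f z ` {..<l})"

text \<open>Preimage of \<open>S\<close> under the Gauss map, whose domain is the set of regular points of \<open>V\<close>.\<close>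

definition log_gauss_preimage ::
    "(complex ^ 'n::finite) set \<Rightarrow> nat \<Rightarrow> nat \<Rightarrow> (nat \<Rightarrow> 'n laurent) \<Rightarrow> (complex ^ 'n) set set \<Rightarrow> (complex ^ 'n) set"
  where "log_gauss_preimage V k l f S = {z \<in> regular_points V k. log_gauss l f z \<in> S}"

end

theory Submission
  imports Defs "HOL-Complex_Analysis.Cauchy_Integral_Formula"
    "HOL-Computational_Algebra.Polynomial_Factorial" "HOL-Computational_Algebra.Field_as_Ring"
    "HOL-Computational_Algebra.Fundamental_Theorem_Algebra"
begin

text \<open>
  At a regular point \<open>z\<close> let \<open>T\<close> be the tangent space of \<open>V\<close> and let \<open>\<tau>\<close> be its image under
  \<open>v \<mapsto> (v\<^sub>j / z\<^sub>j)\<close>. The differential of the logarithmic map takes the real part of vectors of \<open>\<tau>\<close>,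
  so its rank is the real dimension of \<open>Re \<tau>\<close>. The space \<open>E = \<gamma>\<^sub>G(z)\<close> is the annihilator of \<open>\<tau>\<close> under the
  bilinear pairing \<open>\<Sum> \<eta>\<^sub>j v\<^sub>j\<close>. As \<open>\<tau>\<close> is stable under multiplication by the imaginary unit, a real
  vector lies in \<open>E\<close> iff it is orthogonal to \<open>Re \<tau>\<close>; hence the real points of \<open>E\<close> have dimension \<open>n\<close> minus
  the rank. Since \<open>\<tau>\<close> lies in the complex span of \<open>Re \<tau>\<close>, the rank is at least \<open>k\<close>, and both
  parts of the theorem are arithmetic with these numbers (\<open>regular_point_dimensions\<close>).

  The substance is that the rows of the Gauss matrix span the \<^emph>\<open>whole\<close> annihilator: every conormal vector
  of \<open>V\<close> at \<open>z\<close> is the differential at \<open>z\<close> of a Laurent polynomial vanishing on \<open>V\<close>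
  (\<open>conormal_is_gradient\<close>, \<open>gradients_span_conormal_space\<close>). Regularity of \<open>z\<close> is an analytic condition, so
  this compares the analytic structure of \<open>V\<close> near \<open>z\<close> with its ideal. Let \<open>P\<close> be the prime ideal of the
  polynomials that vanish on \<open>V\<close> near \<open>z\<close>.

  \<^item> Noether normalization (\<open>noether_normalization\<close>) gives a linear projection \<open>\<pi>\<close>, injective on \<open>T\<close>,
    such that modulo \<open>P\<close> all polynomials are finite over the ring \<open>B\<close> of polynomials that factor through
    \<open>\<pi>\<close>, while \<open>P\<close> contains no nonzero element of \<open>B\<close>. Every polynomial \<open>u\<close> then has a monic minimal
    polynomial over \<open>B\<close> (\<open>ex_minpoly\<close>), and each of its roots over a point \<open>a\<close> is the value of \<open>u\<close> at a zero of
    \<open>P\<close> with the same projection as \<open>a\<close> (\<open>lying_over\<close>).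

  \<^item> Roots of monic polynomials depend continuously on the coefficients, so the projection of the zero
    set of \<open>P\<close> is open at \<open>z\<close> (\<open>open_at\<close>). The zero set agrees with \<open>V\<close> near \<open>z\<close>, where secants are
    close to \<open>T\<close>; therefore \<open>\<pi>\<close> maps \<open>T\<close> isomorphically onto its range (\<open>projection_onto\<close>) and
    is injective on \<open>V\<close> near \<open>z\<close> (\<open>projection_injective_near\<close>).

  \<^item> Let \<open>\<xi>\<close> be a linear form that annihilates \<open>T\<close> and separates \<open>z\<close> from the other zeros of \<open>P\<close> in
    its fibre, with minimal polynomial \<open>Q\<close>. If \<open>\<xi>(z)\<close> were a multiple root of \<open>Q\<close> at \<open>z\<close>, then at nearby
    points of \<open>V\<close> there would be two roots close to \<open>\<xi>(z)\<close>; both lift to points of \<open>V\<close> near \<open>z\<close>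
    with the same projection, hence to one point, so the root would be multiple there as well. Then the
    derivative of \<open>Q\<close> at \<open>\<xi>\<close> would lie in \<open>P\<close>, against minimality (\<open>simple_root\<close>). So the differential of
    \<open>Q(\<xi>)\<close> at \<open>z\<close> is a nonzero multiple of \<open>\<xi>\<close> plus a form that factors through \<open>\<pi>\<close>; the latter
    vanishes on \<open>T\<close>, hence everywhere (\<open>gradient_from_separating_form\<close>). Such \<open>\<xi>\<close> span the conormal space.

  \<^item> The polynomial \<open>Q(\<xi>)\<close> vanishes on \<open>V\<close> near \<open>z\<close> only. Some \<open>h\<close> with \<open>h(z) \<noteq> 0\<close> makes the product vanish
    on all of \<open>V\<close> (\<open>local_vanishing_extends\<close>): otherwise there is a prime ideal through \<open>z\<close>
    that contains the ideal of \<open>V\<close> but not \<open>Q(\<xi>)\<close>, and openness of a normalization of it is contradicted.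
\<close>

section \<open>Ideals, elimination and integral elements\<close>

definition is_ideal :: "'r::comm_ring_1 set \<Rightarrow> bool"
  where "is_ideal I \<longleftrightarrow> 0 \<in> I \<and> (\<forall>x\<in>I. \<forall>y\<in>I. x + y \<in> I) \<and> (\<forall>x\<in>I. \<forall>r. r * x \<in> I)"

definition is_prime_ideal :: "'r::comm_ring_1 set \<Rightarrow> bool"
  where "is_prime_ideal P \<longleftrightarrow> is_ideal P \<and> 1 \<notin> P \<and> (\<forall>x y. x * y \<in> P \<longrightarrow> x \<in> P \<or> y \<in> P)"

definition is_subring :: "'r::comm_ring_1 set \<Rightarrow> bool"
  where "is_subring B \<longleftrightarrow> 0 \<in> B \<and> 1 \<in> B \<and> (\<forall>x\<in>B. \<forall>y\<in>B. x + y \<in> B \<and> x * y \<in> B) \<and> (\<forall>x\<in>B. - x \<in> B)"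

lemma ideal_zero: "is_ideal I \<Longrightarrow> 0 \<in> I"
  and ideal_add: "is_ideal I \<Longrightarrow> x \<in> I \<Longrightarrow> y \<in> I \<Longrightarrow> x + y \<in> I"
  and ideal_mult: "is_ideal I \<Longrightarrow> x \<in> I \<Longrightarrow> r * x \<in> I"
  by (auto simp: is_ideal_def)

lemma ideal_mult_right: "is_ideal I \<Longrightarrow> x \<in> I \<Longrightarrow> x * r \<in> I"
  using ideal_mult[of I x r] by (simp add: mult.commute)

lemma ideal_uminus: "is_ideal I \<Longrightarrow> x \<in> I \<Longrightarrow> - x \<in> I"
  using ideal_mult[of I x "-1"] by simp

lemma ideal_diff: "is_ideal I \<Longrightarrow> x \<in> I \<Longrightarrow> y \<in> I \<Longrightarrow> x - y \<in> I"
  using ideal_add[of I x "-y"] ideal_uminus[of I y] by simp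

lemma ideal_sum: "is_ideal I \<Longrightarrow> (\<And>i. i \<in> A \<Longrightarrow> f i \<in> I) \<Longrightarrow> sum f A \<in> I"
  by (induction A rule: infinite_finite_induct) (auto intro: ideal_add ideal_zero)

lemma prime_imp_ideal: "is_prime_ideal P \<Longrightarrow> is_ideal P"
  and prime_one: "is_prime_ideal P \<Longrightarrow> 1 \<notin> P"
  and prime_mult: "is_prime_ideal P \<Longrightarrow> x * y \<in> P \<Longrightarrow> x \<in> P \<or> y \<in> P"
  by (auto simp: is_prime_ideal_def)

lemma subring_0: "is_subring B \<Longrightarrow> 0 \<in> B"
  and subring_1: "is_subring B \<Longrightarrow> 1 \<in> B"
  and subring_add: "is_subring B \<Longrightarrow> x \<in> B \<Longrightarrow> y \<in> B \<Longrightarrow> x + y \<in> B"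
  and subring_mult: "is_subring B \<Longrightarrow> x \<in> B \<Longrightarrow> y \<in> B \<Longrightarrow> x * y \<in> B"
  and subring_uminus: "is_subring B \<Longrightarrow> x \<in> B \<Longrightarrow> - x \<in> B"
  by (auto simp: is_subring_def)

lemma subring_diff: "is_subring B \<Longrightarrow> x \<in> B \<Longrightarrow> y \<in> B \<Longrightarrow> x - y \<in> B"
  using subring_add[of B x "-y"] subring_uminus[of B y] by simp

lemma subring_sum: "is_subring B \<Longrightarrow> (\<And>i. i \<in> A \<Longrightarrow> f i \<in> B) \<Longrightarrow> sum f A \<in> B"
  by (induction A rule: infinite_finite_induct) (auto intro: subring_add subring_0)

lemma subring_power: "is_subring B \<Longrightarrow> x \<in> B \<Longrightarrow> x ^ n \<in> B"
  by (induction n) (auto intro: subring_mult subring_1)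

text \<open>
  An ideal maximal among those containing \<open>I\<close> and disjoint from \<open>S\<close> is prime: if it contained neither
  \<open>x\<close> nor \<open>y\<close>, then adjoining either would produce an element of \<open>S\<close>, and the product of the two would
  lie in the ideal once \<open>x y\<close> does.
\<close>

lemma prime_ideal_avoiding:
  fixes I S :: "'r::comm_ring_1 set"
  assumes I: "is_ideal I" and S1: "1 \<in> S" and SS: "\<And>x y. x \<in> S \<Longrightarrow> y \<in> S \<Longrightarrow> x * y \<in> S"
    and dis: "I \<inter> S = {}"
  shows "\<exists>P. is_prime_ideal P \<and> I \<subseteq> P \<and> P \<inter> S = {}"
proof -
  let ?A = "{J. is_ideal J \<and> I \<subseteq> J \<and> J \<inter> S = {}}"
  have "\<exists>M\<in>?A. \<forall>X\<in>?A. M \<subseteq> X \<longrightarrow> X = M"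
  proof (rule subset_Zorn_nonempty)
    show "?A \<noteq> {}" using I dis by auto
    fix C assume C: "C \<noteq> {}" "subset.chain ?A C"
    have id: "\<And>J. J \<in> C \<Longrightarrow> is_ideal J \<and> I \<subseteq> J \<and> J \<inter> S = {}"
      using C by (auto simp: subset.chain_def)
    have "x + y \<in> \<Union>C" if "x \<in> \<Union>C" "y \<in> \<Union>C" for x y
    proof -
      from that obtain J K where JK: "J \<in> C" "x \<in> J" "K \<in> C" "y \<in> K" by auto
      moreover have "\<forall>X\<in>C. \<forall>Y\<in>C. X \<subseteq> Y \<or> Y \<subseteq> X"
        using C(2) by (simp add: subset_chain_def)
      ultimately have "J \<subseteq> K \<and> y \<in> K \<and> K \<in> C \<or> K \<subseteq> J \<and> x \<in> J \<and> J \<in> C" by simp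
      then show ?thesis
      proof (elim disjE conjE)
        assume "J \<subseteq> K" "y \<in> K" "K \<in> C"
        then have "x + y \<in> K" using id[OF JK(3)] JK by (intro ideal_add) auto
        then show ?thesis by (rule UnionI[OF JK(3)])
      next
        assume "K \<subseteq> J" "x \<in> J" "J \<in> C"
        then have "x + y \<in> J" using id[OF JK(1)] JK by (intro ideal_add) auto
        then show ?thesis by (rule UnionI[OF JK(1)])
      qed
    qed
    moreover have "r * x \<in> \<Union>C" if "x \<in> \<Union>C" for x r
    proof -
      from that obtain J where J: "J \<in> C" "x \<in> J" by auto
      then have "r * x \<in> J" using id[OF J(1)] by (intro ideal_mult) auto
      then show ?thesis by (rule UnionI[OF J(1)])
    qed
    moreover have "0 \<in> \<Union>C"
    proof -
      from C(1) obtain J where J: "J \<in> C" by auto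
      then show ?thesis using ideal_zero[of J] id[OF J] by auto
    qed
    ultimately have "is_ideal (\<Union>C)" by (simp add: is_ideal_def)
    moreover have "I \<subseteq> \<Union>C"
    proof -
      from C(1) obtain J where J: "J \<in> C" by auto
      then show ?thesis using id[OF J] by auto
    qed
    moreover have "\<Union>C \<inter> S = {}" using id by auto
    ultimately show "\<Union>C \<in> ?A" by simp
  qed
  then obtain M where MA: "M \<in> ?A" "\<forall>X\<in>?A. M \<subseteq> X \<longrightarrow> X = M" by (elim bexE) 
  then have M: "is_ideal M" "I \<subseteq> M" "M \<inter> S = {}" by simp_all
  have max: "X = M" if "is_ideal X" "M \<subseteq> X" "X \<inter> S = {}" for X
  proof -
    have "X \<in> ?A" using that M(2) by simp
    then show ?thesis using MA(2) that(2) by simp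
  qed
  have key: "\<exists>m r. m \<in> M \<and> m + r * x \<in> S" if "x \<notin> M" for x
  proof -
    let ?X = "{m + r * x | m r. m \<in> M}"
    have 1: "is_ideal ?X" unfolding is_ideal_def
    proof (intro conjI ballI allI)
      show "0 \<in> ?X" using ideal_zero[OF M(1)] by (auto intro!: exI[of _ 0])
    next
      fix a b assume "a \<in> ?X" "b \<in> ?X"
      then obtain m r m' r' where h: "a = m + r * x" "b = m' + r' * x" "m \<in> M" "m' \<in> M" by auto
      have "a + b = (m + m') + (r + r') * x" using h by (simp add: algebra_simps)
      then show "a + b \<in> ?X" using ideal_add[OF M(1) h(3,4)] by auto
    next
      fix a s assume "a \<in> ?X"
      then obtain m r where h: "a = m + r * x" "m \<in> M" by auto
      have "s * a = s * m + (s * r) * x" using h by (simp add: algebra_simps)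
      then show "s * a \<in> ?X" using ideal_mult[OF M(1) h(2)] by auto
    qed
    have 2: "M \<subseteq> ?X"
    proof
      fix m assume "m \<in> M"
      then show "m \<in> ?X" by (intro CollectI exI[of _ m] exI[of _ 0]) simp
    qed
    have 3: "?X \<noteq> M"
    proof
      assume "?X = M"
      moreover have "x \<in> ?X"
        using ideal_zero[OF M(1)] by (intro CollectI exI[of _ 0] exI[of _ 1]) simp
      ultimately show False using that by simp
    qed
    have "?X \<inter> S \<noteq> {}"
      by (rule contrapos_nn[OF 3 max[OF 1 2]])
    then show ?thesis by force
  qed
  have "x \<in> M \<or> y \<in> M" if xy: "x * y \<in> M" for x y
  proof (rule ccontr)
    assume "\<not> (x \<in> M \<or> y \<in> M)"
    then obtain m r m' r' where h: "m \<in> M" "m + r * x \<in> S" "m' \<in> M" "m' + r' * y \<in> S"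
      using key[of x] key[of y] by auto
    have "(m + r * x) * (m' + r' * y) = (m' + r' * y) * m + (r * x) * m' + (r * r') * (x * y)"
      by (simp add: algebra_simps)
    moreover have "(m' + r' * y) * m + (r * x) * m' + (r * r') * (x * y) \<in> M"
      by (intro ideal_add[OF M(1)] ideal_mult[OF M(1) h(1)] ideal_mult[OF M(1) h(3)] ideal_mult[OF M(1) xy])
    ultimately have "(m + r * x) * (m' + r' * y) \<in> M" by simp
    with SS[OF h(2,4)] M(3) show False by auto
  qed
  moreover have "1 \<notin> M" using M(3) S1 by auto
  ultimately have "is_prime_ideal M" using M(1) by (simp add: is_prime_ideal_def)
  then show ?thesis using M by auto
qed

text \<open>
  Gaussian elimination for a homogeneous linear system whose diagonal entries lie in \<open>S\<close> and whose other
  entries lie in \<open>N\<close>; it replaces the determinant in the arguments of Cayley--Hamilton and Nakayama. The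
  coefficients are polynomials evaluated at \<open>u\<close>. The index of \<open>S\<close> and \<open>N\<close> is a degree, which doubles with every
  eliminated unknown. Two instances occur: \<open>S\<close> the monic polynomials of given degree and \<open>N\<close> those of smaller degree,
  which yields integral equations, and \<open>S\<close> the polynomials with value 1 at a point and \<open>N\<close> those with
  value 0, which yields lying over.
\<close>

lemma linear_elimination:
  fixes P :: "'r::comm_ring_1 set" and u :: 'r and e :: "nat \<Rightarrow> 'r"
    and S N :: "nat \<Rightarrow> 'r poly set"
  assumes P: "is_ideal P" and S1: "1 \<in> S 0"
    and SS: "\<And>a b s t. s \<in> S a \<Longrightarrow> t \<in> S b \<Longrightarrow> s * t \<in> S (a + b)"
    and SN: "\<And>a b s t. s \<in> S a \<Longrightarrow> t \<in> N b \<Longrightarrow> s * t \<in> N (a + b)"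
    and NN: "\<And>a b s t. s \<in> N a \<Longrightarrow> t \<in> N b \<Longrightarrow> s * t \<in> N (a + b)"
    and Nadd: "\<And>a s t. s \<in> N a \<Longrightarrow> t \<in> N a \<Longrightarrow> s + t \<in> N a"
    and SNd: "\<And>a s t. s \<in> S a \<Longrightarrow> t \<in> N a \<Longrightarrow> s - t \<in> S a"
    and s: "\<And>i. i < r \<Longrightarrow> s i \<in> S d" and nu: "\<And>i j. i < r \<Longrightarrow> j < r \<Longrightarrow> nu i j \<in> N d"
    and rel: "\<And>i. i < r \<Longrightarrow> poly (s i) u * e i - (\<Sum>j<r. poly (nu i j) u * e j) \<in> P"
  shows "\<exists>d'. \<exists>t\<in>S d'. \<forall>i<r. poly t u * e i \<in> P"
  using s nu rel
proof (induction r arbitrary: s nu d)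
  case 0
  then show ?case using S1 by auto
next
  case (Suc r)
  let ?\<sigma> = "s r - nu r r"
  have \<sigma>: "?\<sigma> \<in> S d" using Suc.prems by (auto intro: SNd)
  \<comment> \<open>the last equation, solved for the last unknown\<close>
  have relr: "poly ?\<sigma> u * e r - (\<Sum>j<r. poly (nu r j) u * e j) \<in> P"
    using Suc.prems(3)[of r] by (simp add: algebra_simps)
  let ?s = "\<lambda>i. ?\<sigma> * s i" and ?n = "\<lambda>i j. ?\<sigma> * nu i j + nu i r * nu r j"
  have "\<exists>d'. \<exists>t\<in>S d'. \<forall>i<r. poly t u * e i \<in> P"
  proof (rule Suc.IH[of ?s "d + d" ?n])
    fix i assume i: "i < r"
    show "?s i \<in> S (d + d)" using \<sigma> Suc.prems(1) i by (auto intro: SS)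
    show "?n i j \<in> N (d + d)" if "j < r" for j
      using \<sigma> Suc.prems(2) i that by (intro Nadd SN NN) auto
    have "poly ?\<sigma> u * (poly (s i) u * e i - (\<Sum>j<Suc r. poly (nu i j) u * e j))
       + poly (nu i r) u * (poly ?\<sigma> u * e r - (\<Sum>j<r. poly (nu r j) u * e j)) \<in> P"
      using Suc.prems(3)[of i] i relr P by (intro ideal_add ideal_mult) auto
    also have "poly ?\<sigma> u * (poly (s i) u * e i - (\<Sum>j<Suc r. poly (nu i j) u * e j))
       + poly (nu i r) u * (poly ?\<sigma> u * e r - (\<Sum>j<r. poly (nu r j) u * e j))
      = poly (?s i) u * e i - (\<Sum>j<r. poly (?n i j) u * e j)"
      unfolding sum.lessThan_Suc poly_mult poly_add right_diff_distrib distrib_left distrib_right sum.distrib sum_distrib_left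
      by (simp add: mult.assoc mult.left_commute)
    finally show "poly (?s i) u * e i - (\<Sum>j<r. poly (?n i j) u * e j) \<in> P" .
  qed
  then obtain d' t where t: "t \<in> S d'" "\<And>i. i < r \<Longrightarrow> poly t u * e i \<in> P" by auto
  have "poly (t * ?\<sigma>) u * e i \<in> P" if "i < Suc r" for i
  proof (cases "i = r")
    case True
    have "(\<Sum>j<r. poly (nu r j) u * (poly t u * e j)) \<in> P"
    proof (rule ideal_sum[OF P])
      show "poly (nu r j) u * (poly t u * e j) \<in> P" if "j \<in> {..<r}" for j
        by (rule ideal_mult[OF P t(2)]) (use that in auto)
    qed
    with ideal_mult[OF P relr]
    have "poly t u * (poly ?\<sigma> u * e r - (\<Sum>j<r. poly (nu r j) u * e j))
        + (\<Sum>j<r. poly (nu r j) u * (poly t u * e j)) \<in> P"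
      by (rule ideal_add[OF P])
    also have "poly t u * (poly ?\<sigma> u * e r - (\<Sum>j<r. poly (nu r j) u * e j))
        + (\<Sum>j<r. poly (nu r j) u * (poly t u * e j)) = poly t u * (poly ?\<sigma> u * e r)"
      by (simp add: right_diff_distrib sum_distrib_left mult.left_commute)
    finally show ?thesis using True by (simp add: mult.assoc)
  next
    case False
    then have "poly ?\<sigma> u * (poly t u * e i) \<in> P" using t(2)[of i] that P by (auto intro: ideal_mult)
    then show ?thesis unfolding poly_mult by (simp add: mult_ac)
  qed
  then show ?case using SS[OF t(1) \<sigma>] by blast
qed

definition coeffs_in :: "'r::comm_ring_1 set \<Rightarrow> 'r poly \<Rightarrow> bool"
  where "coeffs_in B Q \<longleftrightarrow> (\<forall>i. coeff Q i \<in> B)"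

text \<open>
  Modulo \<open>P\<close>, the ring is generated as a module over \<open>B\<close> by \<open>e 0, \<dots>, e (r - 1)\<close>.
\<close>

definition finite_mod :: "'r::comm_ring_1 set \<Rightarrow> 'r set \<Rightarrow> (nat \<Rightarrow> 'r) \<Rightarrow> nat \<Rightarrow> bool"
  where "finite_mod P B e r \<longleftrightarrow> (\<forall>f. \<exists>b. (\<forall>j<r. b j \<in> B) \<and> f - (\<Sum>j<r. b j * e j) \<in> P)"

lemma coeffs_in_add: "is_subring B \<Longrightarrow> coeffs_in B p \<Longrightarrow> coeffs_in B q \<Longrightarrow> coeffs_in B (p + q)"
  and coeffs_in_diff: "is_subring B \<Longrightarrow> coeffs_in B p \<Longrightarrow> coeffs_in B q \<Longrightarrow> coeffs_in B (p - q)"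
  and coeffs_in_mult: "is_subring B \<Longrightarrow> coeffs_in B p \<Longrightarrow> coeffs_in B q \<Longrightarrow> coeffs_in B (p * q)"
  and coeffs_in_const: "is_subring B \<Longrightarrow> b \<in> B \<Longrightarrow> coeffs_in B [:b:]"
  and coeffs_in_pCons: "is_subring B \<Longrightarrow> b \<in> B \<Longrightarrow> coeffs_in B p \<Longrightarrow> coeffs_in B (pCons b p)"
  and coeffs_in_1: "is_subring B \<Longrightarrow> coeffs_in B 1"
  and coeffs_in_0: "is_subring B \<Longrightarrow> coeffs_in B 0"
  and coeffs_in_smult: "is_subring B \<Longrightarrow> b \<in> B \<Longrightarrow> coeffs_in B p \<Longrightarrow> coeffs_in B (smult b p)"
  and coeffs_in_monom: "is_subring B \<Longrightarrow> b \<in> B \<Longrightarrow> coeffs_in B (monom b n)"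
  by (auto simp: coeffs_in_def coeff_mult coeff_pCons coeff_1 subring_0 subring_1
      intro: subring_add subring_diff subring_mult subring_sum split: nat.splits)

lemma coeff_mult_top:
  assumes "\<And>i. i > a \<Longrightarrow> coeff p i = 0" "\<And>i. i > b \<Longrightarrow> coeff q i = 0"
  shows "coeff (p * q) (a + b) = coeff p a * coeff q b"
proof -
  have "coeff (p * q) (a + b) = (\<Sum>i\<le>a+b. coeff p i * coeff q (a + b - i))" by (rule coeff_mult)
  also have "\<dots> = (\<Sum>i\<in>{a}. coeff p i * coeff q (a + b - i))"
  proof (rule sum.mono_neutral_right)
    show "\<forall>i\<in>{..a + b} - {a}. coeff p i * coeff q (a + b - i) = 0"
    proof
      fix i assume "i \<in> {..a + b} - {a}"
      then consider "i > a" | "a + b - i > b" by fastforce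
      then show "coeff p i * coeff q (a + b - i) = 0" by cases (use assms in auto)
    qed
  qed auto
  finally show ?thesis by simp
qed

lemma coeff_mult_above:
  assumes "\<And>i. i > a \<Longrightarrow> coeff p i = 0" "\<And>i. i \<ge> b \<Longrightarrow> coeff q i = 0" "k \<ge> a + b"
  shows "coeff (p * q) k = 0"
  unfolding coeff_mult
proof (rule sum.neutral, rule ballI)
  fix i assume "i \<in> {..k}"
  then have "i > a \<or> k - i \<ge> b" using assms(3) by auto
  then show "coeff p i * coeff q (k - i) = 0" using assms by auto
qed

lemma finite_mod_annihilates:
  assumes "is_ideal P" "finite_mod P B e r" "\<And>i. i < r \<Longrightarrow> x * e i \<in> P"
  shows "x \<in> P"
proof -
  obtain b where "1 - (\<Sum>j<r. b j * e j) \<in> P" using assms(2) unfolding finite_mod_def by blast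
  then have "x * (1 - (\<Sum>j<r. b j * e j)) \<in> P" by (rule ideal_mult[OF assms(1)])
  moreover have "(\<Sum>j<r. b j * (x * e j)) \<in> P"
  proof (rule ideal_sum[OF assms(1)])
    show "b j * (x * e j) \<in> P" if "j \<in> {..<r}" for j
      by (rule ideal_mult[OF assms(1) assms(3)]) (use that in auto)
  qed
  ultimately have "x * (1 - (\<Sum>j<r. b j * e j)) + (\<Sum>j<r. b j * (x * e j)) \<in> P"
    by (rule ideal_add[OF assms(1)])
  then show ?thesis by (simp add: right_diff_distrib sum_distrib_left mult_ac)
qed

text \<open>
  Multiplication by \<open>u\<close> expresses every \<open>u e\<^sub>i\<close> through the generators, so the \<open>e\<^sub>i\<close> solve a
  linear system with diagonal entries \<open>X - b\<^sub>i\<^sub>i\<close> and constant other entries, evaluated at \<open>u\<close>.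
  Elimination yields a monic polynomial in \<open>u\<close> that annihilates all generators, hence 1.
\<close>

lemma integral_over_finite:
  fixes P B :: "'r::comm_ring_1 set"
  assumes P: "is_ideal P" and B: "is_subring B" and fin: "finite_mod P B e r"
  shows "\<exists>F. coeffs_in B F \<and> lead_coeff F = 1 \<and> poly F u \<in> P"
proof -
  define S where "S = (\<lambda>d. {F. coeffs_in B F \<and> coeff F d = 1 \<and> (\<forall>i>d. coeff F i = 0)})"
  define N where "N = (\<lambda>d. {F. coeffs_in B F \<and> (\<forall>i\<ge>d. coeff F i = 0)})"
  have "\<forall>i. \<exists>b. (\<forall>j<r. b j \<in> B) \<and> u * e i - (\<Sum>j<r. b j * e j) \<in> P"
    using fin unfolding finite_mod_def by blast
  then obtain b where b: "\<And>i j. j < r \<Longrightarrow> b i j \<in> B"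
    "\<And>i. u * e i - (\<Sum>j<r. b i j * e j) \<in> P" by metis
  have "\<exists>d'. \<exists>t\<in>S d'. \<forall>i<r. poly t u * e i \<in> P"
  proof (rule linear_elimination[where s = "\<lambda>i. [:0,1:]" and nu = "\<lambda>i j. [:b i j:]" and N = N and d = 1])
    show "is_ideal P" by (rule P)
    show "1 \<in> S 0" using B by (auto simp: S_def coeffs_in_1)
    show "s * t \<in> S (a + c)" if "s \<in> S a" "t \<in> S c" for a c s t
    proof -
      have "coeff (s * t) k = 0" if "k > a + c" for k
        by (rule coeff_mult_above[of a s "Suc c" t]) (use that \<open>s \<in> S a\<close> \<open>t \<in> S c\<close> in \<open>auto simp: S_def\<close>)
      then show ?thesis using that B by (auto simp: S_def coeffs_in_mult coeff_mult_top)
    qed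
    show SN: "s * t \<in> N (a + c)" if "s \<in> S a" "t \<in> N c" for a c s t
      using that B by (auto simp: S_def N_def coeffs_in_mult intro: coeff_mult_above)
    show "s * t \<in> N (a + c)" if "s \<in> N a" "t \<in> N c" for a c s t
    proof -
      have "coeff (s * t) k = 0" if "k \<ge> a + c" for k
        by (rule coeff_mult_above[of a s c t]) (use that \<open>s \<in> N a\<close> \<open>t \<in> N c\<close> in \<open>auto simp: N_def\<close>)
      then show ?thesis using that B by (auto simp: N_def coeffs_in_mult)
    qed
    show "s + t \<in> N a" if "s \<in> N a" "t \<in> N a" for a s t
      using that B by (auto simp: N_def coeffs_in_add)
    show "s - t \<in> S a" if "s \<in> S a" "t \<in> N a" for a s t
      using that B by (auto simp: S_def N_def coeffs_in_diff)
    show "[:0,1:] \<in> S 1" using B by (auto simp: S_def coeffs_in_def coeff_pCons subring_0 subring_1 split: nat.splits)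
    show "[:b i j:] \<in> N 1" if "j < r" for i j
      using b(1)[OF that] B by (auto simp: N_def coeffs_in_const coeff_pCons split: nat.splits)
    show "poly [:0,1:] u * e i - (\<Sum>j<r. poly [:b i j:] u * e j) \<in> P" for i using b(2)[of i] by simp
  qed
  then obtain d t where t: "t \<in> S d" "\<forall>i<r. poly t u * e i \<in> P" by blast
  have "degree t \<le> d" using t(1) by (auto simp: S_def intro: degree_le)
  moreover have "degree t \<ge> d" if "(1::'r) \<noteq> 0" using t(1) that by (auto simp: S_def intro: le_degree)
  ultimately have "lead_coeff t = 1"
  proof (cases "(1::'r) = 0")
    case True
    then have "x = y" for x y :: 'r by (metis mult_1 mult_zero_left)
    then show ?thesis by blast
  next
    case False
    then have "degree t = d" using \<open>degree t \<le> d\<close> \<open>(1::'r) \<noteq> 0 \<Longrightarrow> d \<le> degree t\<close> by simp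
    then show ?thesis using t(1) by (simp add: S_def)
  qed
  moreover have "poly t u \<in> P" by (rule finite_mod_annihilates[OF P fin]) (use t in auto)
  ultimately show ?thesis using t(1) by (auto simp: S_def)
qed



section \<open>Polynomial functions on affine space\<close>

inductive polynomial_fun :: "(complex ^ 'n::finite \<Rightarrow> complex) \<Rightarrow> bool" where
  polynomial_fun_const: "polynomial_fun (\<lambda>x. c)"
| polynomial_fun_coord: "polynomial_fun (\<lambda>x. x $ j)"
| polynomial_fun_add: "polynomial_fun f \<Longrightarrow> polynomial_fun g \<Longrightarrow> polynomial_fun (\<lambda>x. f x + g x)"
| polynomial_fun_mult: "polynomial_fun f \<Longrightarrow> polynomial_fun g \<Longrightarrow> polynomial_fun (\<lambda>x. f x * g x)"

lemma polynomial_fun_sum: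
  "(\<And>i. i \<in> A \<Longrightarrow> polynomial_fun (f i)) \<Longrightarrow> polynomial_fun (\<lambda>x. \<Sum>i\<in>A. f i x)"
  by (induction A rule: infinite_finite_induct) (auto intro: polynomial_fun.intros)

lemma polynomial_fun_power: "polynomial_fun f \<Longrightarrow> polynomial_fun (\<lambda>x. f x ^ n)"
  by (induction n) (auto intro: polynomial_fun.intros)

lemma polynomial_fun_prod:
  "(\<And>i. i \<in> A \<Longrightarrow> polynomial_fun (f i)) \<Longrightarrow> polynomial_fun (\<lambda>x. \<Prod>i\<in>A. f i x)"
  by (induction A rule: infinite_finite_induct) (auto intro: polynomial_fun.intros)

lemma polynomial_fun_uminus: "polynomial_fun f \<Longrightarrow> polynomial_fun (\<lambda>x. - f x)"
  using polynomial_fun_mult[OF polynomial_fun_const[of "-1"], of f] by simp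

lemma polynomial_fun_diff: "polynomial_fun f \<Longrightarrow> polynomial_fun g \<Longrightarrow> polynomial_fun (\<lambda>x. f x - g x)"
  using polynomial_fun_add[of f "\<lambda>x. - g x"] polynomial_fun_uminus[of g] by simp

lemma polynomial_fun_compose:
  "polynomial_fun f \<Longrightarrow> (\<And>j. polynomial_fun (\<lambda>x. g x $ j)) \<Longrightarrow> polynomial_fun (\<lambda>x. f (g x))"
  by (induction rule: polynomial_fun.induct) (auto intro: polynomial_fun.intros)

lemma polynomial_fun_matrix: "polynomial_fun (\<lambda>x. (A *v x) $ j)" for A :: "complex ^ 'n ^ 'n::finite"
  unfolding matrix_vector_mult_def by (auto intro!: polynomial_fun.intros polynomial_fun_sum)

lemma polynomial_fun_continuous: "polynomial_fun f \<Longrightarrow> continuous_on UNIV f"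
  by (induction rule: polynomial_fun.induct) (auto intro!: continuous_intros)

text \<open>
  The polynomial ring is represented by polynomial functions; over the complex numbers nothing is lost, and
  substitution of linear maps needs no calculus of exponents.
\<close>

typedef ('n::finite) cpoly = "{f :: complex ^ 'n \<Rightarrow> complex. polynomial_fun f}"
  morphisms ev Cpoly by (auto intro: polynomial_fun_const)

setup_lifting type_definition_cpoly

instantiation cpoly :: (finite) comm_ring_1
begin
lift_definition zero_cpoly :: "'a cpoly" is "\<lambda>x. 0" by (rule polynomial_fun_const)
lift_definition one_cpoly :: "'a cpoly" is "\<lambda>x. 1" by (rule polynomial_fun_const)
lift_definition plus_cpoly :: "'a cpoly \<Rightarrow> 'a cpoly \<Rightarrow> 'a cpoly" is "\<lambda>f g x. f x + g x" by (rule polynomial_fun_add)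
lift_definition times_cpoly :: "'a cpoly \<Rightarrow> 'a cpoly \<Rightarrow> 'a cpoly" is "\<lambda>f g x. f x * g x" by (rule polynomial_fun_mult)
lift_definition uminus_cpoly :: "'a cpoly \<Rightarrow> 'a cpoly" is "\<lambda>f x. - f x" by (rule polynomial_fun_uminus)
lift_definition minus_cpoly :: "'a cpoly \<Rightarrow> 'a cpoly \<Rightarrow> 'a cpoly" is "\<lambda>f g x. f x - g x" by (rule polynomial_fun_diff)
instance by standard (transfer; auto simp: algebra_simps fun_eq_iff)+
end

lemma ev_0 [simp]: "ev 0 x = 0"
  and ev_1 [simp]: "ev 1 x = 1"
  and ev_add [simp]: "ev (f + g) x = ev f x + ev g x"
  and ev_mult [simp]: "ev (f * g) x = ev f x * ev g x"
  and ev_uminus [simp]: "ev (- f) x = - ev f x"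
  and ev_diff [simp]: "ev (f - g) x = ev f x - ev g x"
  by (transfer; simp)+

lemma ev_sum [simp]: "ev (sum f A) x = (\<Sum>i\<in>A. ev (f i) x)"
  by (induction A rule: infinite_finite_induct) auto

lemma ev_power [simp]: "ev (f ^ n) x = ev f x ^ n"
  by (induction n) auto

lemma cpoly_eqI: "(\<And>x. ev f x = ev g x) \<Longrightarrow> f = g"
  by (transfer) auto

lemma polynomial_fun_ev: "polynomial_fun (ev f)"
  using ev by auto

lemma ev_Cpoly: "polynomial_fun f \<Longrightarrow> ev (Cpoly f) = f"
  by (simp add: Cpoly_inverse)

lemma continuous_ev: "continuous_on S (ev f)"
  using polynomial_fun_continuous[OF polynomial_fun_ev] continuous_on_subset by blast

lift_definition cconst :: "complex \<Rightarrow> 'n::finite cpoly" is "\<lambda>c x. c" by (rule polynomial_fun_const)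
lift_definition ccoord :: "'n \<Rightarrow> 'n::finite cpoly" is "\<lambda>j x. x $ j" by (rule polynomial_fun_coord)

lemma ev_cconst [simp]: "ev (cconst c) x = c" and ev_ccoord [simp]: "ev (ccoord j) x = x $ j"
  by (transfer; simp)+

lemma cpoly_induct [case_names const coord add mult]:
  assumes "\<And>c. P (cconst c)" "\<And>j. P (ccoord j)"
    "\<And>f g. P f \<Longrightarrow> P g \<Longrightarrow> P (f + g)" "\<And>f g. P f \<Longrightarrow> P g \<Longrightarrow> P (f * g)"
  shows "P (f :: 'n::finite cpoly)"
proof -
  have "P (Cpoly h)" if "polynomial_fun h" for h
    using that
  proof induction
    case (polynomial_fun_const c)
    have "Cpoly (\<lambda>x::complex^'n. c) = cconst c" by (intro cpoly_eqI) (simp add: ev_Cpoly polynomial_fun.intros)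
    then show ?case using assms by simp
  next
    case (polynomial_fun_coord j)
    have "Cpoly (\<lambda>x::complex^'n. x $ j) = ccoord j" by (intro cpoly_eqI) (simp add: ev_Cpoly polynomial_fun.intros)
    then show ?case using assms by simp
  next
    case (polynomial_fun_add f g)
    have "Cpoly (\<lambda>x. f x + g x) = Cpoly f + Cpoly g"
      by (intro cpoly_eqI) (simp add: ev_Cpoly polynomial_fun_add polynomial_fun.intros)
    then show ?case using assms polynomial_fun_add by simp
  next
    case (polynomial_fun_mult f g)
    have "Cpoly (\<lambda>x. f x * g x) = Cpoly f * Cpoly g"
      by (intro cpoly_eqI) (simp add: ev_Cpoly polynomial_fun_mult polynomial_fun.intros)
    then show ?case using assms polynomial_fun_mult by simp
  qed
  from this[OF polynomial_fun_ev] show ?thesis by (simp add: ev_inverse)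
qed

lemma ideal_imp_cong:
  assumes I: "is_ideal I" and j: "\<And>j. ccoord j - cconst (w $ j) \<in> I"
  shows "f - cconst (ev f w) \<in> I"
proof (induction f rule: cpoly_induct)
  case (const c)
  then show ?case using ideal_zero[OF I] by simp
next
  case (coord j)
  then show ?case using j by simp
next
  case (add f g)
  have "(f + g) - cconst (ev (f + g) w) = (f - cconst (ev f w)) + (g - cconst (ev g w))"
    by (rule cpoly_eqI) simp
  then show ?case using ideal_add[OF I add] by (simp only:)
next
  case (mult f g)
  have "(f * g) - cconst (ev (f * g) w) = g * (f - cconst (ev f w)) + cconst (ev f w) * (g - cconst (ev g w))"
    by (rule cpoly_eqI) (simp add: algebra_simps)
  then show ?case using ideal_add[OF I ideal_mult[OF I mult(1)] ideal_mult[OF I mult(2)]] by (simp only:)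
qed

lemma map_poly_hom_mult:
  assumes h0: "h 0 = 0" and ha: "\<And>a b. h (a + b) = h a + h b" and hm: "\<And>a b. h (a * b) = h a * h b"
  shows "map_poly h (p * q) = map_poly h p * map_poly h q"
proof (rule poly_eqI)
  have "h (sum f A) = (\<Sum>i\<in>A. h (f i))" for f and A :: "nat set"
    by (induction A rule: infinite_finite_induct) (auto simp: h0 ha)
  then show "coeff (map_poly h (p * q)) n = coeff (map_poly h p * map_poly h q) n" for n
    by (simp add: coeff_map_poly h0 coeff_mult hm)
qed

definition evp :: "complex ^ 'n \<Rightarrow> 'n::finite cpoly poly \<Rightarrow> complex poly"
  where "evp x Q = map_poly (\<lambda>f. ev f x) Q"

lemma coeff_evp [simp]: "coeff (evp x Q) i = ev (coeff Q i) x"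
  by (simp add: evp_def coeff_map_poly)

lemma evp_0 [simp]: "evp x 0 = 0" and evp_1 [simp]: "evp x 1 = 1"
  and evp_add [simp]: "evp x (p + q) = evp x p + evp x q"
  and evp_diff [simp]: "evp x (p - q) = evp x p - evp x q"
  and evp_mult [simp]: "evp x (p * q) = evp x p * evp x q"
  and evp_pCons [simp]: "evp x (pCons f p) = pCons (ev f x) (evp x p)"
  and evp_smult [simp]: "evp x (smult f p) = smult (ev f x) (evp x p)"
  by (auto simp: evp_def map_poly_hom_mult[of "\<lambda>f. ev f x"] map_poly_pCons map_poly_1' map_poly_monom
      intro!: poly_eqI simp: coeff_map_poly)

lemma ev_poly: "ev (poly Q u) x = poly (evp x Q) (ev u x)"
  by (induction Q) (auto simp: evp_def map_poly_pCons)

lemma degree_evp_le: "degree (evp x Q) \<le> degree Q"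
  by (rule degree_le) (simp add: coeff_eq_0)

lemma degree_evp_monic: "lead_coeff Q = 1 \<Longrightarrow> degree (evp x Q) = degree Q"
  by (rule antisym[OF degree_evp_le le_degree]) simp

lemma poly_ext: "(\<And>t. poly p t = poly q t) \<Longrightarrow> p = q" for p q :: "complex poly"
  using poly_eq_poly_eq_iff[of p q] by auto

lemma poly_sum_upto: "degree p \<le> n \<Longrightarrow> poly p x = (\<Sum>i\<le>n. coeff p i * x ^ i)" for p :: "'a::comm_ring_1 poly"
  unfolding poly_altdef by (rule sum.mono_neutral_left) (auto simp: coeff_eq_0)

lemma ev_on_line:
  "\<exists>\<alpha>::'n::finite cpoly poly. coeff \<alpha> 0 = cconst (ev f p) \<and> (\<forall>v t. ev f (p + t *s v) = poly (evp v \<alpha>) t)"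
proof (induction f rule: cpoly_induct)
  case (const c)
  then show ?case by (intro exI[of _ "[:cconst c:]"]) simp
next
  case (coord j)
  then show ?case by (intro exI[of _ "[:cconst (p $ j), ccoord j:]"]) simp
next
  case (add f g)
  then obtain a b where "coeff a 0 = cconst (ev f p) \<and> (\<forall>v t. ev f (p + t *s v) = poly (evp v a) t)"
    "coeff b 0 = cconst (ev g p) \<and> (\<forall>v t. ev g (p + t *s v) = poly (evp v b) t)" by auto
  moreover have "cconst (ev f p) + cconst (ev g p) = cconst (ev (f + g) p)" by (rule cpoly_eqI) simp
  ultimately show ?case by (intro exI[of _ "a + b"]) simp
next
  case (mult f g)
  then obtain a b where "coeff a 0 = cconst (ev f p) \<and> (\<forall>v t. ev f (p + t *s v) = poly (evp v a) t)"
    "coeff b 0 = cconst (ev g p) \<and> (\<forall>v t. ev g (p + t *s v) = poly (evp v b) t)" by auto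
  moreover have "cconst (ev f p) * cconst (ev g p) = cconst (ev (f * g) p)" by (rule cpoly_eqI) simp
  ultimately show ?case by (intro exI[of _ "a * b"]) (simp add: coeff_mult_0)
qed

text \<open>
  The restriction of \<open>f\<close> to the line through \<open>p\<close> in direction \<open>v\<close>, as a polynomial in the parameter.
\<close>

definition on_line :: "complex ^ 'n \<Rightarrow> complex ^ 'n \<Rightarrow> 'n::finite cpoly \<Rightarrow> complex poly"
  where "on_line p v f = (SOME q. \<forall>t. poly q t = ev f (p + t *s v))"

lemma poly_on_line [simp]: "poly (on_line p v f) t = ev f (p + t *s v)"
proof -
  obtain \<alpha> :: "'a cpoly poly" where "\<forall>v t. ev f (p + t *s v) = poly (evp v \<alpha>) t"
    using ev_on_line[of f p] by blast
  then have "\<exists>q. \<forall>t. poly q t = ev f (p + t *s v)" by (intro exI[of _ "evp v \<alpha>"]) simp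
  from someI_ex[OF this] show ?thesis unfolding on_line_def by simp
qed

lemma on_line_hom: "on_line p v 0 = 0" "on_line p v 1 = 1" "on_line p v (f + g) = on_line p v f + on_line p v g"
  "on_line p v (f * g) = on_line p v f * on_line p v g"
  by (auto simp: poly_eq_poly_eq_iff[symmetric] fun_eq_iff)

instance cpoly :: (finite) idom
proof
  fix f g :: "'a cpoly"
  assume "f \<noteq> 0" "g \<noteq> 0"
  then obtain p where p: "ev f p \<noteq> 0" using cpoly_eqI[of f 0] by auto
  show "f * g \<noteq> 0"
  proof
    assume fg: "f * g = 0"
    have "ev g x = 0" for x
    proof -
      have "on_line p (x - p) f * on_line p (x - p) g = 0"
        by (simp add: on_line_hom(4)[symmetric] fg on_line_hom(1))
      moreover have "on_line p (x - p) f \<noteq> 0"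
        using p poly_on_line[of p "x - p" f 0] by (auto simp del: poly_on_line)
      ultimately have "on_line p (x - p) g = 0" by simp
      then show ?thesis using poly_on_line[of p "x - p" g 1] by simp
    qed
    then show False using \<open>g \<noteq> 0\<close> cpoly_eqI[of g 0] by simp
  qed
qed

lemma evp_pderiv: "evp x (pderiv Q) = pderiv (evp x Q)"
proof -
  have "ev (of_nat n) x = of_nat n" for n by (induction n) auto
  then show ?thesis by (intro poly_eqI) (simp add: coeff_pderiv)
qed

text \<open>
  Restriction to lines replaces factoriality of the polynomial ring. On the line through \<open>p\<close> in direction \<open>v\<close>
  the quotient is a polynomial in the parameter of degree bounded independently of \<open>v\<close>. Since
  \<open>b(p) \<noteq> 0\<close>, its coefficients come from power series division at \<open>p\<close>, so they are polynomials in \<open>v\<close>.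
  The value at parameter 1 is the global quotient.
\<close>

lemma dvd_if_dvd_on_lines:
  fixes a b :: "'n::finite cpoly"
  assumes p: "ev b p \<noteq> 0" and dvd: "\<And>v. on_line p v b dvd on_line p v a"
  shows "\<exists>c. a = b * c"
proof -
  obtain \<alpha> where \<alpha>: "\<And>v t. ev a (p + t *s v) = poly (evp v \<alpha>) t" using ev_on_line[of a p] by auto
  obtain \<beta> where \<beta>0: "coeff \<beta> 0 = cconst (ev b p)" and \<beta>: "\<And>v t. ev b (p + t *s v) = poly (evp v \<beta>) t"
    using ev_on_line[of b p] by auto
  have la: "on_line p v a = evp v \<alpha>" and lb: "on_line p v b = evp v \<beta>" for v
    by (rule poly_ext, simp add: \<alpha>, rule poly_ext, simp add: \<beta>)
  have "\<forall>v. \<exists>q. evp v \<alpha> = evp v \<beta> * q" using dvd by (simp add: la lb dvd_def)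
  from choice[OF this] obtain q where q: "\<And>v. evp v \<alpha> = evp v \<beta> * q v" by auto
  have b0: "coeff (evp v \<beta>) 0 \<noteq> 0" for v using \<beta>0 p by simp
  have dq: "degree (q v) \<le> degree \<alpha>" for v
  proof (cases "q v = 0")
    case False
    have "evp v \<beta> \<noteq> 0" using b0[of v] by (auto simp del: coeff_evp)
    then have "degree (evp v \<alpha>) = degree (evp v \<beta>) + degree (q v)"
      unfolding q[of v] using False by (rule degree_mult_eq)
    then show ?thesis using degree_evp_le[of v \<alpha>] by linarith
  qed simp
  have ex: "\<exists>c. \<forall>v. coeff (q v) i = ev c v" for i
  proof (induction i rule: less_induct)
    case (less i)
    then have "\<forall>j. \<exists>c. j < i \<longrightarrow> (\<forall>v. coeff (q v) j = ev c v)" by auto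
    from choice[OF this] obtain c where c: "\<And>j v. j < i \<Longrightarrow> coeff (q v) j = ev (c j) v" by auto
    let ?c = "cconst (1 / ev b p) * (coeff \<alpha> i - (\<Sum>j<i. coeff \<beta> (i - j) * c j))"
    have "coeff (q v) i = ev ?c v" for v
    proof -
      let ?s = "\<Sum>j<i. ev (coeff \<beta> (i - j)) v * ev (c j) v"
      have "ev (coeff \<alpha> i) v = coeff (q v * evp v \<beta>) i"
        using arg_cong[OF q[of v], of "\<lambda>h. coeff h i"] by (simp add: mult.commute)
      also have "\<dots> = (\<Sum>j\<le>i. coeff (q v) j * coeff (evp v \<beta>) (i - j))"
        by (rule coeff_mult)
      also have "\<dots> = (\<Sum>j<i. coeff (q v) j * coeff (evp v \<beta>) (i - j)) + coeff (q v) i * ev b p"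
        using \<beta>0 by (simp add: lessThan_Suc_atMost[symmetric])
      also have "(\<Sum>j<i. coeff (q v) j * coeff (evp v \<beta>) (i - j)) = ?s"
        by (rule sum.cong) (simp_all add: c mult.commute)
      finally have "ev (coeff \<alpha> i) v - ?s = coeff (q v) i * ev b p" by simp
      moreover have "ev ?c v = (1 / ev b p) * (ev (coeff \<alpha> i) v - ?s)" by simp
      ultimately show ?thesis using p by simp
    qed
    then show ?case by (intro exI[of _ ?c] allI)
  qed
  then have "\<forall>i. \<exists>c. \<forall>v. coeff (q v) i = ev c v" by simp
  from choice[OF this] obtain c where c: "\<And>i v. coeff (q v) i = ev (c i) v" by auto
  define g where "g = (\<lambda>x. \<Sum>i\<le>degree \<alpha>. ev (c i) (x - p))"
  have "polynomial_fun (\<lambda>x. ev (c i) (x - p))" for i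
  proof (rule polynomial_fun_compose[of "ev (c i)" "\<lambda>x. x - p", OF polynomial_fun_ev])
    show "polynomial_fun (\<lambda>x. (x - p) $ j)" for j
      unfolding vector_minus_component by (rule polynomial_fun_diff[OF polynomial_fun_coord polynomial_fun_const])
  qed
  then have pg: "polynomial_fun g" unfolding g_def by (rule polynomial_fun_sum)
  have "a = b * Cpoly g"
  proof (rule cpoly_eqI)
    fix x
    have "poly (q (x - p)) 1 = (\<Sum>i\<le>degree \<alpha>. coeff (q (x - p)) i)"
      by (simp add: poly_sum_upto[OF dq])
    then have g: "poly (q (x - p)) 1 = g x" by (simp add: g_def c)
    have "ev a x = poly (evp (x - p) \<alpha>) 1" using \<alpha>[of 1 "x - p"] by simp
    also have "\<dots> = poly (evp (x - p) \<beta>) 1 * g x" by (simp add: q g)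
    also have "poly (evp (x - p) \<beta>) 1 = ev b x" using \<beta>[of 1 "x - p"] by simp
    finally show "ev a x = ev (b * Cpoly g) x" by (simp add: ev_Cpoly[OF pg])
  qed
  then show ?thesis ..
qed

text \<open>
  For idempotent \<open>\<pi>\<close> these are the polynomials that factor through the projection \<open>\<pi>\<close>, a polynomial
  ring in as many variables as the rank of \<open>\<pi>\<close>.
\<close>

definition invariants :: "complex ^ 'n ^ 'n \<Rightarrow> 'n::finite cpoly set"
  where "invariants \<pi> = {f. \<forall>x. ev f (\<pi> *v x) = ev f x}"

lemma invariants_iff: "f \<in> invariants \<pi> \<longleftrightarrow> (\<forall>x. ev f (\<pi> *v x) = ev f x)"
  by (simp add: invariants_def)

lemma subring_invariants: "is_subring (invariants \<pi>)"
  by (auto simp: is_subring_def invariants_def)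

lemma subst_cpoly:
  fixes f :: "'n::finite cpoly" and A :: "complex ^ 'n ^ 'n"
  shows "\<exists>g. \<forall>x. ev g x = ev f (A *v x)"
proof -
  have "polynomial_fun (\<lambda>x. ev f (A *v x))"
    by (rule polynomial_fun_compose[of "ev f" "\<lambda>x. A *v x", OF polynomial_fun_ev]) (rule polynomial_fun_matrix)
  from ev_Cpoly[OF this] show ?thesis by (intro exI[of _ "Cpoly (\<lambda>x. ev f (A *v x))"]) simp
qed

lemma invariants_dvd:
  fixes a b :: "'n::finite cpoly"
  assumes idem: "\<pi> ** \<pi> = \<pi>" and "a \<in> invariants \<pi>" "b \<in> invariants \<pi>" "a = b * c"
  shows "\<exists>c'\<in>invariants \<pi>. a = b * c'"
proof -
  obtain c' where c': "\<forall>x. ev c' x = ev c (\<pi> *v x)" using subst_cpoly[of c \<pi>] ..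
  have c'': "c' \<in> invariants \<pi>" unfolding invariants_iff c'[rule_format] matrix_vector_mul_assoc idem by simp
  have "a = b * c'"
  proof (rule cpoly_eqI)
    fix x
    have "ev a x = ev a (\<pi> *v x)" using assms(2) unfolding invariants_iff by simp
    also have "\<dots> = ev b (\<pi> *v x) * ev c (\<pi> *v x)" unfolding assms(4) by (rule ev_mult)
    also have "ev b (\<pi> *v x) = ev b x" using assms(3) unfolding invariants_iff by simp
    also have "ev b x * ev c (\<pi> *v x) = ev (b * c') x" using c' by simp
    finally show "ev a x = ev (b * c') x" .
  qed
  with c'' show ?thesis ..
qed


section \<open>Minimal polynomials over the ring of a projection, and lying over\<close>

lemma smult_cancel_left: "c \<noteq> 0 \<Longrightarrow> smult c p = smult c q \<Longrightarrow> p = q" for c :: "'a::idom"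
  by (rule poly_eqI) (metis coeff_smult mult_left_cancel)

text \<open>
  Gauss's lemma: \<open>F\<close> is primitive, so it is the product of the primitive parts of \<open>G\<close> and \<open>Q\<close> up to a unit, and the primitive
  part of \<open>Q\<close> has an invertible leading coefficient.
\<close>

lemma lead_coeff_dvd_of_monic_factor:
  fixes F G Q :: "complex poly poly"
  assumes eq: "smult (q ^ k) F = G * Q" and F: "lead_coeff F = 1" and Q: "lead_coeff Q = q" and q: "q \<noteq> 0"
  shows "q dvd coeff Q i"
proof -
  let ?c = "content Q" and ?g = "content G"
  have "content F dvd 1" using content_dvd_coeff[of F "degree F"] F by simp
  then have "normalize (content F) = 1" by (rule is_unit_normalize)
  then have "content F = 1" by simp
  then have n: "normalize (q ^ k) = ?g * ?c"
    using arg_cong[OF eq, of content] by (simp add: content_mult)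
  define w where "w = unit_factor (q ^ k)"
  have w: "is_unit w" "q ^ k = w * normalize (q ^ k)"
    unfolding w_def using q by (simp_all only: unit_factor_is_unit power_not_zero not_False_eq_True unit_factor_mult_normalize)
  have g0: "?g * ?c \<noteq> 0" unfolding n[symmetric] using q by simp
  have "smult (?g * ?c) (smult w F) = smult (?g * ?c) (primitive_part G * primitive_part Q)"
  proof -
    have "smult (?g * ?c) (smult w F) = smult (q ^ k) F"
      using w(2) n by (simp add: mult.commute)
    also have "\<dots> = smult ?g (primitive_part G) * smult ?c (primitive_part Q)"
      by (simp only: eq content_times_primitive_part)
    also have "\<dots> = smult (?g * ?c) (primitive_part G * primitive_part Q)"
      by (simp only: mult_smult_left mult_smult_right smult_smult mult.commute[of ?c ?g])
    finally show ?thesis .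
  qed
  then have "smult w F = primitive_part G * primitive_part Q" by (rule smult_cancel_left[OF g0])
  then have "lead_coeff (smult w F) = lead_coeff (primitive_part G) * lead_coeff (primitive_part Q)"
    by (simp add: lead_coeff_mult)
  then have "w = lead_coeff (primitive_part G) * lead_coeff (primitive_part Q)"
    using F by (simp only: lead_coeff_smult mult_1_right)
  with w(1) have "is_unit (lead_coeff (primitive_part G) * lead_coeff (primitive_part Q))" by (simp only:)
  then have u: "is_unit (lead_coeff (primitive_part Q))" by (rule dvd_mult_right)
  have "lead_coeff (smult ?c (primitive_part Q)) = ?c * lead_coeff (primitive_part Q)"
    by (rule lead_coeff_smult)
  then have "q = ?c * lead_coeff (primitive_part Q)"
    by (simp only: content_times_primitive_part Q)
  then have "q dvd ?c" using mult_unit_dvd_iff[OF u, of ?c ?c] by (simp only: dvd_refl)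
  also have "?c dvd coeff Q i" by (rule content_dvd_coeff)
  finally show ?thesis .
qed

lemma degree_less_or_0: "(\<And>i. i \<ge> n \<Longrightarrow> coeff p i = 0) \<Longrightarrow> p = 0 \<or> degree p < n"
  by (metis leading_coeff_0_iff not_le_imp_less)

lemma pseudo_division_in_subring:
  fixes Q :: "'r::idom poly"
  assumes B: "is_subring B" and Q: "coeffs_in B Q" "Q \<noteq> 0" and R: "coeffs_in B R"
  shows "\<exists>k G S. coeffs_in B G \<and> coeffs_in B S \<and> smult (lead_coeff Q ^ k) R = G * Q + S \<and> (S = 0 \<or> degree S < degree Q)"
  using R
proof (induction "if R = 0 then 0 else Suc (degree R)" arbitrary: R rule: less_induct)
  case less
  show ?case
  proof (cases "R = 0 \<or> degree R < degree Q")
    case True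
    then show ?thesis using less.prems coeffs_in_0[OF B] by (intro exI[of _ 0] exI[of _ R]) simp
  next
    case False
    let ?n = "degree R" and ?m = "degree Q"
    let ?M = "monom (lead_coeff R) (?n - ?m)"
    define R' where "R' = smult (lead_coeff Q) R - ?M * Q"
    have lc: "lead_coeff Q \<in> B" "lead_coeff R \<in> B" using Q less.prems by (auto simp: coeffs_in_def)
    have R': "coeffs_in B R'" unfolding R'_def
      using lc less.prems Q by (intro coeffs_in_diff coeffs_in_smult coeffs_in_mult coeffs_in_monom B)
    have "coeff R' i = 0" if "i \<ge> ?n" for i
    proof (cases "i = ?n")
      case True
      then show ?thesis using False by (simp add: R'_def coeff_monom_mult)
    next
      case False2: False
      then have "i > ?n" using that by simp
      moreover then have "i - (?n - ?m) > ?m" using False by simp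
      ultimately show ?thesis by (simp add: R'_def coeff_monom_mult coeff_eq_0)
    qed
    then have "R' = 0 \<or> degree R' < ?n" by (rule degree_less_or_0)
    then have "(if R' = 0 then 0 else Suc (degree R')) < (if R = 0 then 0 else Suc (degree R))" using False by auto
    from less.hyps[OF this R'] obtain k G S where *: "coeffs_in B G" "coeffs_in B S"
      "smult (lead_coeff Q ^ k) R' = G * Q + S" "S = 0 \<or> degree S < degree Q" by blast
    have "smult (lead_coeff Q ^ Suc k) R = (G + smult (lead_coeff Q ^ k) ?M) * Q + S"
      using *(3) by (simp add: R'_def smult_diff_right algebra_simps)
    moreover have "coeffs_in B (G + smult (lead_coeff Q ^ k) ?M)"
      using *(1) lc by (intro coeffs_in_add coeffs_in_smult coeffs_in_monom subring_power B)
    ultimately show ?thesis using *(2,4) by blast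
  qed
qed

lemma degree_map_poly_eq: "h 0 = 0 \<Longrightarrow> h (lead_coeff Q) \<noteq> 0 \<Longrightarrow> degree (map_poly h Q) = degree Q"
  by (intro antisym degree_le le_degree) (auto simp: coeff_map_poly coeff_eq_0)

text \<open>
  A Noether normalization of the zero set of \<open>P\<close>, without a choice of coordinates: \<open>\<pi>\<close> projects the zero set
  finitely and, by \<open>free\<close>, dominantly onto the range of \<open>\<pi>\<close>.
\<close>

locale normalization =
  fixes P :: "'n::finite cpoly set" and \<pi> :: "complex ^ 'n ^ 'n" and e :: "nat \<Rightarrow> 'n cpoly" and r :: nat
  assumes prime: "is_prime_ideal P" and idem: "\<pi> ** \<pi> = \<pi>"
    and free: "\<And>f. f \<in> invariants \<pi> \<Longrightarrow> f \<in> P \<Longrightarrow> f = 0"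
    and fin: "finite_mod P (invariants \<pi>) e r"
begin

abbreviation "B \<equiv> invariants \<pi>"

lemma idealP: "is_ideal P" using prime by (rule prime_imp_ideal)

definition is_minpoly :: "'n cpoly \<Rightarrow> 'n cpoly poly \<Rightarrow> bool"
  where "is_minpoly u Q \<longleftrightarrow> coeffs_in B Q \<and> lead_coeff Q = 1 \<and> poly Q u \<in> P \<and>
    (\<forall>R. coeffs_in B R \<longrightarrow> poly R u \<in> P \<longrightarrow> Q dvd R)"

text \<open>
  Take a nonzero relation \<open>Q\<^sub>0\<close> of \<open>u\<close> of least degree, with leading coefficient \<open>q\<close>. Pseudo-division of a
  monic relation by \<open>Q\<^sub>0\<close> leaves no remainder. On every line through a point where \<open>q\<close> does not
  vanish, Gauss's lemma shows that \<open>q\<close> divides all coefficients of \<open>Q\<^sub>0\<close>; by \<open>dvd_if_dvd_on_lines\<close> it does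
  so globally. Dividing by \<open>q\<close> gives a monic relation, which still lies in \<open>P\<close> because \<open>P\<close> is prime. This is where
  normality of the ring \<open>B\<close> enters.
\<close>

lemma ex_minpoly: "\<exists>Q. is_minpoly u Q"
proof -
  obtain F where F: "coeffs_in B F" "lead_coeff F = 1" "poly F u \<in> P"
    using integral_over_finite[OF idealP subring_invariants fin] by blast
  let ?A = "\<lambda>Q. coeffs_in B Q \<and> Q \<noteq> 0 \<and> poly Q u \<in> P"
  have "?A F" using F by auto
  from ex_has_least_nat[of ?A, OF this, of degree]
  obtain Q0 where Q0: "coeffs_in B Q0" "Q0 \<noteq> 0" "poly Q0 u \<in> P"
    and min: "\<And>R. coeffs_in B R \<Longrightarrow> R \<noteq> 0 \<Longrightarrow> poly R u \<in> P \<Longrightarrow> degree Q0 \<le> degree R" by blast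
  let ?q = "lead_coeff Q0"
  have q: "?q \<noteq> 0" "?q \<in> B" using Q0 by (auto simp: coeffs_in_def)
  obtain k G S where GS: "coeffs_in B S" "smult (?q ^ k) F = G * Q0 + S" "S = 0 \<or> degree S < degree Q0"
    using pseudo_division_in_subring[OF subring_invariants Q0(1,2) F(1)] by blast
  have "poly S u = ?q ^ k * poly F u - poly G u * poly Q0 u"
    using arg_cong[OF GS(2), of "\<lambda>p. poly p u"] by simp
  then have "poly S u \<in> P" using F(3) Q0(3) idealP by (simp add: ideal_diff ideal_mult)
  then have S0: "S = 0" using min[OF GS(1)] GS(3) by fastforce
  obtain p where p: "ev ?q p \<noteq> 0" using q(1) cpoly_eqI[of ?q 0] by auto
  have "\<exists>c\<in>B. coeff Q0 i = ?q * c" for i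
  proof -
    have "on_line p v ?q dvd on_line p v (coeff Q0 i)" for v
    proof -
      let ?h = "on_line p v"
      have h0: "?h 0 = 0" by (rule on_line_hom(1))
      have hq: "?h ?q \<noteq> 0" using p poly_on_line[of p v ?q 0] by (auto simp del: poly_on_line)
      have pw: "?h (a ^ k) = ?h a ^ k" for a k by (induction k) (auto simp: on_line_hom)
      have "smult (?h ?q ^ k) (map_poly ?h F) = map_poly ?h (smult (?q ^ k) F)"
        by (simp add: map_poly_smult on_line_hom pw)
      also have "\<dots> = map_poly ?h G * map_poly ?h Q0"
        using GS(2) S0 map_poly_hom_mult[of ?h, OF h0 on_line_hom(3) on_line_hom(4)] by simp
      finally have eq: "smult (?h ?q ^ k) (map_poly ?h F) = map_poly ?h G * map_poly ?h Q0" .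
      have dF: "degree (map_poly ?h F) = degree F"
        by (rule degree_map_poly_eq[where h = ?h, OF h0]) (simp add: F(2) on_line_hom)
      have dQ: "degree (map_poly ?h Q0) = degree Q0"
        by (rule degree_map_poly_eq[where h = ?h, OF h0 hq])
      have "?h ?q dvd coeff (map_poly ?h Q0) i"
        by (rule lead_coeff_dvd_of_monic_factor[OF eq])
          (simp_all add: dF dQ coeff_map_poly h0 F(2) on_line_hom hq)
      then show ?thesis by (simp add: coeff_map_poly h0)
    qed
    then obtain c where "coeff Q0 i = ?q * c" using dvd_if_dvd_on_lines[OF p] by blast
    moreover have "coeff Q0 i \<in> B" using Q0(1) by (simp add: coeffs_in_def)
    ultimately show ?thesis using invariants_dvd[OF idem _ q(2)] by blast
  qed
  then have "\<forall>i. \<exists>c. c \<in> B \<and> coeff Q0 i = ?q * c" by blast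
  from choice[OF this] obtain c where c: "\<And>i. c i \<in> B" "\<And>i. coeff Q0 i = ?q * c i" by auto
  define Q where "Q = (\<Sum>i\<le>degree Q0. monom (c i) i)"
  have c0: "c i = 0" if "i > degree Q0" for i
    using c(2)[of i] q(1) that by (simp add: coeff_eq_0)
  have cQ: "coeff Q i = c i" for i
    using c0[of i] by (auto simp add: Q_def coeff_sum not_le)
  have Q0Q: "Q0 = smult ?q Q" by (rule poly_eqI) (simp add: cQ c(2)[symmetric])
  have dQ: "degree Q = degree Q0" using arg_cong[OF Q0Q, of degree] Q0(2) by simp
  have QB: "coeffs_in B Q" using c(1) by (simp add: coeffs_in_def cQ)
  have lQ: "lead_coeff Q = 1" using c(2)[of "degree Q0"] q(1) by (simp add: cQ dQ)
  have "?q * poly Q u \<in> P" using Q0(3) arg_cong[OF Q0Q, of "\<lambda>p. poly p u"] by simp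
  moreover have "?q \<notin> P" using free[OF q(2)] q(1) by blast
  ultimately have QP: "poly Q u \<in> P" using prime_mult[OF prime] by blast
  have "Q dvd R" if R: "coeffs_in B R" "poly R u \<in> P" for R
  proof -
    have "Q \<noteq> 0" using lQ by auto
    from pseudo_division_in_subring[OF subring_invariants QB this R(1)]
    obtain k G S where GS: "coeffs_in B S" "smult (lead_coeff Q ^ k) R = G * Q + S" "S = 0 \<or> degree S < degree Q"
      by blast
    have R_eq: "R = G * Q + S" using GS(2) lQ by simp
    then have "poly S u = poly R u - poly G u * poly Q u" by simp
    then have "poly S u \<in> P" using R(2) QP idealP by (simp add: ideal_diff ideal_mult)
    then have "S = 0" using min[OF GS(1)] GS(3) dQ by fastforce
    then show ?thesis using R_eq by simp
  qed
  then have "is_minpoly u Q" using QB lQ QP by (simp add: is_minpoly_def)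
  then show ?thesis ..
qed

end

lemma cconst_hom: "cconst 0 = 0" "cconst 1 = 1" "cconst (a + b) = cconst a + cconst b" "cconst (a * b) = cconst a * cconst b"
  by (auto intro: cpoly_eqI)

lemma prime_ideal_const: 
  assumes P: "is_prime_ideal P" and c: "cconst c \<in> P" shows "c = 0"
proof (rule ccontr)
  assume "c \<noteq> 0"
  then have "cconst (1 / c) * cconst c = 1" by (intro cpoly_eqI) simp
  then show False using ideal_mult[OF prime_imp_ideal[OF P] c] prime_one[OF P] by metis
qed

lemma prime_ideal_root:
  assumes P: "is_prime_ideal P" and p: "p \<noteq> 0" and x: "poly (map_poly cconst p) x \<in> P"
  shows "\<exists>c. x - cconst c \<in> P"
  using p x
proof (induction "degree p" arbitrary: p)
  case 0
  then obtain c where "p = [:c:]" using degree_eq_zeroE by metis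
  then show ?case using prime_ideal_const[OF P, of c] 0 by (simp add: map_poly_pCons cconst_hom)
next
  case (Suc n)
  then have "\<not> constant (poly p)" using constant_degree[of p] by simp
  then obtain c where "poly p c = 0" using fundamental_theorem_of_algebra by blast
  then obtain q where q: "p = [:- c, 1:] * q" by (auto simp: poly_eq_0_iff_dvd dvd_def)
  have q0: "q \<noteq> 0" using q Suc.prems by auto
  have "degree p = 1 + degree q" unfolding q using q0 by (subst degree_mult_eq) auto
  then have dq: "n = degree q" using Suc.hyps(2) by simp
  have m: "cconst (- c) = - cconst c" by (rule cpoly_eqI) simp
  have "poly (map_poly cconst p) x = (x - cconst c) * poly (map_poly cconst q) x"
    unfolding q by (subst map_poly_hom_mult) (simp_all add: cconst_hom m map_poly_pCons left_diff_distrib)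
  then consider "x - cconst c \<in> P" | "poly (map_poly cconst q) x \<in> P"
    using Suc.prems(2) prime_mult[OF P] by metis
  then show ?case using Suc.hyps(1)[OF dq q0] by cases auto
qed

definition zeros :: "'n::finite cpoly set \<Rightarrow> (complex ^ 'n) set"
  where "zeros P = {w. \<forall>f\<in>P. ev f w = 0}"

lemma projection_component: "\<pi> ** \<pi> = \<pi> \<Longrightarrow> \<exists>f\<in>invariants \<pi>. \<forall>x. ev f x = (\<pi> *v x) $ j"
  using subst_cpoly[of "ccoord j" \<pi>] by (auto simp: invariants_iff matrix_vector_mul_assoc)

context normalization begin

text \<open>
  The kernel \<open>N\<close> of evaluation at \<open>(a, t)\<close> generates a proper ideal modulo \<open>P\<close>: if 1 were a combination of
  the module generators with coefficients in \<open>N\<close>, then so would be every generator, and elimination would give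
  a polynomial with value 1 at \<open>(a, t)\<close> whose value at \<open>u\<close> lies in \<open>P\<close>. It would be a multiple of
  \<open>Q\<close>, which vanishes at \<open>(a, t)\<close>.
\<close>

lemma ideal_over:
  assumes Q: "is_minpoly u Q" and root: "poly (evp a Q) t = 0"
  defines "N \<equiv> {\<nu>. coeffs_in B \<nu> \<and> poly (evp a \<nu>) t = 0}"
  shows "\<exists>K. is_ideal K \<and> 1 \<notin> K \<and> P \<subseteq> K \<and> (\<forall>\<nu>\<in>N. poly \<nu> u \<in> K)"
proof -
  note subB = subring_invariants[of \<pi>]
  define K where "K = {x. \<exists>\<nu>. (\<forall>j<r. \<nu> j \<in> N) \<and> x - (\<Sum>j<r. poly (\<nu> j) u * e j) \<in> P}"
  have N0: "0 \<in> N" using subB by (auto simp: N_def coeffs_in_0)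
  have Nadd: "x + y \<in> N" if "x \<in> N" "y \<in> N" for x y using that subB by (auto simp: N_def coeffs_in_add)
  have Nmult: "x * y \<in> N" if "x \<in> N" "coeffs_in B y" for x y using that subB by (auto simp: N_def coeffs_in_mult)
  have Nsum: "sum f A \<in> N" if "\<And>i. i \<in> A \<Longrightarrow> f i \<in> N" for f and A :: "nat set"
    using that by (induction A rule: infinite_finite_induct) (auto intro: N0 Nadd)
  have K: "is_ideal K" unfolding is_ideal_def
  proof (intro conjI ballI allI)
    show "0 \<in> K" using N0 ideal_zero[OF idealP] by (auto simp: K_def intro!: exI[of _ "\<lambda>j. 0"])
  next
    fix x y assume "x \<in> K" "y \<in> K"
    then obtain \<nu> \<mu> where h: "\<And>j. j < r \<Longrightarrow> \<nu> j \<in> N" "x - (\<Sum>j<r. poly (\<nu> j) u * e j) \<in> P"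
      "\<And>j. j < r \<Longrightarrow> \<mu> j \<in> N" "y - (\<Sum>j<r. poly (\<mu> j) u * e j) \<in> P" unfolding K_def by blast
    have "x + y - (\<Sum>j<r. poly (\<nu> j + \<mu> j) u * e j)
        = (x - (\<Sum>j<r. poly (\<nu> j) u * e j)) + (y - (\<Sum>j<r. poly (\<mu> j) u * e j))"
      by (simp add: distrib_right sum.distrib)
    also have "\<dots> \<in> P" by (rule ideal_add[OF idealP h(2,4)])
    finally show "x + y \<in> K" using h(1,3) Nadd unfolding K_def by (intro CollectI exI[of _ "\<lambda>j. \<nu> j + \<mu> j"]) auto
  next
    fix x f assume "x \<in> K"
    then obtain \<nu> where h: "\<And>j. j < r \<Longrightarrow> \<nu> j \<in> N" "x - (\<Sum>j<r. poly (\<nu> j) u * e j) \<in> P"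
      unfolding K_def by blast
    have "\<forall>j. \<exists>b. (\<forall>k<r. b k \<in> B) \<and> f * e j - (\<Sum>k<r. b k * e k) \<in> P"
      using fin unfolding finite_mod_def by blast
    from choice[OF this] obtain b where b: "\<And>j k. k < r \<Longrightarrow> b j k \<in> B"
      "\<And>j. f * e j - (\<Sum>k<r. b j k * e k) \<in> P" by auto
    let ?\<mu> = "\<lambda>k. \<Sum>j<r. \<nu> j * [:b j k:]"
    have "(\<Sum>k<r. poly (?\<mu> k) u * e k) = (\<Sum>k<r. \<Sum>j<r. poly (\<nu> j) u * (b j k * e k))"
      by (simp add: poly_sum sum_distrib_right mult.assoc mult.left_commute)
    also have "\<dots> = (\<Sum>j<r. poly (\<nu> j) u * (\<Sum>k<r. b j k * e k))"
      by (subst sum.swap) (simp add: sum_distrib_left)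
    finally have "f * x - (\<Sum>k<r. poly (?\<mu> k) u * e k) = f * (x - (\<Sum>j<r. poly (\<nu> j) u * e j))
       + (\<Sum>j<r. poly (\<nu> j) u * (f * e j - (\<Sum>k<r. b j k * e k)))"
      by (simp add: right_diff_distrib sum_distrib_left sum_subtractf mult.left_commute)
    also have "\<dots> \<in> P"
      by (intro ideal_add[OF idealP] ideal_sum[OF idealP] ideal_mult[OF idealP h(2)] ideal_mult[OF idealP b(2)])
    finally have "f * x - (\<Sum>k<r. poly (?\<mu> k) u * e k) \<in> P" .
    moreover have "?\<mu> k \<in> N" if "k < r" for k
      using h(1) b(1)[OF that] by (intro Nsum Nmult coeffs_in_const[OF subB]) auto
    ultimately show "f * x \<in> K" unfolding K_def by (intro CollectI exI[of _ ?\<mu>]) auto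
  qed
  have PK: "P \<subseteq> K" using N0 by (auto simp: K_def intro!: exI[of _ "\<lambda>j. 0"])
  have NK: "poly \<nu> u \<in> K" if \<nu>: "\<nu> \<in> N" for \<nu>
  proof -
    obtain b where b: "\<And>j. j < r \<Longrightarrow> b j \<in> B" "1 - (\<Sum>j<r. b j * e j) \<in> P"
      using fin unfolding finite_mod_def by blast
    have "poly \<nu> u - (\<Sum>j<r. poly (\<nu> * [:b j:]) u * e j) = poly \<nu> u * (1 - (\<Sum>j<r. b j * e j))"
      by (simp add: right_diff_distrib sum_distrib_left mult.assoc mult.left_commute)
    also have "\<dots> \<in> P" by (rule ideal_mult[OF idealP b(2)])
    finally show ?thesis unfolding K_def
      using Nmult[OF \<nu> coeffs_in_const[OF subB b(1)]]
      by (intro CollectI exI[of _ "\<lambda>j. \<nu> * [:b j:]"] conjI allI impI)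
  qed
  have "1 \<notin> K"
  proof
    assume "1 \<in> K"
    then have "e i \<in> K" for i using ideal_mult[OF K, of 1 "e i"] by simp
    then have "\<forall>i. \<exists>\<nu>. (\<forall>j<r. \<nu> j \<in> N) \<and> e i - (\<Sum>j<r. poly (\<nu> j) u * e j) \<in> P"
      unfolding K_def by blast
    from choice[OF this] obtain \<nu> where \<nu>: "\<And>i j. j < r \<Longrightarrow> \<nu> i j \<in> N"
      "\<And>i. e i - (\<Sum>j<r. poly (\<nu> i j) u * e j) \<in> P" by auto
    let ?S = "\<lambda>d::nat. {\<nu>. coeffs_in B \<nu> \<and> poly (evp a \<nu>) t = 1}"
    have "\<exists>d'. \<exists>s\<in>?S d'. \<forall>i<r. poly s u * e i \<in> P"
      by (rule linear_elimination[where s = "\<lambda>i. 1" and nu = \<nu> and N = "\<lambda>d. N" and d = 0, OF idealP])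
        (use \<nu> subB in \<open>auto simp: N_def coeffs_in_1 intro: coeffs_in_add coeffs_in_mult coeffs_in_diff\<close>)
    then obtain s where s: "coeffs_in B s" "poly (evp a s) t = 1" "\<And>i. i < r \<Longrightarrow> poly s u * e i \<in> P" by auto
    have "poly s u \<in> P" by (rule finite_mod_annihilates[OF idealP fin s(3)])
    then have "Q dvd s" using Q s(1) by (simp add: is_minpoly_def)
    then obtain q where "s = Q * q" by (rule dvdE)
    then have "poly (evp a s) t = 0" using root by simp
    then show False using s(2) by simp
  qed
  then show ?thesis using K PK NK by blast
qed

text \<open>
  A prime ideal \<open>M\<close> above the ideal of \<open>ideal_over\<close> is the ideal of a point: modulo \<open>M\<close> the elements
  of \<open>B\<close> are constants, so the integral equation of each coordinate function has constant
  coefficients and splits into linear factors, one of which lies in \<open>M\<close>.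
\<close>

lemma lying_over:
  assumes Q: "is_minpoly u Q" and root: "poly (evp a Q) t = 0"
  shows "\<exists>w\<in>zeros P. \<pi> *v w = \<pi> *v a \<and> ev u w = t"
proof -
  note subB = subring_invariants[of \<pi>]
  obtain K where K: "is_ideal K" "1 \<notin> K" "P \<subseteq> K"
    "\<And>\<nu>. coeffs_in B \<nu> \<Longrightarrow> poly (evp a \<nu>) t = 0 \<Longrightarrow> poly \<nu> u \<in> K"
    using ideal_over[OF Q root] by blast
  have "K \<inter> {1} = {}" using K(2) by simp
  from prime_ideal_avoiding[OF K(1) _ _ this] obtain M where M: "is_prime_ideal M" "K \<subseteq> M" by auto
  note idM = prime_imp_ideal[OF M(1)]
  have bM: "b - cconst (ev b a) \<in> M" if b: "b \<in> B" for b
  proof -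
    have "cconst (ev b a) \<in> B" by (simp add: invariants_iff)
    then have "poly [:b - cconst (ev b a):] u \<in> K" using b subB
      by (intro K(4) coeffs_in_const subring_diff) auto
    then show ?thesis using M(2) by auto
  qed
  have "\<exists>c. ccoord j - cconst c \<in> M" for j
  proof -
    obtain F where F: "coeffs_in B F" "lead_coeff F = 1" "poly F (ccoord j) \<in> P"
      using integral_over_finite[OF idealP subring_invariants fin] by blast
    have "poly F x - poly (map_poly cconst (evp a F)) x \<in> M" for x
      using F(1)
    proof (induction F)
      case 0
      then show ?case using ideal_zero[OF idM] by simp
    next
      case (pCons b F)
      have b: "b \<in> B" "coeffs_in B F"
        using pCons.prems unfolding coeffs_in_def by (metis coeff_pCons_0, metis coeff_pCons_Suc)
      have "poly (pCons b F) x - poly (map_poly cconst (evp a (pCons b F))) x =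
        (b - cconst (ev b a)) + x * (poly F x - poly (map_poly cconst (evp a F)) x)"
        by (simp add: map_poly_pCons cconst_hom algebra_simps)
      also have "\<dots> \<in> M" by (intro ideal_add[OF idM] bM[OF b(1)] ideal_mult[OF idM pCons.IH[OF b(2)]])
      finally show ?case .
    qed
    from ideal_diff[OF idM _ this, of "poly F (ccoord j)" "ccoord j"]
    have "poly (map_poly cconst (evp a F)) (ccoord j) \<in> M" using F(3) K(3) M(2) by auto
    moreover have "evp a F \<noteq> 0"
    proof
      assume "evp a F = 0"
      then have "coeff (evp a F) (degree F) = 0" by (simp del: coeff_evp)
      then show False using F(2) by simp
    qed
    ultimately show ?thesis using prime_ideal_root[OF M(1)] by blast
  qed
  then have "\<forall>j. \<exists>c. ccoord j - cconst c \<in> M" by simp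
  from choice[OF this] obtain c where c: "\<And>j. ccoord j - cconst (c j) \<in> M" by auto
  define w where "w = (\<chi> j. c j)"
  have fM: "f - cconst (ev f w) \<in> M" for f
    by (rule ideal_imp_cong[OF idM]) (simp add: w_def c)
  have z: "ev f w = 0" if "f \<in> M" for f
    using ideal_diff[OF idM that fM[of f]] prime_ideal_const[OF M(1)] by simp
  have "w \<in> zeros P" using z K(3) M(2) by (auto simp: zeros_def)
  moreover have "ev u w = t"
  proof -
    have "poly [:- cconst t, 1:] u \<in> K" using subB
      by (intro K(4) coeffs_in_pCons) (auto simp: coeffs_in_0 invariants_iff coeffs_in_def)
    then show ?thesis using z[of "u - cconst t"] M(2) by auto
  qed
  moreover have "\<pi> *v w = \<pi> *v a"
  proof (rule vec_eq_iff[THEN iffD2], rule allI)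
    fix j
    obtain f where f: "f \<in> B" "\<And>x. ev f x = (\<pi> *v x) $ j" using projection_component[OF idem] by blast
    have "ev (f - cconst (ev f a)) w = 0" by (rule z[OF bM[OF f(1)]])
    then show "(\<pi> *v w) $ j = (\<pi> *v a) $ j" using f(2) by simp
  qed
  ultimately show ?thesis by blast
qed

end


section \<open>Noether normalization\<close>

text \<open>
  Homogeneous of degree \<open>i\<close>; the zero polynomial is homogeneous of every degree.
\<close>

inductive homog :: "nat \<Rightarrow> 'n::finite cpoly \<Rightarrow> bool" where
  homog_0: "homog i 0"
| homog_const: "homog 0 (cconst c)"
| homog_coord: "homog 1 (ccoord j)"
| homog_add: "homog i f \<Longrightarrow> homog i g \<Longrightarrow> homog i (f + g)"
| homog_mult: "homog i f \<Longrightarrow> homog j g \<Longrightarrow> homog (i + j) (f * g)"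

lemma homog_sum: "(\<And>a. a \<in> A \<Longrightarrow> homog i (f a)) \<Longrightarrow> homog i (sum f A)"
  by (induction A rule: infinite_finite_induct) (auto intro: homog_0 homog_add)

lemma homog_scale: "homog i f \<Longrightarrow> ev f (t *s x) = t ^ i * ev f x"
  by (induction rule: homog.induct) (auto simp: algebra_simps power_add)

lemma homog_linear_subst:
  fixes A :: "complex ^ 'n ^ 'n::finite"
  shows "homog i f \<Longrightarrow> \<exists>g. homog i g \<and> (\<forall>x. ev g x = ev f (A *v x))"
proof (induction rule: homog.induct)
  case (homog_0 i)
  then show ?case by (intro exI[of _ 0]) (auto intro: homog.homog_0)
next
  case (homog_const c)
  then show ?case by (intro exI[of _ "cconst c"]) (auto intro: homog.homog_const)
next
  case (homog_coord j)
  have "homog 1 (\<Sum>k\<in>UNIV. cconst (A $ j $ k) * ccoord k)"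
    using homog_mult[OF homog_const homog.homog_coord] by (intro homog_sum) simp
  then show ?case by (intro exI[of _ "\<Sum>k\<in>UNIV. cconst (A $ j $ k) * ccoord k"])
      (simp add: matrix_vector_mult_def)
next
  case (homog_add i f g)
  then obtain f' g' where "homog i f' \<and> (\<forall>x. ev f' x = ev f (A *v x))" "homog i g' \<and> (\<forall>x. ev g' x = ev g (A *v x))" by auto
  then show ?case by (intro exI[of _ "f' + g'"]) (auto intro: homog.homog_add)
next
  case (homog_mult i f j g)
  then obtain f' g' where "homog i f' \<and> (\<forall>x. ev f' x = ev f (A *v x))" "homog j g' \<and> (\<forall>x. ev g' x = ev g (A *v x))" by auto
  then show ?case by (intro exI[of _ "f' * g'"]) (auto intro: homog.homog_mult)
qed

lemma homog_components: "\<exists>C. (\<forall>i. homog i (coeff C i)) \<and> f = poly C 1"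
proof (induction f rule: cpoly_induct)
  case (const c)
  show ?case by (intro exI[of _ "[:cconst c:]"]) (auto simp: coeff_pCons intro: homog_0 homog_const split: nat.split)
next
  case (coord j)
  show ?case using homog_coord by (intro exI[of _ "[:0, ccoord j:]"]) (auto simp: coeff_pCons intro: homog_0 split: nat.split)
next
  case (add f g)
  then obtain C D where "(\<forall>i. homog i (coeff C i)) \<and> f = poly C 1" "(\<forall>i. homog i (coeff D i)) \<and> g = poly D 1" by auto
  then show ?case by (intro exI[of _ "C + D"]) (auto intro: homog_add)
next
  case (mult f g)
  then obtain C D where CD: "(\<forall>i. homog i (coeff C i)) \<and> f = poly C 1" "(\<forall>i. homog i (coeff D i)) \<and> g = poly D 1" by auto
  have "homog i (coeff (C * D) i)" for i
    unfolding coeff_mult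
  proof (rule homog_sum)
    fix k assume "k \<in> {..i}"
    then show "homog i (coeff C k * coeff D (i - k))"
      using homog_mult[of k "coeff C k" "i - k" "coeff D (i - k)"] CD by simp
  qed
  then show ?case using CD by (intro exI[of _ "C * D"]) simp
qed

lemma shift_expansion:
  fixes f :: "'n::finite cpoly"
  shows "\<exists>E. \<forall>x s. ev f (x + s *s v) = poly (evp x E) s"
proof (induction f rule: cpoly_induct)
  case (const c)
  show ?case by (intro exI[of _ "[:cconst c:]"]) simp
next
  case (coord j)
  show ?case by (intro exI[of _ "[:ccoord j, cconst (v $ j):]"]) simp
next
  case (add f g)
  then obtain C D where "\<forall>x s. ev f (x + s *s v) = poly (evp x C) s" "\<forall>x s. ev g (x + s *s v) = poly (evp x D) s" by auto
  then show ?case by (intro exI[of _ "C + D"]) simp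
next
  case (mult f g)
  then obtain C D where "\<forall>x s. ev f (x + s *s v) = poly (evp x C) s" "\<forall>x s. ev g (x + s *s v) = poly (evp x D) s" by auto
  then show ?case by (intro exI[of _ "C * D"]) simp
qed

text \<open>
  As a polynomial in \<open>s\<close>, the form \<open>f(x + s v)\<close> has degree at most \<open>i\<close>, and its coefficient at \<open>s\<^sup>i\<close> is the
  constant \<open>f(v)\<close>. This is what makes a relation monic after a generic linear change of coordinates.
\<close>

lemma homog_shift_expansion:
  fixes f :: "'n::finite cpoly"
  shows "homog i f \<Longrightarrow> \<exists>E. (\<forall>k>i. coeff E k = 0) \<and> coeff E i = cconst (ev f v) \<and> (\<forall>x s. ev f (x + s *s v) = poly (evp x E) s)"
proof (induction rule: homog.induct)
  case (homog_0 i)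
  then show ?case by (intro exI[of _ 0]) (simp add: cconst_hom)
next
  case (homog_const c)
  show ?case by (intro exI[of _ "[:cconst c:]"]) (simp add: coeff_pCons split: nat.split)
next
  case (homog_coord j)
  show ?case by (intro exI[of _ "[:ccoord j, cconst (v $ j):]"]) (simp add: coeff_pCons split: nat.split)
next
  case (homog_add i f g)
  then obtain C D where "(\<forall>k>i. coeff C k = 0) \<and> coeff C i = cconst (ev f v) \<and> (\<forall>x s. ev f (x + s *s v) = poly (evp x C) s)"
    "(\<forall>k>i. coeff D k = 0) \<and> coeff D i = cconst (ev g v) \<and> (\<forall>x s. ev g (x + s *s v) = poly (evp x D) s)" by auto
  then show ?case by (intro exI[of _ "C + D"]) (simp add: cconst_hom)
next
  case (homog_mult i f j g)
  then obtain C D where *: "(\<forall>k>i. coeff C k = 0) \<and> coeff C i = cconst (ev f v) \<and> (\<forall>x s. ev f (x + s *s v) = poly (evp x C) s)"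
    "(\<forall>k>j. coeff D k = 0) \<and> coeff D j = cconst (ev g v) \<and> (\<forall>x s. ev g (x + s *s v) = poly (evp x D) s)" by auto
  have "coeff (C * D) k = 0" if "k > i + j" for k
    by (rule coeff_mult_above[of i C "Suc j" D]) (use * that in auto)
  moreover have "coeff (C * D) (i + j) = coeff C i * coeff D j" by (rule coeff_mult_top) (use * in auto)
  ultimately show ?case using * by (intro exI[of _ "C * D"]) (simp add: cconst_hom)
qed

lemma sum_grid:
  fixes g :: "nat \<Rightarrow> nat \<Rightarrow> 'a::comm_monoid_add"
  shows "(\<Sum>j<r. \<Sum>i<D. g j i) = (\<Sum>k<r * D. g (k div D) (k mod D))"
proof (cases "D = 0")
  case False
  have "(\<Sum>k<r * D. g (k div D) (k mod D)) = (\<Sum>j<r. \<Sum>k=j*D..<j*D+D. g (k div D) (k mod D))"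
    by (rule sum.nat_group[symmetric])
  also have "\<dots> = (\<Sum>j<r. \<Sum>i<D. g j i)"
  proof (rule sum.cong[OF refl])
    fix j
    have "(\<Sum>k=j*D..<j*D+D. g (k div D) (k mod D)) = (\<Sum>i=0..<D. g ((i + j*D) div D) ((i + j*D) mod D))"
      using sum.shift_bounds_nat_ivl[of "\<lambda>k. g (k div D) (k mod D)" 0 "j*D" D] by (simp add: add.commute)
    also have "\<dots> = (\<Sum>i<D. g j i)" using False by (intro sum.cong) auto
    finally show "(\<Sum>k=j*D..<j*D+D. g (k div D) (k mod D)) = (\<Sum>i<D. g j i)" .
  qed
  finally show ?thesis ..
qed simp

text \<open>
  Transitivity of finiteness: the powers of \<open>y\<close> generate \<open>B\<close> over \<open>B'\<close>, so their products with
  the generators over \<open>B\<close> generate everything over \<open>B'\<close>.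
\<close>

lemma finite_mod_adjoin:
  assumes P: "is_ideal P" and fin: "finite_mod P B e r"
    and sub: "\<And>h. h \<in> B \<Longrightarrow> \<exists>b. (\<forall>i<D. b i \<in> B') \<and> h - (\<Sum>i<D. b i * y ^ i) \<in> P"
  shows "finite_mod P B' (\<lambda>k. y ^ (k mod D) * e (k div D)) (r * D)"
  unfolding finite_mod_def
proof
  fix f
  obtain b where b: "\<And>j. j < r \<Longrightarrow> b j \<in> B" "f - (\<Sum>j<r. b j * e j) \<in> P"
    using fin unfolding finite_mod_def by blast
  have "\<forall>j. \<exists>c. j < r \<longrightarrow> (\<forall>i<D. c i \<in> B') \<and> b j - (\<Sum>i<D. c i * y ^ i) \<in> P"
    using sub b(1) by blast
  from choice[OF this] obtain c where c: "\<And>j i. j < r \<Longrightarrow> i < D \<Longrightarrow> c j i \<in> B'"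
    "\<And>j. j < r \<Longrightarrow> b j - (\<Sum>i<D. c j i * y ^ i) \<in> P" by auto
  have "(\<Sum>k<r * D. c (k div D) (k mod D) * (y ^ (k mod D) * e (k div D)))
     = (\<Sum>j<r. \<Sum>i<D. c j i * (y ^ i * e j))"
    by (rule sum_grid[symmetric])
  also have "\<dots> = (\<Sum>j<r. (\<Sum>i<D. c j i * y ^ i) * e j)"
    by (simp add: sum_distrib_right mult.assoc)
  finally have "f - (\<Sum>k<r * D. c (k div D) (k mod D) * (y ^ (k mod D) * e (k div D)))
     = (f - (\<Sum>j<r. b j * e j)) + (\<Sum>j<r. (b j - (\<Sum>i<D. c j i * y ^ i)) * e j)"
    by (simp add: left_diff_distrib sum_subtractf)
  also have "\<dots> \<in> P"
    by (intro ideal_add[OF P b(2)] ideal_sum[OF P] ideal_mult_right[OF P] c(2)) simp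
  finally have "f - (\<Sum>k<r * D. c (k div D) (k mod D) * (y ^ (k mod D) * e (k div D))) \<in> P" .
  moreover have "c (k div D) (k mod D) \<in> B'" if "k < r * D" for k
  proof (rule c(1))
    show "k div D < r" using that by (simp add: less_mult_imp_div_less)
    show "k mod D < D" using that by (metis mod_less_divisor mult_0_right not_less_zero neq0_conv)
  qed
  ultimately show "\<exists>b. (\<forall>j<r * D. b j \<in> B') \<and> f - (\<Sum>j<r * D. b j * (y ^ (j mod D) * e (j div D))) \<in> P"
    by (intro exI[of _ "\<lambda>k. c (k div D) (k mod D)"]) simp
qed

lemma subst_coeffs:
  fixes E :: "'n::finite cpoly poly" and A :: "complex ^ 'n ^ 'n"
  shows "\<exists>E'. \<forall>i x. ev (coeff E' i) x = ev (coeff E i) (A *v x)"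
proof (induction E)
  case 0
  then show ?case by (intro exI[of _ 0]) simp
next
  case (pCons f E)
  then obtain E' where E': "\<forall>i x. ev (coeff E' i) x = ev (coeff E i) (A *v x)" by blast
  obtain g where g: "\<forall>x. ev g x = ev f (A *v x)" using subst_cpoly by blast
  show ?case using E' g by (intro exI[of _ "pCons g E'"]) (simp add: coeff_pCons split: nat.split)
qed

lemma homog_components_invariant:
  fixes f :: "'n::finite cpoly"
  assumes idem: "\<pi> ** \<pi> = \<pi>" and f: "f \<in> invariants \<pi>"
  shows "\<exists>C. (\<forall>i. homog i (coeff C i)) \<and> (\<forall>i. coeff C i \<in> invariants \<pi>) \<and> f = poly C 1"
proof -
  obtain C0 where C0: "\<And>i. homog i (coeff C0 i)" "f = poly C0 1" using homog_components by blast
  have "\<forall>i. \<exists>g. homog i g \<and> (\<forall>x. ev g x = ev (coeff C0 i) (\<pi> *v x))"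
    using homog_linear_subst[OF C0(1)] by blast
  from choice[OF this] obtain g where g: "\<And>i. homog i (g i)" "\<And>i x. ev (g i) x = ev (coeff C0 i) (\<pi> *v x)" by auto
  obtain C where C: "\<And>i x. ev (coeff C i) x = ev (coeff C0 i) (\<pi> *v x)" using subst_coeffs by blast
  have Cg: "coeff C i = g i" for i by (rule cpoly_eqI) (simp add: C g)
  have "f = poly C 1"
  proof (rule cpoly_eqI)
    fix x
    have "evp x C = evp (\<pi> *v x) C0" by (rule poly_eqI) (simp add: C)
    then have "ev (poly C 1) x = ev f (\<pi> *v x)" by (simp add: ev_poly C0(2))
    then show "ev f x = ev (poly C 1) x" using f by (simp add: invariants_iff)
  qed
  moreover have "homog i (coeff C i)" for i using g(1) by (simp add: Cg)
  moreover have "coeff C i \<in> invariants \<pi>" for i by (simp add: invariants_iff C matrix_vector_mul_assoc idem)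
  ultimately show ?thesis by blast
qed

text \<open>
  The relation \<open>f\<close> allows to project once more, along a direction \<open>v\<close> in the range of \<open>\<pi>\<close> at which the leading form of \<open>f\<close>
  does not vanish: then \<open>f\<close> is, up to a constant, a monic equation for the forgotten coordinate. The direction
  can be moved off \<open>\<pi>(T)\<close>, which keeps the kernel of the projection transversal to \<open>T\<close>, as long as \<open>T\<close> does not
  fill the range of \<open>\<pi>\<close>.
\<close>

lemma noether_step:
  fixes P :: "'n::finite cpoly set"
  assumes P: "is_ideal P" and idem: "\<pi> ** \<pi> = \<pi>" and fin: "finite_mod P (invariants \<pi>) e r"
    and f: "f \<in> invariants \<pi>" "f \<in> P" "f \<noteq> 0"
    and T: "vec.subspace T" "\<And>x. x \<in> T \<Longrightarrow> \<pi> *v x = 0 \<Longrightarrow> x = 0"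
    and v1: "v1 \<in> range ((*v) \<pi>)" "v1 \<notin> (*v) \<pi> ` T"
  shows "\<exists>\<pi>' e' r'. \<pi>' ** \<pi>' = \<pi>' \<and> finite_mod P (invariants \<pi>') e' r'
    \<and> (\<forall>x\<in>T. \<pi>' *v x = 0 \<longrightarrow> x = 0) \<and> vec.dim (range ((*v) \<pi>')) < vec.dim (range ((*v) \<pi>))"
proof -
  have pp: "\<pi> *v (\<pi> *v x) = \<pi> *v x" for x by (simp add: matrix_vector_mul_assoc idem)
  obtain C where C: "\<And>i. homog i (coeff C i)" "\<And>i. coeff C i \<in> invariants \<pi>" and fC: "f = poly C 1"
    using homog_components_invariant[OF idem f(1)] by blast
  let ?D = "degree C"
  let ?fD = "lead_coeff C"
  have "C \<noteq> 0" using fC f(3) by auto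
  then obtain v0' where "ev ?fD v0' \<noteq> 0" using cpoly_eqI[of ?fD 0] by auto
  moreover define v0 where "v0 = \<pi> *v v0'"
  ultimately have v0: "ev ?fD v0 \<noteq> 0" "\<pi> *v v0 = v0" using C(2) by (simp_all add: invariants_iff pp)
  have v1p: "\<pi> *v v1 = v1" using v1(1) pp by auto
  have "\<exists>v. \<pi> *v v = v \<and> ev ?fD v \<noteq> 0 \<and> v \<notin> (*v) \<pi> ` T"
  proof (cases "v0 \<in> (*v) \<pi> ` T")
    case False
    then show ?thesis using v0 by blast
  next
    case True
    let ?q = "on_line v0 v1 ?fD"
    have "?q \<noteq> 0" using v0(1) poly_on_line[of v0 v1 ?fD 0] by (auto simp del: poly_on_line)
    then have "finite (insert 0 {s. poly ?q s = 0})" using poly_roots_finite by blast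
    then obtain s where s: "s \<notin> insert 0 {s. poly ?q s = 0}" using ex_new_if_finite infinite_UNIV_char_0 by blast
    have "v0 + s *s v1 \<notin> (*v) \<pi> ` T"
    proof
      assume "v0 + s *s v1 \<in> (*v) \<pi> ` T"
      then obtain a b where ab: "a \<in> T" "b \<in> T" "v0 = \<pi> *v a" "v0 + s *s v1 = \<pi> *v b" using True by auto
      have "s *s v1 = \<pi> *v b - \<pi> *v a" using ab by (simp add: algebra_simps)
      then have "(1/s) *s (s *s v1) = (1/s) *s (\<pi> *v (b - a))" by (simp add: matrix_vector_mult_diff_distrib)
      moreover have "(1/s) *s (s *s v1) = v1" using s by simp
      ultimately have "v1 = \<pi> *v ((1/s) *s (b - a))" by (simp only: vector_scalar_commute)
      moreover have "(1/s) *s (b - a) \<in> T" using ab T(1) by (intro vec.subspace_scale vec.subspace_diff)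
      ultimately show False using v1(2) by blast
    qed
    moreover have "\<pi> *v (v0 + s *s v1) = v0 + s *s v1"
      by (simp add: matrix_vector_right_distrib vector_scalar_commute v0(2) v1p)
    moreover have "ev ?fD (v0 + s *s v1) \<noteq> 0" using s by simp
    ultimately show ?thesis by blast
  qed
  then obtain v where v: "\<pi> *v v = v" "ev ?fD v \<noteq> 0" "v \<notin> (*v) \<pi> ` T" by blast
  have "v \<noteq> 0" using v(3) vec.subspace_0[OF T(1)] by force
  then obtain j where j: "v $ j \<noteq> 0" by (metis vec_eq_iff zero_index)
  \<comment> \<open>\<open>\<rho>\<close> is the projection along \<open>v\<close> onto the hyperplane where coordinate \<open>j\<close> vanishes; \<open>y\<close> is the
     coordinate that it forgets, and the leading form of \<open>f\<close> at \<open>v\<close> will be the leading coefficient of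
     the equation of \<open>y\<close>\<close>
  define \<rho> :: "complex ^ 'n ^ 'n" where "\<rho> = (\<chi> i k. (if i = k then 1 else 0) - (if k = j then v $ i / v $ j else 0))"
  have \<rho>: "\<rho> *v x = x - (x $ j / v $ j) *s v" for x
    by (simp add: vec_eq_iff matrix_vector_mult_def \<rho>_def left_diff_distrib sum_subtractf if_distrib[of "\<lambda>c. c * _"] cong: if_cong)
  define \<pi>' where "\<pi>' = \<rho> ** \<pi>"
  define y where "y = Cpoly (\<lambda>x. (\<pi> *v x) $ j) * cconst (1 / v $ j)"
  have y: "ev y x = (\<pi> *v x) $ j / v $ j" for x
    by (simp add: y_def ev_Cpoly polynomial_fun_matrix)
  have \<pi>': "\<pi>' *v x = \<pi> *v x - ev y x *s v" for x
    by (simp add: \<pi>'_def y \<rho> matrix_vector_mul_assoc[symmetric])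
  have dec: "\<pi> *v x = \<pi>' *v x + ev y x *s v" for x by (simp add: \<pi>')
  have pi_pi': "\<pi> *v (\<pi>' *v x) = \<pi>' *v x" for x
    by (simp add: \<pi>' matrix_vector_mult_diff_distrib vector_scalar_commute pp v(1))
  have y\<pi>': "ev y (\<pi>' *v x) = 0" for x
    unfolding y pi_pi' using j by (simp add: \<pi>' y)
  have idem': "\<pi>' *v (\<pi>' *v x) = \<pi>' *v x" for x
    by (subst \<pi>') (simp add: pi_pi' y\<pi>')
  then have "\<pi>' ** \<pi>' = \<pi>'" by (simp add: matrix_eq matrix_vector_mul_assoc[symmetric])
  moreover have "x = 0" if "x \<in> T" "\<pi>' *v x = 0" for x
  proof -
    have e: "\<pi> *v x = ev y x *s v" using dec[of x] that(2) by simp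
    have "ev y x = 0"
    proof (rule ccontr)
      assume n: "ev y x \<noteq> 0"
      have "(1 / ev y x) *s (\<pi> *v x) = v" using e n by simp
      then have "v = \<pi> *v ((1 / ev y x) *s x)" by (simp add: vector_scalar_commute)
      moreover have "(1 / ev y x) *s x \<in> T" using that T(1) by (intro vec.subspace_scale)
      ultimately show False using v(3) by blast
    qed
    then show "x = 0" using e T(2)[OF that(1)] by simp
  qed
  moreover have "vec.dim (range ((*v) \<pi>')) < vec.dim (range ((*v) \<pi>))"
  proof -
    have sub: "vec.subspace (range ((*v) A))" for A :: "complex ^ 'n ^ 'n"
      by (intro vec.subspace_image matrix_vector_mul_linear_gen vec.subspace_UNIV)
    have "range ((*v) \<pi>') \<subseteq> range ((*v) \<pi>)" using pi_pi' by (metis image_subsetI rangeI)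
    moreover have "v \<in> range ((*v) \<pi>)" using v(1) by (metis rangeI)
    moreover have "v \<notin> range ((*v) \<pi>')"
    proof
      assume "v \<in> range ((*v) \<pi>')"
      then have "\<pi>' *v v = v" using idem' by auto
      moreover have "\<pi>' *v v = 0" using j by (simp add: \<pi>' v(1) y)
      ultimately show False using \<open>v \<noteq> 0\<close> by simp
    qed
    ultimately have "vec.span (range ((*v) \<pi>')) \<subset> vec.span (range ((*v) \<pi>))"
      using vec.span_eq_iff sub by (metis psubsetI)
    then show ?thesis by (rule vec.dim_psubset)
  qed
  moreover have "\<exists>e' r'. finite_mod P (invariants \<pi>') e' r'"
  proof -
    note subB = subring_invariants[of \<pi>']
    have exp: "\<exists>G. coeffs_in (invariants \<pi>') G \<and> h = poly G y \<and> (\<forall>i x. ev (coeff G i) x = ev (coeff E i) (\<pi>' *v x))"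
      if h: "h \<in> invariants \<pi>" and E: "\<And>x s. ev h (x + s *s v) = poly (evp x E) s" for h E
    proof -
      obtain G where G: "\<And>i x. ev (coeff G i) x = ev (coeff E i) (\<pi>' *v x)" using subst_coeffs by blast
      have "h = poly G y"
      proof (rule cpoly_eqI)
        fix x
        have "evp x G = evp (\<pi>' *v x) E" by (rule poly_eqI) (simp add: G)
        then have "ev (poly G y) x = ev h (\<pi> *v x)" by (simp add: ev_poly E[symmetric] dec)
        then show "ev h x = ev (poly G y) x" using h by (simp add: invariants_iff)
      qed
      moreover have "coeffs_in (invariants \<pi>') G" by (simp add: coeffs_in_def invariants_iff G idem')
      ultimately show ?thesis using G by blast
    qed
    have "\<forall>i. \<exists>E. (\<forall>k>i. coeff E k = 0) \<and> coeff E i = cconst (ev (coeff C i) v) \<and> (\<forall>x s. ev (coeff C i) (x + s *s v) = poly (evp x E) s)"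
      by (intro allI homog_shift_expansion C(1))
    from choice[OF this] obtain E where E': "\<forall>i. (\<forall>k>i. coeff (E i) k = 0) \<and> coeff (E i) i = cconst (ev (coeff C i) v)
        \<and> (\<forall>x s. ev (coeff C i) (x + s *s v) = poly (evp x (E i)) s)" ..
    have E: "\<And>i k. k > i \<Longrightarrow> coeff (E i) k = 0" "\<And>i. coeff (E i) i = cconst (ev (coeff C i) v)"
      "\<And>i x s. ev (coeff C i) (x + s *s v) = poly (evp x (E i)) s" using E' by blast+
    define EE where "EE = (\<Sum>i\<le>?D. E i)"
    have EE_above: "coeff EE k = 0" if "k > ?D" for k
      unfolding EE_def coeff_sum by (rule sum.neutral) (use E(1) that in auto)
    have "coeff EE ?D = (\<Sum>i\<in>{?D}. coeff (E i) ?D)"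
      unfolding EE_def coeff_sum by (rule sum.mono_neutral_right) (auto simp: E(1))
    then have EE_top: "coeff EE ?D = cconst (ev ?fD v)" by (simp add: E(2))
    have evp_sum: "evp x (sum h A) = (\<Sum>i\<in>A. evp x (h i))" for x h and A :: "nat set"
      by (induction A rule: infinite_finite_induct) auto
    have fs: "f = (\<Sum>i\<le>?D. coeff C i)" using fC poly_sum_upto[of C ?D 1] by simp
    have "ev f (x + s *s v) = poly (evp x EE) s" for x s
      unfolding fs ev_sum EE_def evp_sum poly_sum E(3) ..
    from exp[OF f(1) this] obtain F where F: "coeffs_in (invariants \<pi>') F" "f = poly F y"
      "\<And>i x. ev (coeff F i) x = ev (coeff EE i) (\<pi>' *v x)" by blast
    let ?c = "ev ?fD v"
    define Q where "Q = smult (cconst (1 / ?c)) F"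
    have Ftop: "coeff F ?D = cconst ?c" by (rule cpoly_eqI) (simp add: F(3) EE_top)
    have Fabove: "coeff F k = 0" if "k > ?D" for k by (rule cpoly_eqI) (simp add: F(3) EE_above[OF that])
    have Qtop: "coeff Q ?D = 1" using v(2) by (simp add: Q_def Ftop cconst_hom(4)[symmetric] cconst_hom(2))
    have dQ: "degree Q = ?D"
    proof (rule antisym)
      show "degree Q \<le> ?D" by (rule degree_le) (simp add: Q_def Fabove)
      show "?D \<le> degree Q" by (rule le_degree) (simp add: Qtop)
    qed
    have QB: "coeffs_in (invariants \<pi>') Q"
      unfolding Q_def by (intro coeffs_in_smult subB F(1)) (simp add: invariants_iff)
    have QP: "poly Q y \<in> P" using ideal_mult[OF P f(2)] by (simp add: Q_def F(2))
    have Q0: "Q \<noteq> 0" using Qtop by auto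
    have "\<exists>b. (\<forall>i<?D. b i \<in> invariants \<pi>') \<and> h - (\<Sum>i<?D. b i * y ^ i) \<in> P" if h: "h \<in> invariants \<pi>" for h
    proof -
      obtain E where "\<And>x s. ev h (x + s *s v) = poly (evp x E) s" using shift_expansion by blast
      from exp[OF h this] obtain G where G: "coeffs_in (invariants \<pi>') G" "h = poly G y" by blast
      from pseudo_division_in_subring[OF subB QB Q0 G(1)]
      obtain k A S where S: "coeffs_in (invariants \<pi>') S" "smult (lead_coeff Q ^ k) G = A * Q + S"
        "S = 0 \<or> degree S < degree Q" by blast
      have "poly S y = (\<Sum>i<?D. coeff S i * y ^ i)"
      proof (cases "S = 0")
        case False
        then have "degree S < ?D" using S(3) dQ by simp
        then show ?thesis unfolding poly_altdef by (intro sum.mono_neutral_left) (auto simp: coeff_eq_0)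
      qed simp
      moreover have "G = A * Q + S" using S(2) by (simp add: dQ Qtop)
      ultimately have "h - (\<Sum>i<?D. coeff S i * y ^ i) = poly A y * poly Q y" by (simp add: G(2))
      then show ?thesis using ideal_mult[OF P QP] S(1) by (intro exI[of _ "coeff S"]) (simp add: coeffs_in_def)
    qed
    from finite_mod_adjoin[OF P fin this] show ?thesis by blast
  qed
  ultimately show ?thesis by blast
qed

text \<open>
  Among the projections over which all polynomials are finite and whose kernel meets \<open>T\<close> trivially, one of least rank
  satisfies the claim, by \<open>noether_step\<close>. The hypothesis on \<open>T\<close> covers the case in which the step
  is unavailable because \<open>T\<close> fills the range.
\<close>

theorem noether_normalization:
  fixes P :: "'n::finite cpoly set"
  assumes P: "is_prime_ideal P" and T: "vec.subspace T"
    and H: "\<And>\<pi> f. \<pi> ** \<pi> = \<pi> \<Longrightarrow> (\<And>x. x \<in> T \<Longrightarrow> \<pi> *v x = 0 \<Longrightarrow> x = 0) \<Longrightarrow> range ((*v) \<pi>) = (*v) \<pi> ` T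
       \<Longrightarrow> f \<in> invariants \<pi> \<Longrightarrow> f \<in> P \<Longrightarrow> f = 0"
  shows "\<exists>\<pi> e r. normalization P \<pi> e r \<and> (\<forall>x\<in>T. \<pi> *v x = 0 \<longrightarrow> x = 0)"
proof -
  note idP = prime_imp_ideal[OF P]
  let ?A = "\<lambda>\<pi>. \<pi> ** \<pi> = \<pi> \<and> (\<exists>e r. finite_mod P (invariants \<pi>) e r) \<and> (\<forall>x\<in>T. \<pi> *v x = 0 \<longrightarrow> x = 0)"
  have "finite_mod P (invariants (mat 1)) (\<lambda>_. 1) (Suc 0)"
    unfolding finite_mod_def
  proof
    fix f :: "'n cpoly"
    show "\<exists>b. (\<forall>j<Suc 0. b j \<in> invariants (mat 1)) \<and> f - (\<Sum>j<Suc 0. b j * 1) \<in> P"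
      using ideal_zero[OF idP] by (intro exI[of _ "\<lambda>_. f"]) (simp add: invariants_iff lessThan_Suc)
  qed
  then have "?A (mat 1)" by auto
  from ex_has_least_nat[of ?A, OF this, of "\<lambda>\<pi>. vec.dim (range ((*v) \<pi>))"]
  obtain \<pi> e r where \<pi>: "\<pi> ** \<pi> = \<pi>" "finite_mod P (invariants \<pi>) e r" "\<And>x. x \<in> T \<Longrightarrow> \<pi> *v x = 0 \<Longrightarrow> x = 0"
    and min: "\<And>\<pi>'. ?A \<pi>' \<Longrightarrow> vec.dim (range ((*v) \<pi>)) \<le> vec.dim (range ((*v) \<pi>'))" by blast
  have "f = 0" if f: "f \<in> invariants \<pi>" "f \<in> P" for f
  proof (rule ccontr)
    assume f0: "f \<noteq> 0"
    then have "range ((*v) \<pi>) \<noteq> (*v) \<pi> ` T" using H[OF \<pi>(1,3) _ f] by blast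
    then obtain v1 where "v1 \<in> range ((*v) \<pi>)" "v1 \<notin> (*v) \<pi> ` T" by blast
    from noether_step[OF idP \<pi>(1,2) f f0 T \<pi>(3) this] min show False by (meson not_le)
  qed
  then have "normalization P \<pi> e r" using P \<pi> by (simp add: normalization_def)
  then show ?thesis using \<pi>(3) by blast
qed


section \<open>Roots of monic polynomials near a point\<close>

lemma monic_factor_root:
  fixes p :: "complex poly"
  assumes "lead_coeff p = 1" "poly p t = 0"
  obtains q where "p = [:- t, 1:] * q" "lead_coeff q = 1" "degree p = Suc (degree q)"
proof -
  obtain q where q: "p = [:- t, 1:] * q" using assms(2) by (auto simp: poly_eq_0_iff_dvd dvd_def)
  have "q \<noteq> 0" using q assms(1) by auto
  then have "degree p = Suc (degree q)" unfolding q by (subst degree_mult_eq) auto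
  moreover have "lead_coeff q = 1" using assms(1) unfolding q lead_coeff_mult by simp
  ultimately show ?thesis using that q by blast
qed

lemma poly_pderiv_linear_mult:
  "poly (pderiv ([:- t, 1:] * q)) c = poly q c + (c - t) * poly (pderiv q) c" for t :: complex
  unfolding pderiv_mult poly_add poly_mult by (simp add: pderiv_pCons algebra_simps)

lemma monic_root_exists:
  fixes p :: "complex poly"
  assumes "degree p \<noteq> 0" shows "\<exists>t. poly p t = 0"
  by (rule fundamental_theorem_of_algebra) (use assms constant_degree[of p] in simp)

text \<open>
  The value at \<open>c\<close> is the product of the distances to the roots, and the logarithmic derivative is the sum of
  the inverse differences.
\<close>

lemma monic_lower_bound:
  fixes p :: "complex poly"
  assumes "lead_coeff p = 1" "\<And>t. poly p t = 0 \<Longrightarrow> \<delta> \<le> cmod (t - c)" "\<delta> > 0"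
  shows "\<delta> ^ degree p \<le> cmod (poly p c) \<and> cmod (poly (pderiv p) c) \<le> degree p / \<delta> * cmod (poly p c)"
  using assms(1,2)
proof (induction "degree p" arbitrary: p)
  case 0
  then obtain a where "p = [:a:]" using degree_eq_zeroE by metis
  then show ?case using 0 by (simp add: pderiv_pCons)
next
  case (Suc n)
  then obtain t where t: "poly p t = 0" using monic_root_exists[of p] by auto
  from monic_factor_root[OF Suc.prems(1) t] obtain q where q: "p = [:- t, 1:] * q" "lead_coeff q = 1" "degree p = Suc (degree q)" .
  have IH: "\<delta> ^ degree q \<le> cmod (poly q c)" "cmod (poly (pderiv q) c) \<le> degree q / \<delta> * cmod (poly q c)"
    using Suc.hyps(1)[of q] q(2,3) Suc.hyps(2) Suc.prems(2) by (auto simp: q(1))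
  have ct: "\<delta> \<le> cmod (c - t)" using Suc.prems(2)[OF t] by (simp add: norm_minus_commute)
  have pc: "cmod (poly p c) = cmod (c - t) * cmod (poly q c)"
    by (simp add: q(1) norm_mult[symmetric] algebra_simps)
  have "\<delta> ^ degree p = \<delta> * \<delta> ^ degree q" by (simp add: q(3))
  also have "\<dots> \<le> cmod (poly p c)" unfolding pc using IH(1) ct assms(3) by (intro mult_mono) auto
  finally have 1: "\<delta> ^ degree p \<le> cmod (poly p c)" .
  have pd: "poly (pderiv p) c = poly q c + (c - t) * poly (pderiv q) c"
    unfolding q(1) by (rule poly_pderiv_linear_mult)
  have a: "cmod (poly q c) \<le> 1 / \<delta> * cmod (poly p c)"
    using mult_right_mono[OF ct norm_ge_zero[of "poly q c"]] assms(3) by (simp add: pc field_simps)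
  have "cmod (poly (pderiv p) c) \<le> cmod (poly q c) + cmod (c - t) * cmod (poly (pderiv q) c)"
    unfolding pd by (metis norm_triangle_ineq norm_mult)
  also have "\<dots> \<le> 1 / \<delta> * cmod (poly p c) + cmod (c - t) * (degree q / \<delta> * cmod (poly q c))"
    using a mult_left_mono[OF IH(2) norm_ge_zero[of "c - t"]] by linarith
  also have "\<dots> = degree p / \<delta> * cmod (poly p c)"
    by (simp add: q(3) pc algebra_simps add_divide_distrib)
  finally show ?case using 1 by simp
qed

lemma monic_root_near:
  fixes p :: "complex poly"
  assumes "lead_coeff p = 1" "\<delta> > 0" "cmod (poly p c) < \<delta> ^ degree p"
  shows "\<exists>t. poly p t = 0 \<and> cmod (t - c) < \<delta>"
  using monic_lower_bound[of p \<delta> c] assms by force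

text \<open>
  Split off a root \<open>t\<close> near \<open>c\<close>. If the cofactor had no root near \<open>c\<close>, then by
  \<open>monic_lower_bound\<close> it would be large at \<open>c\<close> compared with its derivative, and the
  derivative of \<open>p\<close> at \<open>c\<close> would be large too. The last disjunct records a double root.
\<close>

lemma monic_two_roots_near:
  fixes p :: "complex poly"
  assumes p: "lead_coeff p = 1" and \<delta>: "\<delta> > 0"
    and c: "cmod (poly p c) < \<delta> ^ degree p" "degree p * cmod (poly p c) < \<delta> ^ degree p / 2"
      "cmod (poly (pderiv p) c) < \<delta> ^ (degree p - 1) / 2"
  shows "\<exists>t t'. poly p t = 0 \<and> poly p t' = 0 \<and> cmod (t - c) < \<delta> \<and> cmod (t' - c) < \<delta> \<and> (t \<noteq> t' \<or> poly (pderiv p) t = 0)"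
proof -
  obtain t where t: "poly p t = 0" "cmod (t - c) < \<delta>" using monic_root_near[OF p \<delta> c(1)] by blast
  from monic_factor_root[OF p t(1)] obtain q where q: "p = [:- t, 1:] * q" "lead_coeff q = 1" "degree p = Suc (degree q)" .
  have "\<exists>t'. poly q t' = 0 \<and> cmod (t' - c) < \<delta>"
  proof (rule ccontr)
    assume "\<nexists>t'. poly q t' = 0 \<and> cmod (t' - c) < \<delta>"
    then have "\<And>t'. poly q t' = 0 \<Longrightarrow> \<delta> \<le> cmod (t' - c)" by (auto simp: not_less)
    from monic_lower_bound[OF q(2) this \<delta>]
    have lb: "\<delta> ^ degree q \<le> cmod (poly q c)" "cmod (poly (pderiv q) c) \<le> degree q / \<delta> * cmod (poly q c)" by auto
    have pd: "poly (pderiv p) c = poly q c + (c - t) * poly (pderiv q) c"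
      unfolding q(1) by (rule poly_pderiv_linear_mult)
    have pc: "cmod (poly p c) = cmod (c - t) * cmod (poly q c)"
      by (simp add: q(1) norm_mult[symmetric] algebra_simps)
    have "cmod ((c - t) * poly (pderiv q) c) \<le> cmod (c - t) * (degree q / \<delta> * cmod (poly q c))"
      unfolding norm_mult using lb(2) by (intro mult_left_mono) auto
    also have "\<dots> = degree q * cmod (poly p c) / \<delta>" by (simp add: pc)
    also have "\<dots> \<le> degree p * cmod (poly p c) / \<delta>"
      using \<delta> by (intro divide_right_mono mult_right_mono) (auto simp: q(3))
    also have "\<dots> < (\<delta> ^ degree p / 2) / \<delta>" using c(2) \<delta> by (intro divide_strict_right_mono)
    also have "\<dots> = \<delta> ^ degree q / 2" using \<delta> by (simp add: q(3))
    finally have "cmod ((c - t) * poly (pderiv q) c) < \<delta> ^ degree q / 2" .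
    moreover have "cmod (poly q c) \<le> cmod (poly (pderiv p) c) + cmod ((c - t) * poly (pderiv q) c)"
      unfolding pd by (metis norm_triangle_ineq4 add_diff_cancel_right')
    ultimately show False using lb(1) c(3) q(3) by simp
  qed
  then obtain t' where t': "poly q t' = 0" "cmod (t' - c) < \<delta>" by blast
  have "poly (pderiv p) t = poly q t" unfolding q(1) poly_pderiv_linear_mult by simp
  moreover have "poly p t' = 0" by (simp add: q(1) t'(1))
  ultimately show ?thesis using t t' by (cases "t = t'") auto
qed

lemma monic_root_bound:
  fixes p :: "complex poly"
  assumes "lead_coeff p = 1" "poly p x = 0"
  shows "cmod x \<le> 1 + (\<Sum>i<degree p. cmod (coeff p i))"
proof (cases "cmod x \<le> 1")
  case True
  then show ?thesis by (simp add: add_increasing2 sum_nonneg)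
next
  case False
  have d: "degree p \<noteq> 0"
  proof
    assume "degree p = 0"
    then obtain a where "p = [:a:]" using degree_eq_zeroE by metis
    then show False using assms by simp
  qed
  then obtain m where m: "degree p = Suc m" using not0_implies_Suc by blast
  have "poly p x = (\<Sum>i\<le>degree p. coeff p i * x ^ i)" by (rule poly_altdef)
  then have "x ^ degree p = - (\<Sum>i<degree p. coeff p i * x ^ i)"
    using assms by (simp add: lessThan_Suc_atMost[symmetric] eq_neg_iff_add_eq_0 add.commute)
  then have "cmod x ^ degree p = cmod (\<Sum>i<degree p. coeff p i * x ^ i)" by (metis norm_minus_cancel norm_power)
  also have "\<dots> \<le> (\<Sum>i<degree p. cmod (coeff p i * x ^ i))" by (rule norm_sum)
  also have "\<dots> \<le> (\<Sum>i<degree p. cmod (coeff p i) * cmod x ^ m)"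
    using False by (intro sum_mono) (auto simp: norm_mult norm_power m intro!: mult_left_mono power_increasing)
  also have "\<dots> = (\<Sum>i<degree p. cmod (coeff p i)) * cmod x ^ m" by (simp add: sum_distrib_right)
  finally have "cmod x * cmod x ^ m \<le> (\<Sum>i<degree p. cmod (coeff p i)) * cmod x ^ m" by (simp add: m)
  then have "cmod x \<le> (\<Sum>i<degree p. cmod (coeff p i))" by (rule mult_right_le_imp_le) (use False in \<open>auto intro!: zero_less_power\<close>)
  then show ?thesis by simp
qed

section \<open>Openness of a normalization\<close>

lemma norm_complex_scale: "norm (c *s x) = cmod c * norm x" for x :: "complex ^ 'n"
  by (simp add: norm_vec_def norm_mult L2_set_right_distrib)

lemma finite_vec_set:
  fixes S :: "'n::finite \<Rightarrow> 'a set"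
  assumes "\<And>j. finite (S j)" shows "finite {w. \<forall>j. w $ j \<in> S j}"
proof -
  have "{w. \<forall>j. w $ j \<in> S j} \<subseteq> vec_lambda ` (PiE UNIV S)"
  proof
    fix w assume "w \<in> {w. \<forall>j. w $ j \<in> S j}"
    then have "vec_nth w \<in> PiE UNIV S" "w = vec_lambda (vec_nth w)" by (auto simp: vec_lambda_eta)
    then show "w \<in> vec_lambda ` (PiE UNIV S)" by blast
  qed
  moreover have "finite (PiE UNIV S)" using assms by (intro finite_PiE) auto
  ultimately show ?thesis by (meson finite_imageI finite_subset)
qed

lemma closed_zeros: "closed (zeros P)"
proof -
  have "zeros P = (\<Inter>f\<in>P. {w. ev f w = 0})" by (auto simp: zeros_def)
  moreover have "closed {w. ev f w = 0}" for f
    using continuous_closed_preimage_constant[OF continuous_ev[of UNIV f] closed_UNIV, of 0] by simp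
  ultimately show ?thesis by auto
qed

lemma continuous_matrix: "continuous_on S ((*v) (A :: complex ^ 'n ^ 'n::finite))"
  unfolding matrix_vector_mult_def by (intro continuous_intros)

context normalization begin

lemma evp_fiber: "coeffs_in B F \<Longrightarrow> \<pi> *v w = \<pi> *v a \<Longrightarrow> evp w F = evp a F"
  by (rule poly_eqI) (metis coeff_evp coeffs_in_def invariants_iff)

lemma ex_coordinate_relations:
  "\<exists>F. \<forall>j. coeffs_in B (F j) \<and> lead_coeff (F j) = 1 \<and> poly (F j) (ccoord j) \<in> P"
  using integral_over_finite[OF idealP subring_invariants fin] by (intro choice allI)

lemma finite_fiber: "finite {w \<in> zeros P. \<pi> *v w = \<pi> *v a}"
proof -
  obtain F where F: "\<And>j. coeffs_in B (F j)" "\<And>j. lead_coeff (F j) = 1" "\<And>j. poly (F j) (ccoord j) \<in> P"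
    using ex_coordinate_relations by blast
  let ?S = "\<lambda>j. {t. poly (evp a (F j)) t = 0}"
  have nz: "evp a (F j) \<noteq> 0" for j
  proof
    assume "evp a (F j) = 0"
    then have "coeff (evp a (F j)) (degree (F j)) = 0" by (simp del: coeff_evp)
    then show False using F(2)[of j] by simp
  qed
  have "finite (?S j)" for j by (rule poly_roots_finite[OF nz])
  then have fin: "finite {w. \<forall>j. w $ j \<in> ?S j}" by (rule finite_vec_set)
  have "{w \<in> zeros P. \<pi> *v w = \<pi> *v a} \<subseteq> {w. \<forall>j. w $ j \<in> ?S j}"
  proof clarify
    fix w j assume w: "w \<in> zeros P" "\<pi> *v w = \<pi> *v a"
    have "ev (poly (F j) (ccoord j)) w = 0" using w(1) F(3) by (simp add: zeros_def)
    then show "poly (evp a (F j)) (w $ j) = 0" using evp_fiber[OF F(1) w(2)] by (simp add: ev_poly)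
  qed
  then show ?thesis using fin by (rule finite_subset)
qed

text \<open>
  The coordinates satisfy monic equations with coefficients in \<open>B\<close>, and these coefficients are bounded over bounded sets.
\<close>

lemma zeros_proper: "\<exists>M. \<forall>w\<in>zeros P. dist (\<pi> *v w) y \<le> 1 \<longrightarrow> norm w \<le> M"
proof -
  obtain F where F: "\<And>j. coeffs_in B (F j)" "\<And>j. lead_coeff (F j) = 1" "\<And>j. poly (F j) (ccoord j) \<in> P"
    using ex_coordinate_relations by blast
  let ?g = "\<lambda>x. \<Sum>j\<in>UNIV. 1 + (\<Sum>i<degree (F j). cmod (ev (coeff (F j) i) x))"
  have "continuous_on (cball y 1) ?g" by (intro continuous_intros continuous_ev)
  then have "bounded (?g ` cball y 1)" by (intro compact_imp_bounded compact_continuous_image) auto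
  then obtain M where M: "\<forall>t\<in>?g ` cball y 1. norm t \<le> M" unfolding bounded_iff by blast
  have "norm w \<le> M" if w: "w \<in> zeros P" "dist (\<pi> *v w) y \<le> 1" for w
  proof -
    have "cmod (w $ j) \<le> 1 + (\<Sum>i<degree (F j). cmod (ev (coeff (F j) i) (\<pi> *v w)))" for j
    proof -
      have d: "degree (evp w (F j)) = degree (F j)" by (rule degree_evp_monic[OF F(2)])
      have "ev (poly (F j) (ccoord j)) w = 0" using w(1) F(3) by (simp add: zeros_def)
      then have "poly (evp w (F j)) (w $ j) = 0" by (simp add: ev_poly)
      then have "cmod (w $ j) \<le> 1 + (\<Sum>i<degree (evp w (F j)). cmod (coeff (evp w (F j)) i))"
        by (intro monic_root_bound) (simp_all add: d F(2))
      moreover have "ev (coeff (F j) i) (\<pi> *v w) = ev (coeff (F j) i) w" for i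
        using F(1)[of j] by (simp add: coeffs_in_def invariants_iff)
      ultimately show ?thesis by (simp add: d)
    qed
    then have "(\<Sum>j\<in>UNIV. cmod (w $ j)) \<le> ?g (\<pi> *v w)" by (rule sum_mono)
    moreover have "norm w \<le> (\<Sum>j\<in>UNIV. cmod (w $ j))" unfolding norm_vec_def by (rule L2_set_le_sum) simp
    moreover have "norm (?g (\<pi> *v w)) \<le> M" using w(2) by (intro M[rule_format] imageI) (simp add: dist_commute)
    ultimately show ?thesis by simp
  qed
  then show ?thesis by blast
qed

definition separates :: "'n cpoly \<Rightarrow> complex ^ 'n \<Rightarrow> bool"
  where "separates u z \<longleftrightarrow> (\<forall>w\<in>zeros P. \<pi> *v w = \<pi> *v z \<longrightarrow> ev u w = ev u z \<longrightarrow> w = z)"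

text \<open>
  By properness a sequence of zeros whose projections and \<open>u\<close>-values converge to those of \<open>z\<close> has a limit point; it
  lies in the fibre of \<open>z\<close> and has the same \<open>u\<close>-value, so it is \<open>z\<close>.
\<close>

lemma zeros_near:
  assumes sep: "separates u z" and \<epsilon>: "\<epsilon> > 0"
  shows "\<exists>\<delta>>0. \<forall>w\<in>zeros P. dist (\<pi> *v w) (\<pi> *v z) < \<delta> \<longrightarrow> dist (ev u w) (ev u z) < \<delta> \<longrightarrow> dist w z < \<epsilon>"
proof (rule ccontr)
  assume neg: "\<not> ?thesis"
  have "\<forall>n. \<exists>w. w \<in> zeros P \<and> dist (\<pi> *v w) (\<pi> *v z) < 1 / Suc n \<and> dist (ev u w) (ev u z) < 1 / Suc n \<and> \<epsilon> \<le> dist w z"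
  proof
    fix n :: nat
    have "1 / real (Suc n) > 0" by simp
    then show "\<exists>w. w \<in> zeros P \<and> dist (\<pi> *v w) (\<pi> *v z) < 1 / Suc n \<and> dist (ev u w) (ev u z) < 1 / Suc n \<and> \<epsilon> \<le> dist w z"
      using neg by (meson not_less)
  qed
  from choice[OF this] obtain w where w: "\<And>n. w n \<in> zeros P" "\<And>n. dist (\<pi> *v w n) (\<pi> *v z) < 1 / Suc n"
    "\<And>n. dist (ev u (w n)) (ev u z) < 1 / Suc n" "\<And>n. \<epsilon> \<le> dist (w n) z" by auto
  obtain M where M: "\<And>x. x \<in> zeros P \<Longrightarrow> dist (\<pi> *v x) (\<pi> *v z) \<le> 1 \<Longrightarrow> norm x \<le> M" using zeros_proper by blast
  have "norm (w n) \<le> M" for n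
  proof (rule M[OF w(1)])
    have "1 / real (Suc n) \<le> 1" by simp
    then show "dist (\<pi> *v w n) (\<pi> *v z) \<le> 1" using w(2)[of n] by linarith
  qed
  then have "bounded (range w)" by (auto simp: bounded_iff)
  from bounded_imp_convergent_subsequence[OF this]
  obtain l s where s: "strict_mono s" "(w \<circ> s) \<longlonglongrightarrow> l" by blast
  have lim0: "(\<lambda>n. 1 / real (Suc (s n))) \<longlonglongrightarrow> 0"
    using LIMSEQ_subseq_LIMSEQ[OF lim_1_over_n[THEN LIMSEQ_Suc] s(1)] by (simp add: o_def)
  have "l \<in> zeros P"
    by (rule closed_sequentially[OF closed_zeros _ s(2)]) (simp add: w(1))
  moreover have "\<pi> *v l = \<pi> *v z"
  proof (rule LIMSEQ_unique)
    show "(\<lambda>n. \<pi> *v (w \<circ> s) n) \<longlonglongrightarrow> \<pi> *v l"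
      using continuous_on_tendsto_compose[OF continuous_matrix[of UNIV \<pi>] s(2)] by simp
    show "(\<lambda>n. \<pi> *v (w \<circ> s) n) \<longlonglongrightarrow> \<pi> *v z"
      by (rule metric_tendsto_imp_tendsto[OF lim0]) (use w(2) in \<open>auto intro!: always_eventually less_imp_le simp: dist_real_def\<close>)
  qed
  moreover have "ev u l = ev u z"
  proof (rule LIMSEQ_unique)
    show "(\<lambda>n. ev u ((w \<circ> s) n)) \<longlonglongrightarrow> ev u l"
      using continuous_on_tendsto_compose[OF continuous_ev[of UNIV u] s(2)] by simp
    show "(\<lambda>n. ev u ((w \<circ> s) n)) \<longlonglongrightarrow> ev u z"
      by (rule metric_tendsto_imp_tendsto[OF lim0]) (use w(3) in \<open>auto intro!: always_eventually less_imp_le simp: dist_real_def\<close>)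
  qed
  ultimately have "l = z" using sep by (simp add: separates_def)
  moreover have "\<epsilon> \<le> dist l z"
  proof (rule LIMSEQ_le_const)
    show "(\<lambda>n. dist ((w \<circ> s) n) z) \<longlonglongrightarrow> dist l z" by (intro tendsto_intros s(2))
    show "\<exists>N. \<forall>n\<ge>N. \<epsilon> \<le> dist ((w \<circ> s) n) z" using w(4) by auto
  qed
  ultimately show False using \<epsilon> by simp
qed

lemma eval_continuous: "isCont (\<lambda>a. poly (evp a Q) c) z"
proof -
  have "poly (evp a Q) c = ev (poly Q (cconst c)) a" for a by (simp add: ev_poly)
  then show ?thesis using continuous_ev[of UNIV "poly Q (cconst c)"] by (simp add: continuous_on_eq_continuous_at)
qed

lemma eval_small:
  assumes "poly (evp z Q) c = 0" "\<delta> > 0"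
  shows "\<exists>\<eta>>0. \<forall>a. dist a z < \<eta> \<longrightarrow> cmod (poly (evp a Q) c) < \<delta>"
  using eval_continuous[where Q = Q and c = c and z = z] assms unfolding continuous_at_eps_delta by (auto simp: dist_norm)

lemma projection_near: "\<delta> > 0 \<Longrightarrow> \<exists>\<eta>>0. \<forall>a. dist a z < \<eta> \<longrightarrow> dist (\<pi> *v a) (\<pi> *v z) < \<delta>"
  using continuous_matrix[of UNIV \<pi>] by (simp add: continuous_on_eq_continuous_at continuous_at_eps_delta)

text \<open>
  The minimal polynomial of \<open>u\<close> has the root \<open>u(z)\<close> at \<open>z\<close>, hence a nearby root \<open>t\<close> at a nearby point
  \<open>a\<close>. That root lifts to a zero of \<open>P\<close> over \<open>a\<close>, and \<open>zeros_near\<close> puts the lift close to \<open>z\<close>.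
\<close>

lemma open_at:
  assumes z: "z \<in> zeros P" and sep: "separates u z" and \<epsilon>: "\<epsilon> > 0"
  shows "\<exists>\<eta>>0. \<forall>a. dist a z < \<eta> \<longrightarrow> (\<exists>w\<in>zeros P. \<pi> *v w = \<pi> *v a \<and> dist w z < \<epsilon>)"
proof -
  obtain Q where Q: "is_minpoly u Q" using ex_minpoly by blast
  then have Q': "lead_coeff Q = 1" "poly Q u \<in> P" by (simp_all add: is_minpoly_def)
  have dQ: "degree (evp a Q) = degree Q" for a by (rule degree_evp_monic[OF Q'(1)])
  have rz: "poly (evp z Q) (ev u z) = 0" using z Q'(2) by (auto simp: zeros_def ev_poly)
  obtain \<delta> where \<delta>: "\<delta> > 0" "\<And>w. w \<in> zeros P \<Longrightarrow> dist (\<pi> *v w) (\<pi> *v z) < \<delta> \<Longrightarrow> dist (ev u w) (ev u z) < \<delta> \<Longrightarrow> dist w z < \<epsilon>"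
    using zeros_near[OF sep \<epsilon>] by blast
  obtain \<eta>1 where \<eta>1: "\<eta>1 > 0" "\<And>a. dist a z < \<eta>1 \<Longrightarrow> cmod (poly (evp a Q) (ev u z)) < \<delta> ^ degree Q"
    using eval_small[OF rz, of "\<delta> ^ degree Q"] \<delta>(1) by auto
  obtain \<eta>2 where \<eta>2: "\<eta>2 > 0" "\<And>a. dist a z < \<eta>2 \<Longrightarrow> dist (\<pi> *v a) (\<pi> *v z) < \<delta>"
    using projection_near[OF \<delta>(1)] by blast
  have "\<exists>w\<in>zeros P. \<pi> *v w = \<pi> *v a \<and> dist w z < \<epsilon>" if a: "dist a z < min \<eta>1 \<eta>2" for a
  proof -
    obtain t where t: "poly (evp a Q) t = 0" "cmod (t - ev u z) < \<delta>"
      using monic_root_near[of "evp a Q" \<delta> "ev u z"] \<eta>1(2)[of a] a \<delta>(1) by (auto simp: dQ Q'(1))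
    obtain w where "w \<in> zeros P" "\<pi> *v w = \<pi> *v a" "ev u w = t" using lying_over[OF Q t(1)] by blast
    then show ?thesis using \<delta>(2)[of w] \<eta>2(2)[of a] a t(2) by (auto simp: dist_norm)
  qed
  then show ?thesis using \<eta>1(1) \<eta>2(1) by (intro exI[of _ "min \<eta>1 \<eta>2"]) auto
qed

lemma minpoly_degree_pos: "is_minpoly u Q \<Longrightarrow> degree Q \<noteq> 0"
proof
  assume Q: "is_minpoly u Q" and d: "degree Q = 0"
  then obtain a where "Q = [:a:]" using degree_eq_zeroE by metis
  then show False using Q prime_one[OF prime] by (auto simp: is_minpoly_def)
qed

lemma minpoly_coeff_0: assumes Q: "is_minpoly g Q" and g: "g \<notin> P" shows "coeff Q 0 \<noteq> 0"
proof
  assume z: "coeff Q 0 = 0"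
  obtain S where S: "Q = pCons 0 S" using z by (metis coeff_pCons_0 pCons_cases)
  have Q': "coeffs_in B Q" "lead_coeff Q = 1" "poly Q g \<in> P" "\<And>R. coeffs_in B R \<Longrightarrow> poly R g \<in> P \<Longrightarrow> Q dvd R"
    using Q by (simp_all add: is_minpoly_def)
  have SB: "coeffs_in B S" using Q'(1) unfolding coeffs_in_def S by (metis coeff_pCons_Suc)
  have "g * poly S g \<in> P" using Q'(3) by (simp add: S)
  then have "poly S g \<in> P" using prime_mult[OF prime] g by blast
  then have "Q dvd S" by (rule Q'(4)[OF SB])
  moreover have "S \<noteq> 0" using S Q'(2) by auto
  ultimately have "degree Q \<le> degree S" by (rule dvd_imp_degree_le)
  then show False using \<open>S \<noteq> 0\<close> by (simp add: S)
qed

text \<open>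
  A zero set of a prime ideal has no isolated smaller pieces: if \<open>g\<close> vanished on it near \<open>z\<close>,
  the constant coefficient of the minimal polynomial of \<open>g\<close> would vanish over the projection of a neighbourhood, which is open by
  \<open>open_at\<close>; so it would be zero. But \<open>g \<notin> P\<close> makes it nonzero.
\<close>

lemma not_locally_zero:
  assumes z: "z \<in> zeros P" and sep: "separates u z" and \<epsilon>: "\<epsilon> > 0" and g: "g \<notin> P"
  shows "\<exists>w\<in>zeros P. dist w z < \<epsilon> \<and> ev g w \<noteq> 0"
proof (rule ccontr)
  assume neg: "\<not> ?thesis"
  obtain Q where Q: "is_minpoly g Q" using ex_minpoly by blast
  obtain \<eta> where \<eta>: "\<eta> > 0" "\<And>a. dist a z < \<eta> \<Longrightarrow> \<exists>w\<in>zeros P. \<pi> *v w = \<pi> *v a \<and> dist w z < \<epsilon>"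
    using open_at[OF z sep \<epsilon>] by blast
  have c0: "coeff Q 0 \<in> B" using Q by (simp add: is_minpoly_def coeffs_in_def)
  have near: "ev (coeff Q 0) a = 0" if a: "dist a z < \<eta>" for a
  proof -
    obtain w where w: "w \<in> zeros P" "\<pi> *v w = \<pi> *v a" "dist w z < \<epsilon>" using \<eta>(2)[OF a] by blast
    then have gw: "ev g w = 0" using neg by blast
    have "ev (poly Q g) w = 0" using Q w(1) by (simp add: is_minpoly_def zeros_def)
    then have "ev (coeff Q 0) w = 0" by (simp add: ev_poly gw poly_0_coeff_0)
    then show ?thesis using c0 w(2) by (metis invariants_iff)
  qed
  have "coeff Q 0 = 0"
  proof (rule cpoly_eqI)
    fix x
    let ?p = "on_line z (x - z) (coeff Q 0)"
    have "?p = 0"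
    proof (rule ccontr)
      assume "?p \<noteq> 0"
      then have "finite {t. poly ?p t = 0}" by (rule poly_roots_finite)
      moreover have "(\<lambda>s::real. complex_of_real s) ` {0<..<\<eta> / (1 + norm (x - z))} \<subseteq> {t. poly ?p t = 0}"
      proof
        fix t assume "t \<in> (\<lambda>s::real. complex_of_real s) ` {0<..<\<eta> / (1 + norm (x - z))}"
        then obtain s :: real where s: "0 < s" "s < \<eta> / (1 + norm (x - z))" and t: "t = complex_of_real s" by auto
        have "norm (complex_of_real s *s (x - z)) = s * norm (x - z)"
          using s(1) by (simp add: norm_complex_scale del: vector_ssub_ldistrib)
        also have "\<dots> \<le> s * (1 + norm (x - z))" using s(1) by (intro mult_left_mono) auto
        also have "\<dots> < \<eta>" using s(2) by (simp add: field_simps add_pos_nonneg)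
        finally have "ev (coeff Q 0) (z + complex_of_real s *s (x - z)) = 0"
          by (intro near) (simp add: dist_norm del: vector_ssub_ldistrib)
        then show "t \<in> {t. poly ?p t = 0}" by (simp add: t del: vector_ssub_ldistrib)
      qed
      moreover have "infinite ((\<lambda>s::real. complex_of_real s) ` {0<..<\<eta> / (1 + norm (x - z))})"
      proof
        assume "finite ((\<lambda>s::real. complex_of_real s) ` {0<..<\<eta> / (1 + norm (x - z))})"
        then have "finite {0<..<\<eta> / (1 + norm (x - z))}" by (rule finite_imageD) (simp add: inj_on_def)
        moreover have "0 < \<eta> / (1 + norm (x - z))" using \<eta>(1) by (simp add: add_pos_nonneg)
        ultimately show False using infinite_Ioo by blast
      qed
      ultimately show False using finite_subset by blast
    qed
    then show "ev (coeff Q 0) x = ev 0 x" using poly_on_line[of z "x - z" "coeff Q 0" 1] by simp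
  qed
  then show False using minpoly_coeff_0[OF Q g] by simp
qed

lemma coeffs_in_pderiv: "coeffs_in B Q \<Longrightarrow> coeffs_in B (pderiv Q)"
proof -
  have "of_nat n \<in> B" for n by (induction n) (auto simp: invariants_iff)
  then show "coeffs_in B Q \<Longrightarrow> coeffs_in B (pderiv Q)"
    unfolding coeffs_in_def coeff_pderiv by (blast intro: subring_mult[OF subring_invariants])
qed

lemma minpoly_pderiv: assumes Q: "is_minpoly u Q" shows "poly (pderiv Q) u \<notin> P"
proof
  assume "poly (pderiv Q) u \<in> P"
  moreover have "coeffs_in B (pderiv Q)" using Q by (simp add: is_minpoly_def coeffs_in_pderiv)
  ultimately have "Q dvd pderiv Q" using Q by (simp add: is_minpoly_def)
  then obtain S where "pderiv Q = Q * S" by (rule dvdE)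
  then have "pderiv (evp 0 Q) = evp 0 Q * evp 0 S" using evp_pderiv[of 0 Q] by simp
  then have "evp 0 Q dvd pderiv (evp 0 Q)" by simp
  moreover have "degree (evp 0 Q) \<noteq> 0"
    using minpoly_degree_pos[OF Q] degree_evp_monic[of Q 0] Q by (simp add: is_minpoly_def)
  ultimately show False using not_dvd_pderiv by blast
qed

text \<open>
  The points \<open>a\<close> of \<open>approx\<close> will be points of \<open>V\<close> near \<open>z\<close>, which determine their lifts. Over such a
  point, the two roots of \<open>monic_two_roots_near\<close> lift to the same zero of \<open>P\<close>, so they coincide and form a
  double root; this is excluded by the choice of \<open>a\<close>.
\<close>

lemma simple_root:
  assumes z: "z \<in> zeros P" and sep: "separates u z" and Q: "is_minpoly u Q" and \<epsilon>: "\<epsilon> > 0"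
    and approx: "\<And>\<eta>. \<eta> > 0 \<Longrightarrow> \<exists>a. dist a z < \<eta> \<and> ev (poly (pderiv Q) u) a \<noteq> 0
       \<and> (\<forall>w\<in>zeros P. dist w z < \<epsilon> \<longrightarrow> \<pi> *v w = \<pi> *v a \<longrightarrow> w = a)"
  shows "poly (pderiv (evp z Q)) (ev u z) \<noteq> 0"
proof
  assume dz: "poly (pderiv (evp z Q)) (ev u z) = 0"
  have Q': "lead_coeff Q = 1" "poly Q u \<in> P" "coeffs_in B Q" using Q by (simp_all add: is_minpoly_def)
  let ?m = "degree Q" and ?c = "ev u z"
  have dQ: "degree (evp a Q) = ?m" for a by (rule degree_evp_monic[OF Q'(1)])
  have rz: "poly (evp z Q) ?c = 0" using z Q'(2) by (auto simp: zeros_def ev_poly)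
  have dz': "poly (evp z (pderiv Q)) ?c = 0" using dz by (simp add: evp_pderiv)
  obtain \<delta> where \<delta>: "\<delta> > 0" "\<And>w. w \<in> zeros P \<Longrightarrow> dist (\<pi> *v w) (\<pi> *v z) < \<delta> \<Longrightarrow> dist (ev u w) ?c < \<delta> \<Longrightarrow> dist w z < \<epsilon>"
    using zeros_near[OF sep \<epsilon>] by blast
  \<comment> \<open>small enough for both bounds on the value in \<open>monic_two_roots_near\<close>\<close>
  let ?b = "\<delta> ^ ?m / (2 * (1 + real ?m))"
  have "?b > 0" using \<delta>(1) by (intro divide_pos_pos) auto
  then obtain \<eta>1 where \<eta>1: "\<eta>1 > 0" "\<And>a. dist a z < \<eta>1 \<Longrightarrow> cmod (poly (evp a Q) ?c) < ?b"
    using eval_small[OF rz] by blast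
  obtain \<eta>2 where \<eta>2: "\<eta>2 > 0" "\<And>a. dist a z < \<eta>2 \<Longrightarrow> cmod (poly (evp a (pderiv Q)) ?c) < \<delta> ^ (?m - 1) / 2"
    using eval_small[OF dz', of "\<delta> ^ (?m - 1) / 2"] \<delta>(1) by auto
  obtain \<eta>3 where \<eta>3: "\<eta>3 > 0" "\<And>a. dist a z < \<eta>3 \<Longrightarrow> dist (\<pi> *v a) (\<pi> *v z) < \<delta>"
    using projection_near[OF \<delta>(1)] by blast
  obtain a where a: "dist a z < min \<eta>1 (min \<eta>2 \<eta>3)" "ev (poly (pderiv Q) u) a \<noteq> 0"
    "\<And>w. w \<in> zeros P \<Longrightarrow> dist w z < \<epsilon> \<Longrightarrow> \<pi> *v w = \<pi> *v a \<Longrightarrow> w = a"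
    using approx[of "min \<eta>1 (min \<eta>2 \<eta>3)"] \<eta>1(1) \<eta>2(1) \<eta>3(1) by auto
  have s: "cmod (poly (evp a Q) ?c) < ?b" using \<eta>1(2) a(1) by simp
  then have s': "2 * (1 + real ?m) * cmod (poly (evp a Q) ?c) < \<delta> ^ ?m" by (simp add: field_simps)
  have m0: "0 \<le> real ?m * cmod (poly (evp a Q) ?c)" by simp
  have s1: "cmod (poly (evp a Q) ?c) < \<delta> ^ ?m" "real ?m * cmod (poly (evp a Q) ?c) < \<delta> ^ ?m / 2"
  proof -
    have "2 * cmod (poly (evp a Q) ?c) + 2 * (real ?m * cmod (poly (evp a Q) ?c)) < \<delta> ^ ?m"
      using s' by (simp add: algebra_simps)
    then show "cmod (poly (evp a Q) ?c) < \<delta> ^ ?m" "real ?m * cmod (poly (evp a Q) ?c) < \<delta> ^ ?m / 2"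
      using m0 norm_ge_zero[of "poly (evp a Q) ?c"] by linarith+
  qed
  have s2: "cmod (poly (pderiv (evp a Q)) ?c) < \<delta> ^ (?m - 1) / 2" using \<eta>2(2) a(1) by (simp add: evp_pderiv)
  have "\<exists>t t'. poly (evp a Q) t = 0 \<and> poly (evp a Q) t' = 0 \<and> cmod (t - ?c) < \<delta> \<and> cmod (t' - ?c) < \<delta> \<and> (t \<noteq> t' \<or> poly (pderiv (evp a Q)) t = 0)"
    by (rule monic_two_roots_near) (use s1 s2 \<delta>(1) in \<open>simp_all add: dQ Q'(1)\<close>)
  then obtain t t' where t: "poly (evp a Q) t = 0" "poly (evp a Q) t' = 0" "cmod (t - ?c) < \<delta>" "cmod (t' - ?c) < \<delta>"
    "t \<noteq> t' \<or> poly (pderiv (evp a Q)) t = 0" by blast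
  have root: "ev u a = t" if t: "poly (evp a Q) t = 0" "cmod (t - ?c) < \<delta>" for t
  proof -
    obtain w where w: "w \<in> zeros P" "\<pi> *v w = \<pi> *v a" "ev u w = t" using lying_over[OF Q t(1)] by blast
    have "dist w z < \<epsilon>" using \<delta>(2)[OF w(1)] \<eta>3(2)[of a] a(1) t(2) w(2,3) by (simp add: dist_norm)
    then show ?thesis using a(3)[OF w(1) _ w(2)] w(3) by simp
  qed
  have "t = t'" using root t by metis
  then have "poly (pderiv (evp a Q)) t = 0" using t(5) by simp
  then show False using a(2) root[OF t(1,3)] by (simp add: ev_poly evp_pderiv)
qed

end


section \<open>Gradients and complex linear maps\<close>

text \<open>
  The complex bilinear pairing, without conjugation: gradients of polynomials pair with tangent vectors in this way.
\<close>

definition pairing :: "complex ^ 'n \<Rightarrow> complex ^ 'n::finite \<Rightarrow> complex"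
  where "pairing \<eta> x = (\<Sum>j\<in>UNIV. \<eta> $ j * x $ j)"

lemma pairing_simps:
  "pairing (a + b) x = pairing a x + pairing b x" "pairing \<eta> (x + y) = pairing \<eta> x + pairing \<eta> y"
  "pairing (c *s \<eta>) x = c * pairing \<eta> x" "pairing \<eta> (c *s x) = c * pairing \<eta> x"
  "pairing 0 x = 0" "pairing \<eta> 0 = 0" "pairing \<eta> (x - y) = pairing \<eta> x - pairing \<eta> y" "pairing \<eta> (- x) = - pairing \<eta> x"
  "pairing (a - b) x = pairing a x - pairing b x"
  by (simp_all add: pairing_def algebra_simps sum.distrib sum_distrib_left sum_subtractf sum_negf)

lemma scaleR_complex_vec: "r *\<^sub>R x = complex_of_real r *s x" for x :: "complex ^ 'n"
  unfolding vec_eq_iff vector_scaleR_component vector_smult_component by (simp add: scaleR_conv_of_real)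

lemma linear_matrix_vector_mult: "linear ((*v) A)" for A :: "complex ^ 'n ^ 'n::finite"
  by (rule linearI) (simp_all add: matrix_vector_right_distrib scaleR_complex_vec vector_scalar_commute)

lemma bounded_linear_pairing: "bounded_linear (pairing \<eta>)"
  unfolding pairing_def
  by (intro bounded_linear_sum bounded_linear_mult_right[THEN bounded_linear_compose] bounded_linear_vec_nth)

lemma pairing_axis: "pairing \<eta> (axis j 1) = \<eta> $ j"
  by (simp add: pairing_def axis_def if_distrib[of "\<lambda>c. _ * c"] cong: if_cong)

lemma pairing_eqI: "(\<And>x. pairing a x = pairing b x) \<Longrightarrow> a = b"
  by (metis pairing_axis vec_eq_iff)

definition has_gradient :: "'n::finite cpoly \<Rightarrow> complex ^ 'n \<Rightarrow> complex ^ 'n \<Rightarrow> bool"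
  where "has_gradient f x \<eta> \<longleftrightarrow> (ev f has_derivative pairing \<eta>) (at x)"

lemma ev_fun: "ev (f + g) = (\<lambda>x. ev f x + ev g x)" "ev (f * g) = (\<lambda>x. ev f x * ev g x)"
  "ev (cconst c) = (\<lambda>x. c)" "ev (ccoord j) = (\<lambda>x. x $ j)"
  by auto

lemma has_gradient_const: "has_gradient (cconst c) x 0"
  unfolding has_gradient_def ev_fun by (simp add: pairing_simps[abs_def])

lemma has_gradient_add: "has_gradient f x a \<Longrightarrow> has_gradient g x b \<Longrightarrow> has_gradient (f + g) x (a + b)"
  unfolding has_gradient_def ev_fun pairing_simps[abs_def] by (rule has_derivative_add)

lemma has_gradient_mult:
  "has_gradient f x a \<Longrightarrow> has_gradient g x b \<Longrightarrow> has_gradient (f * g) x (ev f x *s b + ev g x *s a)"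
  unfolding has_gradient_def ev_fun
  by (drule (1) has_derivative_mult) (simp add: pairing_simps[abs_def] mult.commute)

lemma has_gradient_coord: "has_gradient (ccoord j) x (axis j 1)"
proof -
  have "pairing (axis j 1) = (\<lambda>x. x $ j)"
    by (rule ext) (simp add: pairing_def axis_def if_distrib[of "\<lambda>c. c * _"] cong: if_cong)
  then show ?thesis unfolding has_gradient_def ev_fun
    by (simp add: bounded_linear_imp_has_derivative bounded_linear_vec_nth)
qed

lemma ex_gradient: "\<exists>\<eta>. has_gradient f x \<eta>"
  by (induction f rule: cpoly_induct)
    (use has_gradient_const has_gradient_coord has_gradient_add has_gradient_mult in blast)+

lemma complex_linear_matrix:
  fixes D :: "complex ^ 'n::finite \<Rightarrow> complex ^ 'n"
  assumes "linear D" "\<And>c v. D (c *s v) = c *s D v"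
  shows "\<exists>A. D = (*v) A"
proof -
  have "D v = matrix D *v v" for v
  proof -
    have "D v = D (\<Sum>j\<in>UNIV. v $ j *s axis j 1)" by (simp add: basis_expansion)
    also have "\<dots> = (\<Sum>j\<in>UNIV. v $ j *s D (axis j 1))"
      using assms by (simp add: linear_sum)
    also have "\<dots> = matrix D *v v"
      by (simp add: vec_eq_iff matrix_vector_mult_def matrix_def mult.commute)
    finally show ?thesis .
  qed
  then show ?thesis by blast
qed

lemma holomorphic_map_matrix:
  assumes "holomorphic_map_on \<phi> U" "x \<in> U"
  shows "\<exists>A. (\<phi> has_derivative (*v) A) (at x)"
proof -
  obtain D where D: "(\<phi> has_derivative D) (at x)" "\<And>c v. D (c *s v) = c *s D v"
    using assms unfolding holomorphic_map_on_def by blast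
  obtain A where "D = (*v) A" using complex_linear_matrix[OF has_derivative_linear[OF D(1)] D(2)] by blast
  then show ?thesis using D(1) by blast
qed

lemma bounded_linear_complex_scale: "bounded_linear (\<lambda>t::complex. t *s d)" for d :: "complex ^ 'n::finite"
  by (rule linear_conv_bounded_linear[THEN iffD1], rule linearI)
    (simp_all add: vec_eq_iff algebra_simps)

lemma has_derivative_on_complex_line:
  fixes d :: "complex ^ 'n::finite"
  assumes "(F has_derivative (*v) A) (at (p + t *s d))"
  shows "((\<lambda>t. F (p + t *s d)) has_derivative (\<lambda>s. s *s (A *v d))) (at t)"
proof -
  have "((\<lambda>t::complex. t *s d) has_derivative (\<lambda>t. t *s d)) (at t)"
    by (rule bounded_linear_imp_has_derivative[OF bounded_linear_complex_scale])
  then have "((\<lambda>t. p + t *s d) has_derivative (\<lambda>s. s *s d)) (at t)"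
    by (auto intro!: derivative_eq_intros)
  from diff_chain_at[OF this, of F "(*v) A"] assms show ?thesis
    by (simp add: o_def vector_scalar_commute)
qed

lemma matrix_bound: "\<exists>K>0. \<forall>x. norm ((A::complex ^ 'n ^ 'n::finite) *v x) \<le> K * norm x"
proof -
  have "bounded_linear ((*v) A)"
    using linear_matrix_vector_mult[of A] by (simp add: linear_conv_bounded_linear)
  from bounded_linear.pos_bounded[OF this] show ?thesis by (auto simp: mult.commute)
qed

section \<open>Strict differentiability of holomorphic maps\<close>

text \<open>
  On a complex line through \<open>p\<close> and \<open>q\<close>, the difference of \<open>G\<close> and its linearization at \<open>z\<close> is a holomorphic function
  of one variable. It is small compared with the radius on a disc, so Cauchy's inequality makes its derivative small on a
  smaller disc, and the mean value inequality applies.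
\<close>

lemma holomorphic_strictly_differentiable:
  fixes G :: "complex ^ 'n::finite \<Rightarrow> complex ^ 'n"
  assumes hol: "holomorphic_map_on G W" and W: "open W" "z \<in> W" and A: "(G has_derivative (*v) A) (at z)"
    and \<epsilon>: "\<epsilon> > 0"
  shows "\<exists>\<delta>>0. \<forall>p q. dist p z < \<delta> \<longrightarrow> dist q z < \<delta> \<longrightarrow> norm (G q - G p - A *v (q - p)) \<le> \<epsilon> * norm (q - p)"
proof -
  define \<epsilon>' where "\<epsilon>' = \<epsilon> / (3 * real CARD('n))"
  have \<epsilon>': "\<epsilon>' > 0" using \<epsilon> by (simp add: \<epsilon>'_def)
  obtain d1 where d1: "d1 > 0" "\<And>y. norm (y - z) < d1 \<Longrightarrow> norm (G y - G z - A *v (y - z)) \<le> \<epsilon>' * norm (y - z)"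
    using A \<epsilon>' unfolding has_derivative_at_alt by blast
  obtain d2 where d2: "d2 > 0" "ball z d2 \<subseteq> W" using W open_contains_ball by blast
  \<comment> \<open>the line stays within distance \<open>5 \<delta>\<close> of \<open>z\<close> for parameters up to \<open>R = 4 \<delta> / norm (q - p) > 2\<close>\<close>
  define \<delta> where "\<delta> = min d1 d2 / 5"
  have \<delta>: "\<delta> > 0" "5 * \<delta> \<le> d1" "5 * \<delta> \<le> d2" using d1(1) d2(1) by (auto simp: \<delta>_def)
  have "norm (G q - G p - A *v (q - p)) \<le> \<epsilon> * norm (q - p)" if p: "dist p z < \<delta>" and q: "dist q z < \<delta>" for p q
  proof (cases "p = q")
    case False
    let ?d = "q - p"
    have nd: "norm ?d > 0" "norm ?d < 2 * \<delta>" 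
    proof -
      show "norm ?d > 0" using False by simp
      have "dist q p < \<delta> + \<delta>" by (rule dist_triangle_less_add[OF q p])
      then show "norm ?d < 2 * \<delta>" by (simp add: dist_norm)
    qed
    define R where "R = 4 * \<delta> / norm ?d"
    have R: "R > 2" "R * norm ?d = 4 * \<delta>" 
      using nd by (simp_all add: R_def less_divide_eq)
    have inb: "norm (p + t *s ?d - z) < 5 * \<delta>" if "cmod t < R" for t
    proof -
      have "norm (p + t *s ?d - z) \<le> norm (p - z) + norm (t *s ?d)"
        using norm_triangle_ineq[of "p - z" "t *s ?d"] by (simp add: algebra_simps)
      also have "norm (t *s ?d) = cmod t * norm ?d" by (rule norm_complex_scale)
      also have "\<dots> \<le> R * norm ?d" using that by (intro mult_right_mono) auto
      finally show ?thesis using p R(2) by (simp add: dist_norm)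
    qed
    have comp: "cmod ((G q - G p - A *v ?d) $ j) \<le> 3 * \<epsilon>' * norm ?d" for j
    proof -
      define H where "H = (\<lambda>t. (G (p + t *s ?d) - G z - A *v (p + t *s ?d - z)) $ j)"
      have Hd: "\<exists>D. (H has_field_derivative D) (at t)" if t: "cmod t < R" for t
      proof -
        have "p + t *s ?d \<in> W" 
        proof (rule subsetD[OF d2(2)])
          have "dist (p + t *s ?d) z < d2" using inb[OF t] \<delta>(3) unfolding dist_norm by linarith
          then show "p + t *s ?d \<in> ball z d2" by (simp only: mem_ball dist_commute)
        qed
        from holomorphic_map_matrix[OF hol this] obtain A' where "(G has_derivative (*v) A') (at (p + t *s ?d))" by blast
        from has_derivative_on_complex_line[OF this]
        have 1: "((\<lambda>t. G (p + t *s ?d)) has_derivative (\<lambda>s. s *s (A' *v ?d))) (at t)" .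
        have eq: "H = (\<lambda>t. G (p + t *s ?d) $ j - (G z $ j + (A *v (p - z)) $ j) - t * (A *v ?d) $ j)"
          by (rule ext) (simp only: H_def vector_minus_component vector_add_component vector_smult_component
            matrix_vector_right_distrib matrix_vector_mult_diff_distrib vector_scalar_commute, simp add: algebra_simps)
        have "((\<lambda>t. G (p + t *s ?d) $ j) has_derivative (\<lambda>s. (s *s (A' *v ?d)) $ j)) (at t)"
          using bounded_linear.has_derivative[OF bounded_linear_vec_nth 1] .
        then have "((\<lambda>t. G (p + t *s ?d) $ j) has_field_derivative (A' *v ?d) $ j) (at t)"
          unfolding has_field_derivative_def vector_smult_component mult.commute[of _ "(A' *v ?d) $ j"] .
        then have "(H has_field_derivative (A' *v ?d) $ j - 0 - 1 * (A *v ?d) $ j) (at t)"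
          unfolding eq by (intro DERIV_diff DERIV_const DERIV_cmult_right DERIV_ident)
        then show ?thesis ..
      qed
      have Hhol: "H holomorphic_on ball 0 R"
      proof (rule holomorphic_onI)
        fix t assume "t \<in> ball (0::complex) R"
        then have "H field_differentiable at t" unfolding field_differentiable_def by (intro Hd) simp
        then show "H field_differentiable at t within ball 0 R" by (rule field_differentiable_at_within)
      qed
      have Hb: "cmod (H t) \<le> \<epsilon>' * (5 * \<delta>)" if t: "cmod t < R" for t
      proof -
        have "cmod (H t) \<le> norm (G (p + t *s ?d) - G z - A *v (p + t *s ?d - z))"
          unfolding H_def by (rule Finite_Cartesian_Product.norm_nth_le)
        also have "\<dots> \<le> \<epsilon>' * norm (p + t *s ?d - z)" using inb[OF t] \<delta>(2) by (intro d1(2)) linarith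
        also have "\<dots> \<le> \<epsilon>' * (5 * \<delta>)" using inb[OF t] \<epsilon>' by (intro mult_left_mono) auto
        finally show ?thesis .
      qed
      have Hderiv: "cmod (deriv H s) \<le> 3 * \<epsilon>' * norm ?d" if s: "s \<in> cball 0 1" for s
      proof -
        have sub: "cmod t < R" if "t \<in> cball s (R / 2)" for t
        proof -
          have "cmod t \<le> cmod s + cmod (t - s)" using norm_triangle_ineq[of s "t - s"] by simp
          also have "\<dots> \<le> 1 + R / 2" using that s by (intro add_mono) (simp_all add: dist_norm norm_minus_commute)
          finally show ?thesis using R(1) by simp
        qed
        have "cmod ((deriv ^^ 1) H s) \<le> fact 1 * (\<epsilon>' * (5 * \<delta>)) / (R / 2) ^ 1"
        proof (rule Cauchy_inequality)
          have sub': "cball s (R / 2) \<subseteq> ball 0 R"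
          proof
            fix t assume "t \<in> cball s (R / 2)"
            then show "t \<in> ball 0 R" using sub[of t] by simp
          qed
          then show "continuous_on (cball s (R / 2)) H"
            by (intro holomorphic_on_imp_continuous_on holomorphic_on_subset[OF Hhol])
          show "H holomorphic_on ball s (R / 2)"
            by (rule holomorphic_on_subset[OF Hhol subset_trans[OF ball_subset_cball sub']])
          show "0 < R / 2" using R(1) by simp
          show "cmod (H x) \<le> \<epsilon>' * (5 * \<delta>)" if "cmod (s - x) = R / 2" for x
            using that by (intro Hb sub) (simp add: dist_norm)
        qed
        also have "fact 1 * (\<epsilon>' * (5 * \<delta>)) / (R / 2) ^ 1 = 10 * \<epsilon>' * \<delta> / R" by simp
        also have "\<dots> = 5 / 2 * \<epsilon>' * norm ?d" 
        proof -
          have "\<delta> / R = norm ?d / 4" unfolding R_def using nd(1) \<delta>(1) by simp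
          then have "10 * \<epsilon>' * (\<delta> / R) = 10 * \<epsilon>' * (norm ?d / 4)" by (simp only:)
          also have "\<dots> = 5 / 2 * \<epsilon>' * norm ?d" by simp
          also have "10 * \<epsilon>' * (\<delta> / R) = 10 * \<epsilon>' * \<delta> / R" by simp
          finally show ?thesis .
        qed
        also have "\<dots> \<le> 3 * \<epsilon>' * norm ?d" using \<epsilon>' by (intro mult_right_mono) auto
        finally show ?thesis by simp
      qed
      have "cmod (H 1 - H 0) \<le> 3 * \<epsilon>' * norm ?d * cmod (1 - 0)"
      proof (rule field_differentiable_bound[of "cball 0 1" H "deriv H"])
        show "(H has_field_derivative deriv H t) (at t within cball 0 1)" if "t \<in> cball 0 1" for t
        proof -
          have "cmod t < R" using that R(1) by simp
          then have "H field_differentiable at t" unfolding field_differentiable_def by (rule Hd)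
          then have "(H has_field_derivative deriv H t) (at t)" by (simp add: DERIV_deriv_iff_field_differentiable)
          then show ?thesis by (rule has_field_derivative_at_within)
        qed
        show "cmod (deriv H t) \<le> 3 * \<epsilon>' * norm ?d" if "t \<in> cball 0 1" for t
          by (rule Hderiv[OF that])
      qed (simp_all add: convex_cball)
      moreover have "H 1 - H 0 = (G q - G p - A *v ?d) $ j"
      proof -
        have e: "p + 1 *s ?d = q" "p + 0 *s ?d = p" by simp_all
        show ?thesis
          unfolding H_def e matrix_vector_mult_diff_distrib vector_minus_component by simp
      qed
      ultimately show ?thesis by (simp only: diff_zero norm_one mult_1_right)
    qed
    have "norm (G q - G p - A *v ?d) \<le> (\<Sum>j\<in>UNIV. cmod ((G q - G p - A *v ?d) $ j))"
      unfolding norm_vec_def by (rule L2_set_le_sum) simp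
    also have "\<dots> \<le> (\<Sum>j\<in>(UNIV::'n set). 3 * \<epsilon>' * norm ?d)" by (rule sum_mono) (rule comp)
    also have "\<dots> = \<epsilon> * norm ?d" by (simp add: \<epsilon>'_def)
    finally show ?thesis .
  qed simp
  then show ?thesis using \<delta>(1) by blast
qed

section \<open>Local geometry of a submanifold\<close>

lemma has_derivative_matrix_compose:
  fixes F G :: "complex ^ 'n::finite \<Rightarrow> complex ^ 'n"
  assumes F: "(F has_derivative (*v) A) (at z)" and G: "(G has_derivative (*v) C) (at (F z))"
    and U: "open U" "z \<in> U" "\<And>x. x \<in> U \<Longrightarrow> G (F x) = x"
  shows "C *v (A *v v) = v"
proof -
  have "((\<lambda>x. G (F x)) has_derivative (\<lambda>v. C *v (A *v v))) (at z)"
    using diff_chain_at[OF F G] by (simp add: o_def)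
  moreover have "((\<lambda>x. G (F x)) has_derivative (\<lambda>v. v)) (at z)"
    by (rule has_derivative_transform_within_open[OF has_derivative_ident U(1,2)]) (simp add: U(3))
  ultimately have "(\<lambda>v. C *v (A *v v)) = (\<lambda>v. v)" by (rule has_derivative_unique)
  from fun_cong[OF this, of v] show ?thesis .
qed

text \<open>
  A chart as in the definition of a submanifold, together with the matrices of its derivative and of the
  derivative of its inverse.
\<close>

locale submanifold_chart =
  fixes V :: "(complex ^ 'n::finite) set" and z :: "complex ^ 'n" and U \<phi> \<psi> J A A'
  assumes z: "z \<in> V" and U: "open U" "z \<in> U" "open (\<phi> ` U)"
    and hol: "holomorphic_map_on \<phi> U" "holomorphic_map_on \<psi> (\<phi> ` U)" and inv: "\<And>x. x \<in> U \<Longrightarrow> \<psi> (\<phi> x) = x"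
    and straight: "\<phi> ` (V \<inter> U) = \<phi> ` U \<inter> {w. \<forall>j. j \<notin> J \<longrightarrow> w $ j = 0}"
    and dphi: "(\<phi> has_derivative (*v) A) (at z)" and dpsi: "(\<psi> has_derivative (*v) A') (at (\<phi> z))"
begin

abbreviation plane :: "(complex ^ 'n) set" where "plane \<equiv> {w. \<forall>j. j \<notin> J \<longrightarrow> w $ j = 0}"

lemma psi_in: assumes "y \<in> \<phi> ` U" "y \<in> plane" shows "\<psi> y \<in> V" "\<psi> y \<in> U" "\<phi> (\<psi> y) = y"
proof -
  have "y \<in> \<phi> ` (V \<inter> U)" unfolding straight using assms by simp
  then obtain x where "x \<in> V" "x \<in> U" "y = \<phi> x" by auto
  then show "\<psi> y \<in> V" "\<psi> y \<in> U" "\<phi> (\<psi> y) = y" using inv[of x] by simp_all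
qed

lemma phi_in: assumes "x \<in> V" "x \<in> U" shows "\<phi> x \<in> plane"
proof -
  have "\<phi> x \<in> \<phi> ` (V \<inter> U)" using assms by blast
  then show ?thesis unfolding straight by simp
qed

lemma A'A: "A' *v (A *v v) = v" using has_derivative_matrix_compose[OF dphi dpsi U(1,2) inv] .

lemma AA': "A *v (A' *v v) = v"
proof (rule has_derivative_matrix_compose[OF dpsi _ U(3)])
  show "(\<phi> has_derivative (*v) A) (at (\<psi> (\<phi> z)))" using dphi inv[OF U(2)] by simp
  show "\<phi> z \<in> \<phi> ` U" using U(2) by simp
  show "\<phi> (\<psi> x) = x" if "x \<in> \<phi> ` U" for x using that inv by auto
qed

lemma tangent_space_eq: "tangent_space V z = (*v) A' ` plane"
proof
  show "(*v) A' ` plane \<subseteq> tangent_space V z"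
  proof
    fix v assume "v \<in> (*v) A' ` plane"
    then obtain w where w: "w \<in> plane" "v = A' *v w" by (rule imageE)
    let ?\<gamma> = "\<lambda>t::real. \<phi> z + t *\<^sub>R w"
    let ?c = "\<lambda>t::real. \<psi> (\<phi> z + t *\<^sub>R w)"
    have "?c 0 = z" using inv U(2) by simp
    moreover have "\<forall>\<^sub>F t in at 0. ?c t \<in> V"
    proof -
      have "(?\<gamma> \<longlongrightarrow> \<phi> z + 0 *\<^sub>R w) (at 0)" by (intro tendsto_intros)
      then have "(?\<gamma> \<longlongrightarrow> \<phi> z) (at 0)" by simp
      from topological_tendstoD[OF this U(3)] have "\<forall>\<^sub>F t in at 0. ?\<gamma> t \<in> \<phi> ` U" using U(2) by simp
      then show ?thesis
      proof eventually_elim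
        case (elim t)
        have "?\<gamma> t \<in> plane" using phi_in[OF z U(2)] w(1) by auto
        with elim show ?case by (rule psi_in(1))
      qed
    qed
    moreover have "(?c has_vector_derivative v) (at 0)"
    proof -
      have "(?\<gamma> has_derivative (\<lambda>t. t *\<^sub>R w)) (at 0)" by (auto intro!: derivative_eq_intros)
      from diff_chain_at[OF this, of \<psi> "(*v) A'"] dpsi
      have "(?c has_derivative (\<lambda>t. A' *v (t *\<^sub>R w))) (at 0)" by (simp add: o_def)
      then show ?thesis unfolding has_vector_derivative_def by (simp add: w(2) scaleR_complex_vec vector_scalar_commute)
    qed
    ultimately show "v \<in> tangent_space V z" unfolding tangent_space_def by (intro CollectI exI[of _ ?c] conjI)
  qed
  show "tangent_space V z \<subseteq> (*v) A' ` plane"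
  proof
    fix v assume "v \<in> tangent_space V z"
    then obtain c :: "real \<Rightarrow> complex ^ 'n" where c: "c 0 = z" "\<forall>\<^sub>F t in at 0. c t \<in> V" "(c has_vector_derivative v) (at 0)"
      unfolding tangent_space_def by (elim CollectE exE conjE)
    have "isCont c 0" using c(3) has_vector_derivative_continuous by blast
    then have "(c \<longlongrightarrow> z) (at 0)" using c(1) by (simp add: isCont_def)
    from topological_tendstoD[OF this U(1,2)] have ev: "\<forall>\<^sub>F t in at 0. \<phi> (c t) \<in> plane"
      using c(2) by eventually_elim (rule phi_in)
    have "(A *v v) $ j = 0" if j: "j \<notin> J" for j
    proof -
      have "(c has_derivative (\<lambda>t. t *\<^sub>R v)) (at 0)" using c(3) by (simp add: has_vector_derivative_def)
      from diff_chain_at[OF this, of \<phi> "(*v) A"] dphi c(1)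
      have "((\<lambda>t. \<phi> (c t)) has_derivative (\<lambda>t. A *v (t *\<^sub>R v))) (at 0)" by (simp add: o_def)
      from bounded_linear.has_derivative[OF bounded_linear_vec_nth this, of j]
      have "((\<lambda>t. \<phi> (c t) $ j) has_derivative (\<lambda>t. (A *v (t *\<^sub>R v)) $ j)) (at 0)" .
      moreover have "((\<lambda>t. \<phi> (c t) $ j) has_derivative (\<lambda>t. 0)) (at 0)"
      proof (rule has_derivative_transform_eventually[OF has_derivative_const[of 0]])
        show "\<forall>\<^sub>F t in at 0. 0 = \<phi> (c t) $ j" using ev by eventually_elim (use j in auto)
        show "0 = \<phi> (c 0) $ j" using phi_in[OF z U(2)] j c(1) by auto
      qed simp
      ultimately have "(\<lambda>t::real. (A *v (t *\<^sub>R v)) $ j) = (\<lambda>t. 0)" by (rule has_derivative_unique)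
      from fun_cong[OF this, of 1] show ?thesis by simp
    qed
    then have "A *v v \<in> plane" by simp
    then show "v \<in> (*v) A' ` plane" by (rule image_eqI[rotated]) (simp add: A'A)
  qed
qed

lemma plane_subspace: "vec.subspace plane" unfolding vec.subspace_def by simp

lemma tangent_space_subspace: "vec.subspace (tangent_space V z)"
  unfolding tangent_space_eq by (intro vec.subspace_image matrix_vector_mul_linear_gen plane_subspace)

lemma tangent_space_dim: "vec.dim (tangent_space V z) = card J"
proof -
  have "inj_on ((*v) A') (vec.span plane)" by (rule inj_on_inverseI[of _ "(*v) A"]) (rule AA')
  then have "vec.dim ((*v) A' ` plane) = vec.dim plane"
    by (intro vec.dim_image_eq matrix_vector_mul_linear_gen)
  then show ?thesis by (simp add: tangent_space_eq dim_substandard_cart)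
qed

text \<open>
  In the chart a secant is a difference of points of the coordinate plane; its image under the derivative of
  the inverse chart is tangent and, by strict differentiability, close to the secant.
\<close>

lemma secant_near_tangent:
  assumes \<epsilon>: "\<epsilon> > 0"
  shows "\<exists>\<delta>>0. \<forall>p\<in>V. \<forall>q\<in>V. dist p z < \<delta> \<longrightarrow> dist q z < \<delta> \<longrightarrow>
     (\<exists>\<tau>\<in>tangent_space V z. norm (q - p - \<tau>) \<le> \<epsilon> * norm (q - p))"
proof -
  obtain K where K: "K > 0" "\<And>x. norm (A *v x) \<le> K * norm x" using matrix_bound[of A] by auto
  obtain d1 where d1: "d1 > 0" "\<And>p q. dist p z < d1 \<Longrightarrow> dist q z < d1 \<Longrightarrow> norm (\<phi> q - \<phi> p - A *v (q - p)) \<le> 1 * norm (q - p)"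
    using holomorphic_strictly_differentiable[OF hol(1) U(1,2) dphi zero_less_one] by blast
  have "\<epsilon> / (K + 1) > 0" using \<epsilon> K(1) by simp
  from holomorphic_strictly_differentiable[OF hol(2) U(3) imageI[OF U(2)] dpsi this]
  obtain d2 where d2: "d2 > 0" "\<And>p q. dist p (\<phi> z) < d2 \<Longrightarrow> dist q (\<phi> z) < d2 \<Longrightarrow>
     norm (\<psi> q - \<psi> p - A' *v (q - p)) \<le> \<epsilon> / (K + 1) * norm (q - p)" by blast
  obtain d3 where d3: "d3 > 0" "ball z d3 \<subseteq> U" using U open_contains_ball by blast
  have "isCont \<phi> z" using dphi has_derivative_continuous by blast
  then obtain d4 where d4: "d4 > 0" "\<And>x. dist x z < d4 \<Longrightarrow> dist (\<phi> x) (\<phi> z) < d2"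
    using d2(1) unfolding continuous_at_eps_delta by blast
  define \<delta> where "\<delta> = min (min d1 d3) d4"
  have "\<exists>\<tau>\<in>tangent_space V z. norm (q - p - \<tau>) \<le> \<epsilon> * norm (q - p)"
    if p: "p \<in> V" "dist p z < \<delta>" and q: "q \<in> V" "dist q z < \<delta>" for p q
  proof (rule bexI[of _ "A' *v (\<phi> q - \<phi> p)"])
    have pU: "p \<in> U" "q \<in> U" using p q d3(2) by (auto simp: \<delta>_def dist_commute)
    have "\<phi> q - \<phi> p \<in> plane" using phi_in[OF p(1) pU(1)] phi_in[OF q(1) pU(2)] by simp
    then show "A' *v (\<phi> q - \<phi> p) \<in> tangent_space V z" by (simp add: tangent_space_eq)
    have "norm (\<phi> q - \<phi> p) \<le> norm (\<phi> q - \<phi> p - A *v (q - p)) + norm (A *v (q - p))"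
      using norm_triangle_ineq[of "\<phi> q - \<phi> p - A *v (q - p)" "A *v (q - p)"] by simp
    also have "\<dots> \<le> 1 * norm (q - p) + K * norm (q - p)"
      by (intro add_mono d1(2) K(2)) (use p q in \<open>auto simp: \<delta>_def\<close>)
    finally have L: "norm (\<phi> q - \<phi> p) \<le> (K + 1) * norm (q - p)" by (simp add: algebra_simps)
    have "norm (q - p - A' *v (\<phi> q - \<phi> p)) = norm (\<psi> (\<phi> q) - \<psi> (\<phi> p) - A' *v (\<phi> q - \<phi> p))"
      using inv pU by simp
    also have "\<dots> \<le> \<epsilon> / (K + 1) * norm (\<phi> q - \<phi> p)"
      by (intro d2(2) d4(2)) (use p q in \<open>auto simp: \<delta>_def\<close>)
    also have "\<dots> \<le> \<epsilon> / (K + 1) * ((K + 1) * norm (q - p))"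
      using L \<epsilon> K(1) by (intro mult_left_mono) auto
    also have "\<dots> = \<epsilon> * norm (q - p)" using K(1) by simp
    finally show "norm (q - p - A' *v (\<phi> q - \<phi> p)) \<le> \<epsilon> * norm (q - p)" .
  qed
  moreover have "\<delta> > 0" using d1 d3 d4 by (simp add: \<delta>_def)
  ultimately show ?thesis by blast
qed

lemma cpoly_on_chart_line:
  assumes sub: "\<And>t. t \<in> S \<Longrightarrow> a + t *s d \<in> \<phi> ` U" and S: "open S"
  shows "(\<lambda>t. ev f (\<psi> (a + t *s d))) holomorphic_on S"
proof (rule holomorphic_onI)
  fix t assume t: "t \<in> S"
  obtain A1 where "(\<psi> has_derivative (*v) A1) (at (a + t *s d))"
    using holomorphic_map_matrix[OF hol(2) sub[OF t]] by blast
  from has_derivative_on_complex_line[OF this]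
  have 1: "((\<lambda>t. \<psi> (a + t *s d)) has_derivative (\<lambda>s. s *s (A1 *v d))) (at t)" .
  obtain \<eta> where "(ev f has_derivative pairing \<eta>) (at (\<psi> (a + t *s d)))"
    using ex_gradient unfolding has_gradient_def by blast
  from diff_chain_at[OF 1 this]
  have "((\<lambda>t. ev f (\<psi> (a + t *s d))) has_field_derivative pairing \<eta> (A1 *v d)) (at t)"
    unfolding has_field_derivative_def o_def pairing_simps mult.commute[of _ "pairing \<eta> (A1 *v d)"] .
  then show "(\<lambda>t. ev f (\<psi> (a + t *s d))) field_differentiable at t within S"
    by (meson field_differentiable_at_within field_differentiable_def)
qed

text \<open>
  Through a point of the coordinate plane where \<open>f\<close> is nonzero, restrict \<open>g\<close> to complex lines of the chart: it vanishes
  near that point, hence along the whole line by the identity theorem.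
\<close>

lemma local_integral_domain:
  assumes r: "r > 0" and fg: "\<And>x. x \<in> V \<Longrightarrow> dist x z < r \<Longrightarrow> ev (f * g) x = 0"
  shows "\<exists>r'>0. (\<forall>x\<in>V. dist x z < r' \<longrightarrow> ev f x = 0) \<or> (\<forall>x\<in>V. dist x z < r' \<longrightarrow> ev g x = 0)"
proof -
  have "isCont \<psi> (\<phi> z)" using dpsi has_derivative_continuous by blast
  then obtain d1 where d1: "d1 > 0" "\<And>y. dist y (\<phi> z) < d1 \<Longrightarrow> dist (\<psi> y) (\<psi> (\<phi> z)) < r"
    using r unfolding continuous_at_eps_delta by blast
  obtain d2 where d2: "d2 > 0" "ball (\<phi> z) d2 \<subseteq> \<phi> ` U" using U open_contains_ball by blast
  define \<rho> where "\<rho> = min d1 d2"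
  have "\<rho> > 0" using d1 d2 by (simp add: \<rho>_def)
  have bU: "ball (\<phi> z) \<rho> \<subseteq> \<phi> ` U" using d2(2) by (auto simp: \<rho>_def)
  have prod: "ev f (\<psi> y) * ev g (\<psi> y) = 0" if "y \<in> ball (\<phi> z) \<rho>" "y \<in> plane" for y
  proof -
    have "\<psi> y \<in> V" using psi_in(1)[of y] that bU by blast
    moreover have "dist (\<psi> y) z < r" using d1(2)[of y] that(1) inv[OF U(2)] by (simp add: \<rho>_def dist_commute)
    ultimately show ?thesis using fg by simp
  qed
  have "isCont \<phi> z" using dphi has_derivative_continuous by blast
  then obtain d3 where d3: "d3 > 0" "\<And>x. dist x z < d3 \<Longrightarrow> dist (\<phi> x) (\<phi> z) < \<rho>"
    using \<open>\<rho> > 0\<close> unfolding continuous_at_eps_delta by blast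
  obtain d4 where d4: "d4 > 0" "ball z d4 \<subseteq> U" using U open_contains_ball by blast
  have pull_back: "ev h x = 0" if h: "\<And>y. y \<in> ball (\<phi> z) \<rho> \<Longrightarrow> y \<in> plane \<Longrightarrow> ev h (\<psi> y) = 0"
    and x: "x \<in> V" "dist x z < min d3 d4" for h x
  proof -
    have "x \<in> U" using x(2) d4(2) by (auto simp: dist_commute)
    moreover have "\<phi> x \<in> ball (\<phi> z) \<rho>" using d3(2)[of x] x(2) by (simp add: dist_commute)
    ultimately show ?thesis using h[of "\<phi> x"] phi_in[OF x(1)] inv by simp
  qed
  have pos: "min d3 d4 > 0" using d3 d4 by simp
  show ?thesis
  proof (cases "\<exists>a\<in>ball (\<phi> z) \<rho>. a \<in> plane \<and> ev f (\<psi> a) \<noteq> 0")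
    case False
    then have "\<And>x. x \<in> V \<Longrightarrow> dist x z < min d3 d4 \<Longrightarrow> ev f x = 0" using pull_back[of f] by blast
    then show ?thesis using pos by blast
  next
    case True
    then obtain a where a: "a \<in> ball (\<phi> z) \<rho>" "a \<in> plane" "ev f (\<psi> a) \<noteq> 0" by blast
    have "ev g (\<psi> b) = 0" if b: "b \<in> ball (\<phi> z) \<rho>" "b \<in> plane" for b
    proof -
      let ?l = "\<lambda>t::complex. a + t *s (b - a)"
      define S where "S = ?l -` ball (\<phi> z) \<rho>"
      have cl: "continuous_on UNIV ?l"
        by (intro continuous_intros linear_continuous_on bounded_linear_complex_scale)
      have S: "open S" unfolding S_def using cl by (intro open_vimage) auto
      have "convex S" unfolding S_def
      proof (rule convexI)
        fix s t :: complex and u v :: real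
        assume h: "s \<in> ?l -` ball (\<phi> z) \<rho>" "t \<in> ?l -` ball (\<phi> z) \<rho>" "0 \<le> u" "0 \<le> v" "u + v = 1"
        have "?l (u *\<^sub>R s + v *\<^sub>R t) = u *\<^sub>R ?l s + v *\<^sub>R ?l t"
        proof -
          have v: "v = 1 - u" using h(5) by simp
          show ?thesis
            unfolding v vec_eq_iff vector_scaleR_component vector_smult_component vector_add_component vector_minus_component
            by (simp add: scaleR_conv_of_real algebra_simps)
        qed
        moreover have "u *\<^sub>R ?l s + v *\<^sub>R ?l t \<in> ball (\<phi> z) \<rho>"
          using h convex_ball[of "\<phi> z" \<rho>] unfolding convex_def by blast
        ultimately show "u *\<^sub>R s + v *\<^sub>R t \<in> ?l -` ball (\<phi> z) \<rho>" by (simp del: vector_ssub_ldistrib)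
      qed
      then have conn: "connected S" by (rule convex_connected)
      have SU: "?l t \<in> \<phi> ` U" if "t \<in> S" for t using that bU by (auto simp: S_def)
      have Sp: "?l t \<in> plane" for t using a(2) b(2) by simp
      let ?F = "\<lambda>t. ev f (\<psi> (?l t))" and ?G = "\<lambda>t. ev g (\<psi> (?l t))"
      have F: "?F holomorphic_on S" by (rule cpoly_on_chart_line[OF SU S])
      have G: "?G holomorphic_on S" by (rule cpoly_on_chart_line[OF SU S])
      let ?U = "S \<inter> ?F -` (- {0})"
      have "open ?U" using holomorphic_on_imp_continuous_on[OF F] S by (intro continuous_open_preimage) auto
      have U0: "0 \<in> ?U" using a by (simp add: S_def)
      have zero: "?G t = 0" if "t \<in> ?U" for t
      proof -
        have "?F t * ?G t = 0" using that Sp[of t] by (intro prod) (simp_all add: S_def)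
        moreover have "?F t \<noteq> 0" using that by simp
        ultimately show ?thesis by simp
      qed
      have "1 \<in> S" using b(1) by (simp add: S_def)
      have "?G 1 = 0"
      proof (rule holomorphic_fun_eq_0_on_connected[OF G S conn])
        show "0 \<in> S" using U0 by simp
        fix n
        have "(deriv ^^ n) ?G 0 = (deriv ^^ n) (\<lambda>_. 0) 0"
          by (rule higher_deriv_transform_within_open[OF holomorphic_on_subset[OF G] holomorphic_on_const \<open>open ?U\<close> U0])
            (use zero in auto)
        then show "(deriv ^^ n) ?G 0 = 0" by (cases n) (simp_all del: funpow.simps)
      qed (rule \<open>1 \<in> S\<close>)
      then show ?thesis by simp
    qed
    then have "\<And>x. x \<in> V \<Longrightarrow> dist x z < min d3 d4 \<Longrightarrow> ev g x = 0" using pull_back[of g] by blast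
    then show ?thesis using pos by blast
  qed
qed

end

lemma submanifold_near_chart:
  assumes "z \<in> V" "submanifold_near V k z"
  shows "\<exists>U \<phi> \<psi> J A A'. submanifold_chart V z U \<phi> \<psi> J A A' \<and> card J = k"
proof -
  from assms(2) obtain U \<phi> \<psi> and J :: "'a set" where h: "open U" "z \<in> U" "open (\<phi> ` U)"
      "holomorphic_map_on \<phi> U" "holomorphic_map_on \<psi> (\<phi> ` U)" "\<forall>x\<in>U. \<psi> (\<phi> x) = x"
      "card J = k" "\<phi> ` (V \<inter> U) = \<phi> ` U \<inter> {w. \<forall>j. j \<notin> J \<longrightarrow> w $ j = 0}"
    unfolding submanifold_near_def by blast
  obtain A where A: "(\<phi> has_derivative (*v) A) (at z)" using holomorphic_map_matrix[OF h(4,2)] by blast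
  obtain A' where A': "(\<psi> has_derivative (*v) A') (at (\<phi> z))" using holomorphic_map_matrix[OF h(5)] h(2) by blast
  have "submanifold_chart V z U \<phi> \<psi> J A A'"
    using assms(1) h A A' by unfold_locales auto
  then show ?thesis using h(7) by blast
qed


section \<open>Separating functionals\<close>

lemma vec_subspace_imp_subspace: "vec.subspace T \<Longrightarrow> subspace T" for T :: "(complex ^ 'n::finite) set"
  unfolding subspace_def vec.subspace_def scaleR_complex_vec by blast

lemma Re_pairing_cnj: "Re (pairing (\<chi> j. cnj (a $ j)) x) = inner a x"
  by (simp add: pairing_def inner_vec_def inner_complex_def)

text \<open>
  The conjugate of the component of \<open>d\<close> orthogonal to \<open>T\<close>: its pairing with a vector has the real inner
  product as real part, and \<open>T\<close> is closed under multiplication by the imaginary unit.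
\<close>

lemma functional_vanishing_on_subspace:
  fixes T :: "(complex ^ 'n::finite) set"
  assumes T: "vec.subspace T" and d: "d \<notin> T"
  shows "\<exists>\<eta>. (\<forall>t\<in>T. pairing \<eta> t = 0) \<and> pairing \<eta> d \<noteq> 0"
proof -
  have sp: "span T = T" using vec_subspace_imp_subspace[OF T] by (simp add: span_eq_iff)
  obtain y n where yn: "y \<in> T" "\<And>w. w \<in> T \<Longrightarrow> orthogonal n w" "d = y + n"
    using orthogonal_subspace_decomp_exists[of T d] unfolding sp by metis
  define \<eta> where "\<eta> = (\<chi> j. cnj (n $ j))"
  have re: "Re (pairing \<eta> x) = inner n x" for x unfolding \<eta>_def by (rule Re_pairing_cnj)
  have t0: "pairing \<eta> t = 0" if t: "t \<in> T" for t
  proof -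
    have "Re (pairing \<eta> t) = 0" using yn(2)[OF t] by (simp add: re orthogonal_def)
    moreover have "\<i> *s t \<in> T" by (rule vec.subspace_scale[OF T t])
    then have "Re (pairing \<eta> (\<i> *s t)) = 0" using yn(2) by (simp add: re orthogonal_def)
    then have "Im (pairing \<eta> t) = 0" by (simp add: pairing_simps)
    ultimately show ?thesis by (simp add: complex_eq_iff)
  qed
  have "n \<noteq> 0" using yn d by auto
  then have "Re (pairing \<eta> n) \<noteq> 0" by (simp add: re)
  then have "pairing \<eta> n \<noteq> 0" by auto
  then have "pairing \<eta> d \<noteq> 0" by (simp add: yn(3) pairing_simps t0[OF yn(1)])
  then show ?thesis using t0 by blast
qed

lemma generic_combination:
  fixes a b :: "complex ^ 'n::finite"
  assumes fin: "finite \<Delta>" and b: "\<And>d. d \<in> \<Delta> \<Longrightarrow> pairing b d \<noteq> 0"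
  shows "\<exists>s. s \<noteq> 0 \<and> (\<forall>d\<in>\<Delta>. pairing (a + s *s b) d \<noteq> 0)"
proof -
  have "finite (insert 0 ((\<lambda>d. - pairing a d / pairing b d) ` \<Delta>))" using fin by simp
  then obtain s where s: "s \<notin> insert 0 ((\<lambda>d. - pairing a d / pairing b d) ` \<Delta>)"
    using ex_new_if_finite infinite_UNIV_char_0 by blast
  have "pairing (a + s *s b) d \<noteq> 0" if d: "d \<in> \<Delta>" for d
  proof
    assume "pairing (a + s *s b) d = 0"
    then have "s * pairing b d = - pairing a d" by (simp add: pairing_simps eq_neg_iff_add_eq_0 add.commute)
    then have "s = - pairing a d / pairing b d" using b[OF d] by (metis nonzero_mult_div_cancel_right)
    then show False using s d by blast
  qed
  then show ?thesis using s by blast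
qed

lemma separating_functional:
  fixes T :: "(complex ^ 'n::finite) set"
  assumes T: "vec.subspace T" and fin: "finite \<Delta>" and dis: "\<Delta> \<inter> T = {}"
  shows "\<exists>\<eta>. (\<forall>t\<in>T. pairing \<eta> t = 0) \<and> (\<forall>d\<in>\<Delta>. pairing \<eta> d \<noteq> 0)"
  using fin dis
proof (induction \<Delta> rule: finite_induct)
  case empty
  show ?case by (intro exI[of _ 0]) (simp add: pairing_simps)
next
  case (insert d \<Delta>)
  then obtain \<eta> where \<eta>: "\<forall>t\<in>T. pairing \<eta> t = 0" "\<forall>d\<in>\<Delta>. pairing \<eta> d \<noteq> 0" by auto
  have "d \<notin> T" using insert.prems by auto
  then obtain \<theta> where \<theta>: "\<forall>t\<in>T. pairing \<theta> t = 0" "pairing \<theta> d \<noteq> 0"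
    using functional_vanishing_on_subspace[OF T] by blast
  obtain s where s: "s \<noteq> 0" "\<forall>e\<in>\<Delta>. pairing (\<theta> + s *s \<eta>) e \<noteq> 0"
    using generic_combination[OF insert.hyps(1), of \<eta> \<theta>] \<eta>(2) by blast
  show ?case
  proof (cases "pairing (\<theta> + s *s \<eta>) d = 0")
    case False
    then show ?thesis using s \<eta>(1) \<theta>(1) by (intro exI[of _ "\<theta> + s *s \<eta>"]) (simp add: pairing_simps)
  next
    case True
    let ?\<zeta> = "\<theta> + s *s \<eta>"
    obtain s' where s': "s' \<noteq> 0" "\<forall>e\<in>\<Delta>. pairing (\<theta> + s' *s ?\<zeta>) e \<noteq> 0"
      using generic_combination[OF insert.hyps(1), of ?\<zeta> \<theta>] s(2) by blast
    have "pairing (\<theta> + s' *s ?\<zeta>) d = pairing \<theta> d + s' * pairing ?\<zeta> d" by (simp only: pairing_simps)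
    then have "pairing (\<theta> + s' *s ?\<zeta>) d \<noteq> 0" using True \<theta>(2) by simp
    moreover have "\<forall>t\<in>T. pairing (\<theta> + s' *s ?\<zeta>) t = 0" using \<eta>(1) \<theta>(1) by (simp add: pairing_simps)
    ultimately show ?thesis using s'(2) by blast
  qed
qed

definition linear_form :: "complex ^ 'n \<Rightarrow> 'n::finite cpoly"
  where "linear_form \<eta> = (\<Sum>j\<in>UNIV. cconst (\<eta> $ j) * ccoord j)"

lemma ev_linear_form [simp]: "ev (linear_form \<eta>) x = pairing \<eta> x"
  by (simp add: linear_form_def pairing_def)

lemma has_gradient_linear_form: "has_gradient (linear_form \<eta>) x \<eta>"
proof -
  have "ev (linear_form \<eta>) = pairing \<eta>" by auto
  then show ?thesis unfolding has_gradient_def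
    by (simp add: bounded_linear_imp_has_derivative bounded_linear_pairing)
qed

lemma (in normalization) separates_linear_form:
  assumes "\<And>w. w \<in> zeros P \<Longrightarrow> \<pi> *v w = \<pi> *v z \<Longrightarrow> w \<noteq> z \<Longrightarrow> pairing \<eta> (w - z) \<noteq> 0"
  shows "separates (linear_form \<eta>) z"
  unfolding separates_def using assms by (auto simp: pairing_simps)

section \<open>Local functions on a variety\<close>

definition vanishing_polys :: "(complex ^ 'n) set \<Rightarrow> 'n::finite cpoly set"
  where "vanishing_polys V = {f. \<forall>x\<in>V. ev f x = 0}"

definition germ_ideal :: "(complex ^ 'n) set \<Rightarrow> complex ^ 'n \<Rightarrow> 'n::finite cpoly set"
  where "germ_ideal V z = {f. \<exists>r>0. \<forall>x\<in>V. dist x z < r \<longrightarrow> ev f x = 0}"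

text \<open>
  Near \<open>z\<close> the set is cut out by the polynomials that vanish on it. An algebraic subset of the torus has this
  property although it need not be closed in affine space.
\<close>

definition locally_closed_at :: "(complex ^ 'n::finite) set \<Rightarrow> complex ^ 'n \<Rightarrow> bool"
  where "locally_closed_at V z \<longleftrightarrow> (\<exists>r>0. \<forall>w. dist w z < r \<longrightarrow> (\<forall>f\<in>vanishing_polys V. ev f w = 0) \<longrightarrow> w \<in> V)"

lemma ideal_vanishing_polys: "is_ideal (vanishing_polys V)"
  by (auto simp: is_ideal_def vanishing_polys_def)

lemma ideal_germ_ideal: "is_ideal (germ_ideal V z)"
  unfolding is_ideal_def
proof (intro conjI ballI allI)
  show "0 \<in> germ_ideal V z" by (auto simp: germ_ideal_def intro: exI[of _ 1])
next
  fix f g assume "f \<in> germ_ideal V z" "g \<in> germ_ideal V z"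
  then obtain r s where "r > 0" "\<forall>x\<in>V. dist x z < r \<longrightarrow> ev f x = 0" "s > 0" "\<forall>x\<in>V. dist x z < s \<longrightarrow> ev g x = 0"
    unfolding germ_ideal_def by blast
  then show "f + g \<in> germ_ideal V z" unfolding germ_ideal_def by (intro CollectI exI[of _ "min r s"]) auto
next
  fix f g assume "f \<in> germ_ideal V z"
  then show "g * f \<in> germ_ideal V z" unfolding germ_ideal_def by auto
qed

text \<open>
  Along a curve with direction \<open>t\<close> the lowest nonvanishing homogeneous part dominates: divide by \<open>s\<^sup>m\<close> and
  let \<open>s\<close> tend to 0.
\<close>

lemma ev_zero_homogeneous_part:
  fixes C :: "'n::finite cpoly poly"
  assumes hom: "\<And>i. homog i (coeff C i)" and low: "\<And>i. i < m \<Longrightarrow> coeff C i = 0"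
    and lim: "(y \<longlongrightarrow> t) (at 0)" and z: "\<forall>\<^sub>F s::real in at 0. ev (poly C 1) (complex_of_real s *s y s) = 0"
  shows "ev (coeff C m) t = 0"
proof -
  let ?D = "degree C"
  let ?F = "\<lambda>s::real. \<Sum>i\<le>?D. (if i < m then 0 else complex_of_real s ^ (i - m) * ev (coeff C i) (y s))"
  have "((\<lambda>s. ev (coeff C i) (y s)) \<longlongrightarrow> ev (coeff C i) t) (at 0)" for i
    using continuous_on_tendsto_compose[OF continuous_ev[of UNIV "coeff C i"] lim] by simp
  then have "(?F \<longlongrightarrow> (\<Sum>i\<le>?D. (if i < m then 0 else complex_of_real 0 ^ (i - m) * ev (coeff C i) t))) (at 0)"
  proof (intro tendsto_sum)
    fix i
    assume *: "\<And>i. ((\<lambda>s. ev (coeff C i) (y s)) \<longlongrightarrow> ev (coeff C i) t) (at 0)"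
    show "((\<lambda>s. if i < m then 0 else complex_of_real s ^ (i - m) * ev (coeff C i) (y s)) \<longlongrightarrow>
        (if i < m then 0 else complex_of_real 0 ^ (i - m) * ev (coeff C i) t)) (at 0)"
    proof (cases "i < m")
      case True
      then show ?thesis by simp
    next
      case False
      show ?thesis unfolding if_not_P[OF False]
        by (intro tendsto_mult tendsto_power tendsto_of_real tendsto_ident_at *)
    qed
  qed
  also have "(\<Sum>i\<le>?D. (if i < m then 0 else complex_of_real 0 ^ (i - m) * ev (coeff C i) t)) = ev (coeff C m) t"
  proof (cases "m \<le> ?D")
    case True
    have "(\<Sum>i\<le>?D. (if i < m then 0 else complex_of_real 0 ^ (i - m) * ev (coeff C i) t))
      = (\<Sum>i\<in>{m}. (if i < m then 0 else complex_of_real 0 ^ (i - m) * ev (coeff C i) t))"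
      by (rule sum.mono_neutral_right) (use True in auto)
    then show ?thesis by simp
  next
    case False
    then show ?thesis by (auto simp: coeff_eq_0 intro!: sum.neutral)
  qed
  finally have 1: "(?F \<longlongrightarrow> ev (coeff C m) t) (at 0)" .
  have "\<forall>\<^sub>F s::real in at 0. s \<noteq> 0" by (simp add: eventually_at_filter)
  with z have "\<forall>\<^sub>F s in at 0. ?F s = 0"
  proof eventually_elim
    case (elim s)
    have "ev (poly C 1) (complex_of_real s *s y s) = (\<Sum>i\<le>?D. ev (coeff C i) (complex_of_real s *s y s))"
      by (simp add: poly_altdef)
    also have "\<dots> = (\<Sum>i\<le>?D. complex_of_real s ^ m * (if i < m then 0 else complex_of_real s ^ (i - m) * ev (coeff C i) (y s)))"
      by (intro sum.cong refl) (auto simp: homog_scale[OF hom] low power_add[symmetric] mult.assoc[symmetric])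
    also have "\<dots> = complex_of_real s ^ m * ?F s" by (simp only: sum_distrib_left)
    finally show ?case using elim by simp
  qed
  then have "(?F \<longlongrightarrow> 0) (at 0)" by (rule tendsto_eventually)
  from tendsto_unique[OF _ 1 this] show ?thesis by simp
qed

lemma tangent_curve_quotient:
  assumes "t \<in> tangent_space V z"
  obtains y where "(y \<longlongrightarrow> t) (at 0)" "\<forall>\<^sub>F s::real in at 0. z + complex_of_real s *s y s \<in> V"
    "((\<lambda>s. z + complex_of_real s *s y s) \<longlongrightarrow> z) (at 0)"
proof -
  from assms obtain c :: "real \<Rightarrow> complex ^ 'a" where c: "c 0 = z" "\<forall>\<^sub>F s in at 0. c s \<in> V" "(c has_vector_derivative t) (at 0)"
    unfolding tangent_space_def by (elim CollectE exE conjE)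
  define y where "y = (\<lambda>s. (1 / s) *\<^sub>R (c s - z))"
  have nz: "\<forall>\<^sub>F s::real in at 0. s \<noteq> 0" by (simp add: eventually_at_filter)
  have eq: "\<forall>\<^sub>F s in at 0. c s = z + complex_of_real s *s y s"
    using nz by eventually_elim (simp add: y_def scaleR_complex_vec[symmetric])
  have "((\<lambda>s. norm ((c s - c 0 - (s - 0) *\<^sub>R t) /\<^sub>R norm (s - 0))) \<longlongrightarrow> 0) (at 0)"
    using c(3) unfolding has_vector_derivative_def has_derivative_def by (intro tendsto_norm_zero) (simp add: netlimit_at)
  then have "((\<lambda>s. norm (y s - t)) \<longlongrightarrow> 0) (at 0)"
  proof (rule Lim_transform_eventually)
    show "\<forall>\<^sub>F s in at 0. norm ((c s - c 0 - (s - 0) *\<^sub>R t) /\<^sub>R norm (s - 0)) = norm (y s - t)"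
      using nz
    proof eventually_elim
      case (elim s)
      have "y s - t = (1 / s) *\<^sub>R (c s - z - s *\<^sub>R t)" using elim by (simp add: y_def scaleR_diff_right)
      then show ?case by (simp add: c(1) divide_inverse_commute)
    qed
  qed
  then have yt: "(y \<longlongrightarrow> t) (at 0)" by (metis LIM_zero_cancel tendsto_norm_zero_cancel)
  have "isCont c 0" using c(3) has_vector_derivative_continuous by blast
  then have "(c \<longlongrightarrow> z) (at 0)" using c(1) by (simp add: isCont_def)
  then have lim: "((\<lambda>s. z + complex_of_real s *s y s) \<longlongrightarrow> z) (at 0)"
    by (rule Lim_transform_eventually[OF _ eq])
  have "\<forall>\<^sub>F s in at 0. z + complex_of_real s *s y s \<in> V"
    using c(2) eq by eventually_elim simp
  from that[OF yt this lim] show ?thesis .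
qed

lemma germ_along_tangent_curve:
  assumes f: "f \<in> germ_ideal V z" and t: "t \<in> tangent_space V z"
  obtains y where "(y \<longlongrightarrow> t) (at 0)" "\<forall>\<^sub>F s::real in at 0. ev f (z + complex_of_real s *s y s) = 0"
proof -
  obtain y where y: "(y \<longlongrightarrow> t) (at 0)" "\<forall>\<^sub>F s::real in at 0. z + complex_of_real s *s y s \<in> V"
    "((\<lambda>s. z + complex_of_real s *s y s) \<longlongrightarrow> z) (at 0)" using tangent_curve_quotient[OF t] .
  obtain r where r: "r > 0" "\<And>x. x \<in> V \<Longrightarrow> dist x z < r \<Longrightarrow> ev f x = 0" using f unfolding germ_ideal_def by blast
  have "\<forall>\<^sub>F s::real in at 0. dist (z + complex_of_real s *s y s) z < r" by (rule tendstoD[OF y(3) r(1)])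
  with y(2) have "\<forall>\<^sub>F s::real in at 0. ev f (z + complex_of_real s *s y s) = 0"
    by eventually_elim (rule r(2))
  from that[OF y(1) this] show ?thesis .
qed

lemma translate_cpoly: "\<exists>g. \<forall>x. ev g x = ev f (z + x)"
proof -
  have "polynomial_fun (\<lambda>x. ev f (z + x))"
  proof (rule polynomial_fun_compose[of "ev f" "\<lambda>x. z + x", OF polynomial_fun_ev])
    show "polynomial_fun (\<lambda>x. (z + x) $ j)" for j
      unfolding vector_add_component by (rule polynomial_fun_add[OF polynomial_fun_const polynomial_fun_coord])
  qed
  from ev_Cpoly[OF this] show ?thesis by (intro exI[of _ "Cpoly (\<lambda>x. ev f (z + x))"]) simp
qed

text \<open>
  The hypothesis of \<open>noether_normalization\<close> for tangent spaces. Expand \<open>f\<close> at \<open>z\<close>. By induction each homogeneous part vanishes on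
  tangent vectors; since it factors through \<open>\<pi>\<close> and \<open>T\<close> fills the range of \<open>\<pi>\<close>, it vanishes everywhere.
\<close>

lemma germ_ideal_transversal_free:
  assumes idem: "\<pi> ** \<pi> = \<pi>" and rng: "range ((*v) \<pi>) = (*v) \<pi> ` tangent_space V z"
    and f: "f \<in> invariants \<pi>" "f \<in> germ_ideal V z"
  shows "f = 0"
proof -
  obtain g where g: "\<And>x. ev g x = ev f (z + x)" using translate_cpoly by blast
  have "ev g (\<pi> *v x) = ev g x" for x
  proof -
    have "ev f (z + \<pi> *v x) = ev f (\<pi> *v (z + \<pi> *v x))" using f(1) by (simp add: invariants_iff)
    also have "\<pi> *v (z + \<pi> *v x) = \<pi> *v (z + x)" by (simp add: matrix_vector_right_distrib matrix_vector_mul_assoc idem)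
    also have "ev f (\<pi> *v (z + x)) = ev f (z + x)" using f(1) by (simp add: invariants_iff)
    finally show ?thesis by (simp add: g)
  qed
  then have "g \<in> invariants \<pi>" by (simp add: invariants_iff)
  from homog_components_invariant[OF idem this]
  obtain C where C: "\<And>i. homog i (coeff C i)" "\<And>i. coeff C i \<in> invariants \<pi>" "g = poly C 1" by blast
  have "coeff C m = 0" for m
  proof (induction m rule: less_induct)
    case (less m)
    have T0: "ev (coeff C m) t = 0" if t: "t \<in> tangent_space V z" for t
    proof -
      obtain y where y: "(y \<longlongrightarrow> t) (at 0)" "\<forall>\<^sub>F s::real in at 0. ev f (z + complex_of_real s *s y s) = 0"
        using germ_along_tangent_curve[OF f(2) t] .
      have "\<forall>\<^sub>F s::real in at 0. ev (poly C 1) (complex_of_real s *s y s) = 0"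
        unfolding C(3)[symmetric] g by (rule y(2))
      from ev_zero_homogeneous_part[OF C(1) less y(1) this] show ?thesis .
    qed
    show ?case
    proof (rule cpoly_eqI)
      fix x
      have "\<pi> *v x \<in> (*v) \<pi> ` tangent_space V z" using rng by blast
      then obtain t where t: "t \<in> tangent_space V z" "\<pi> *v x = \<pi> *v t" by auto
      have "ev (coeff C m) x = ev (coeff C m) (\<pi> *v x)" using C(2)[of m] unfolding invariants_iff by simp
      also have "\<dots> = ev (coeff C m) t" unfolding t(2) using C(2)[of m] unfolding invariants_iff by simp
      finally show "ev (coeff C m) x = ev 0 x" using T0[OF t(1)] by simp
    qed
  qed
  then have "C = 0" by (intro poly_eqI) simp
  then have g0: "g = 0" using C(3) by simp
  show ?thesis
  proof (rule cpoly_eqI)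
    fix x show "ev f x = ev 0 x" using g[of "x - z"] g0 by simp
  qed
qed

lemma derivative_annihilates_tangent:
  fixes F :: "complex ^ 'n::finite \<Rightarrow> complex"
  assumes F: "(F has_derivative pairing \<eta>) (at z)" and r: "r > 0" "\<And>x. x \<in> V \<Longrightarrow> dist x z < r \<Longrightarrow> F x = 0"
    and t: "t \<in> tangent_space V z"
  shows "pairing \<eta> t = 0"
proof -
  from t obtain c :: "real \<Rightarrow> complex ^ 'n" where c: "c 0 = z" "\<forall>\<^sub>F s in at 0. c s \<in> V" "(c has_vector_derivative t) (at 0)"
    unfolding tangent_space_def by (elim CollectE exE conjE)
  have "isCont c 0" using c(3) has_vector_derivative_continuous by blast
  then have lim: "(c \<longlongrightarrow> z) (at 0)" using c(1) by (simp add: isCont_def)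
  have zero: "\<forall>\<^sub>F s in at 0. F (c s) = 0"
    using tendstoD[OF lim r(1)] c(2) by eventually_elim (rule r(2))
  have "isCont F z" using F has_derivative_continuous by blast
  then have "((\<lambda>s. F (c s)) \<longlongrightarrow> F z) (at 0)" by (rule isCont_tendsto_compose[OF _ lim])
  moreover have "((\<lambda>s. F (c s)) \<longlongrightarrow> 0) (at 0)" using zero by (rule tendsto_eventually)
  ultimately have fz: "F z = 0" by (rule tendsto_unique[rotated]) simp
  have "(c has_derivative (\<lambda>s. s *\<^sub>R t)) (at 0)" using c(3) by (simp add: has_vector_derivative_def)
  from diff_chain_at[OF this, of F "pairing \<eta>"] F c(1)
  have 1: "((\<lambda>s. F (c s)) has_derivative (\<lambda>s. pairing \<eta> (s *\<^sub>R t))) (at 0)" by (simp add: o_def)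
  have "((\<lambda>s. F (c s)) has_derivative (\<lambda>s. 0)) (at 0)"
  proof (rule has_derivative_transform_eventually[OF has_derivative_const[of 0]])
    show "\<forall>\<^sub>F s in at 0. 0 = F (c s)" using zero by eventually_elim simp
    show "0 = F (c 0)" using fz c(1) by simp
  qed simp
  from has_derivative_unique[OF 1 this] have "(\<lambda>s. pairing \<eta> (s *\<^sub>R t)) = (\<lambda>s. 0)" .
  from fun_cong[OF this, of 1] show ?thesis by simp
qed

lemma gradient_annihilates_tangent:
  assumes G: "has_gradient f z \<eta>" and f: "f \<in> germ_ideal V z" and t: "t \<in> tangent_space V z"
  shows "pairing \<eta> t = 0"
proof -
  obtain r where r: "r > 0" "\<And>x. x \<in> V \<Longrightarrow> dist x z < r \<Longrightarrow> ev f x = 0" using f unfolding germ_ideal_def by blast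
  show ?thesis by (rule derivative_annihilates_tangent[OF G[unfolded has_gradient_def] r t])
qed

text \<open>
  If no such \<open>h\<close> exists, the ideal of \<open>V\<close> avoids the multiplicative set of all \<open>h g\<^sup>i\<close> with \<open>h(z) \<noteq> 0\<close>. A prime ideal \<open>Q\<close>
  that contains the former and avoids the latter has \<open>z\<close> as a zero and does not contain \<open>g\<close>. By
  \<open>not_locally_zero\<close> there are zeros of \<open>Q\<close> arbitrarily close to \<open>z\<close> at which \<open>g\<close> does not vanish; they
  lie in \<open>V\<close>. The irreducible components of \<open>V\<close> are thereby handled without a decomposition.
\<close>

lemma local_vanishing_extends:
  fixes V :: "(complex ^ 'n::finite) set"
  assumes z: "z \<in> V" and loc: "locally_closed_at V z" and g: "g \<in> germ_ideal V z"
  shows "\<exists>h. ev h z \<noteq> 0 \<and> h * g \<in> vanishing_polys V"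
proof (rule ccontr)
  assume neg: "\<not> ?thesis"
  obtain r where r: "r > 0" "\<And>x. x \<in> V \<Longrightarrow> dist x z < r \<Longrightarrow> ev g x = 0" using g unfolding germ_ideal_def by blast
  obtain s where s: "s > 0" "\<And>w. dist w z < s \<Longrightarrow> \<forall>f\<in>vanishing_polys V. ev f w = 0 \<Longrightarrow> w \<in> V"
    using loc unfolding locally_closed_at_def by blast
  let ?S = "{h * g ^ i | h i. ev h z \<noteq> 0}"
  have "vanishing_polys V \<inter> ?S = {}"
  proof (rule ccontr)
    assume "vanishing_polys V \<inter> ?S \<noteq> {}"
    then obtain h i where h: "ev h z \<noteq> 0" "h * g ^ i \<in> vanishing_polys V" by blast
    have "h * g \<in> vanishing_polys V" using h(2) by (auto simp: vanishing_polys_def)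
    then show False using neg h(1) by blast
  qed
  moreover have "1 \<in> ?S" by (intro CollectI exI[of _ 1] exI[of _ 0]) simp
  moreover have "x * y \<in> ?S" if xy: "x \<in> ?S" "y \<in> ?S" for x y
  proof -
    obtain h i where 1: "x = h * g ^ i" "ev h z \<noteq> 0" using xy(1) by blast
    obtain h' i' where 2: "y = h' * g ^ i'" "ev h' z \<noteq> 0" using xy(2) by blast
    have "x * y = (h * h') * g ^ (i + i')" by (simp add: 1(1) 2(1) power_add)
    then show ?thesis using 1(2) 2(2) by (intro CollectI exI[of _ "h * h'"] exI[of _ "i + i'"]) simp
  qed
  ultimately obtain Q where Q: "is_prime_ideal Q" "vanishing_polys V \<subseteq> Q" "Q \<inter> ?S = {}"
    using prime_ideal_avoiding[OF ideal_vanishing_polys, of ?S V] by blast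
  have fz: "ev f z = 0" if "f \<in> Q" for f
  proof (rule ccontr)
    assume "ev f z \<noteq> 0"
    then have "f \<in> ?S" by (intro CollectI exI[of _ f] exI[of _ 0]) simp
    then show False using Q(3) that by blast
  qed
  have gQ: "g \<notin> Q"
  proof
    assume "g \<in> Q"
    moreover have "g \<in> ?S" by (intro CollectI exI[of _ 1] exI[of _ 1]) simp
    ultimately show False using Q(3) by blast
  qed
  have zQ: "z \<in> zeros Q" using fz by (simp add: zeros_def)
  have "\<exists>\<pi> e r. normalization Q \<pi> e r \<and> (\<forall>x\<in>{0}. \<pi> *v x = 0 \<longrightarrow> x = 0)"
  proof (rule noether_normalization[OF Q(1) vec.subspace_single_0])
    fix \<pi> :: "complex ^ 'n ^ 'n" and f
    assume h: "range ((*v) \<pi>) = (*v) \<pi> ` {0}" "f \<in> invariants \<pi>" "f \<in> Q"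
    have pi0: "\<pi> *v x = 0" for x
    proof -
      have "\<pi> *v x \<in> (*v) \<pi> ` {0}" unfolding h(1)[symmetric] by (rule rangeI)
      then show ?thesis by simp
    qed
    show "f = 0"
    proof (rule cpoly_eqI)
      fix x
      have "ev f x = ev f (\<pi> *v x)" "ev f z = ev f (\<pi> *v z)" using h(2) unfolding invariants_iff by simp_all
      then show "ev f x = ev 0 x" using fz[OF h(3)] by (simp add: pi0)
    qed
  qed
  then obtain \<pi> e n where N: "normalization Q \<pi> e n" by blast
  interpret normalization Q \<pi> e n by (rule N)
  let ?\<Delta> = "(\<lambda>w. w - z) ` ({w \<in> zeros Q. \<pi> *v w = \<pi> *v z} - {z})"
  have "finite ?\<Delta>" using finite_fiber by simp
  moreover have "?\<Delta> \<inter> {0} = {}" by auto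
  ultimately obtain \<eta> where \<eta>: "\<forall>d\<in>?\<Delta>. pairing \<eta> d \<noteq> 0"
    using separating_functional[OF vec.subspace_single_0] by blast
  have sep: "separates (linear_form \<eta>) z" by (rule separates_linear_form) (use \<eta> in auto)
  have "min r s > 0" using r s by simp
  from not_locally_zero[OF zQ sep this gQ] obtain w where w: "w \<in> zeros Q" "dist w z < min r s" "ev g w \<noteq> 0" by blast
  have "w \<in> V" using w(1,2) Q(2) by (intro s(2)) (auto simp: zeros_def)
  then show False using r(2)[of w] w(2,3) by simp
qed


section \<open>Conormal vectors are gradients of polynomials vanishing on the variety\<close>

lemma has_gradient_unique: "has_gradient f x a \<Longrightarrow> has_gradient f x b \<Longrightarrow> a = b"
  unfolding has_gradient_def by (rule pairing_eqI) (metis has_derivative_unique)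

lemma gradient_of_invariant:
  assumes idem: "\<pi> ** \<pi> = \<pi>" and b: "b \<in> invariants \<pi>" and g: "has_gradient b x \<beta>"
  shows "pairing \<beta> (\<pi> *v h) = pairing \<beta> h"
proof -
  obtain \<gamma> where \<gamma>: "has_gradient b (\<pi> *v x) \<gamma>" using ex_gradient by blast
  have "((*v) \<pi> has_derivative (*v) \<pi>) (at x)"
    using linear_matrix_vector_mult[of \<pi>] by (simp add: bounded_linear_imp_has_derivative linear_conv_bounded_linear)
  from diff_chain_at[OF this, of "ev b" "pairing \<gamma>"] \<gamma>
  have "((\<lambda>x. ev b (\<pi> *v x)) has_derivative (\<lambda>h. pairing \<gamma> (\<pi> *v h))) (at x)"
    by (simp add: o_def has_gradient_def)
  moreover have "(\<lambda>x. ev b (\<pi> *v x)) = ev b" using b by (auto simp: invariants_iff)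
  ultimately have "(ev b has_derivative (\<lambda>h. pairing \<gamma> (\<pi> *v h))) (at x)" by simp
  from has_derivative_unique[OF this g[unfolded has_gradient_def]]
  have e: "pairing \<beta> h = pairing \<gamma> (\<pi> *v h)" for h by metis
  show ?thesis unfolding e by (simp add: matrix_vector_mul_assoc idem)
qed

text \<open>
  The chain rule. The coefficients of \<open>Q\<close> contribute the form \<open>\<mu>\<close>, which factors through \<open>\<pi>\<close> as they do.
\<close>

lemma gradient_of_polynomial_in:
  fixes Q :: "'n::finite cpoly poly"
  assumes idem: "\<pi> ** \<pi> = \<pi>" and Q: "coeffs_in (invariants \<pi>) Q" and u: "has_gradient u x \<xi>"
  shows "\<exists>\<mu>. has_gradient (poly Q u) x (poly (pderiv (evp x Q)) (ev u x) *s \<xi> + \<mu>)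
    \<and> (\<forall>h. pairing \<mu> (\<pi> *v h) = pairing \<mu> h)"
  using Q
proof (induction Q)
  case 0
  show ?case using has_gradient_const[of 0 x]
    by (intro exI[of _ 0]) (simp add: cconst_hom pairing_simps)
next
  case (pCons b Q)
  have b: "b \<in> invariants \<pi>" "coeffs_in (invariants \<pi>) Q"
    using pCons.prems unfolding coeffs_in_def by (metis coeff_pCons_0, metis coeff_pCons_Suc)
  obtain \<mu> where \<mu>: "has_gradient (poly Q u) x (poly (pderiv (evp x Q)) (ev u x) *s \<xi> + \<mu>)"
    "\<And>h. pairing \<mu> (\<pi> *v h) = pairing \<mu> h" using pCons.IH[OF b(2)] by blast
  obtain \<beta> where \<beta>: "has_gradient b x \<beta>" using ex_gradient by blast
  let ?g = "\<beta> + (ev u x *s (poly (pderiv (evp x Q)) (ev u x) *s \<xi> + \<mu>) + ev (poly Q u) x *s \<xi>)"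
  have 1: "has_gradient (poly (pCons b Q) u) x ?g"
    unfolding poly_pCons by (rule has_gradient_add[OF \<beta> has_gradient_mult[OF u \<mu>(1)]])
  have 2: "?g = poly (pderiv (evp x (pCons b Q))) (ev u x) *s \<xi> + (\<beta> + ev u x *s \<mu>)"
    by (simp add: pderiv_pCons ev_poly vec_eq_iff algebra_simps)
  have 3: "pairing (\<beta> + ev u x *s \<mu>) (\<pi> *v h) = pairing (\<beta> + ev u x *s \<mu>) h" for h
    unfolding pairing_simps \<mu>(2) gradient_of_invariant[OF idem b(1) \<beta>] ..
  show ?case by (intro exI[of _ "\<beta> + ev u x *s \<mu>"] conjI allI 3) (rule 1[unfolded 2])
qed

context submanifold_chart begin

abbreviation "T \<equiv> tangent_space V z"
abbreviation "P \<equiv> germ_ideal V z"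

lemma prime_germ_ideal: "is_prime_ideal P"
  unfolding is_prime_ideal_def
proof (intro conjI allI impI)
  show "is_ideal P" by (rule ideal_germ_ideal)
  show "1 \<notin> P"
  proof
    assume "1 \<in> P"
    then obtain r where "r > 0" "\<forall>x\<in>V. dist x z < r \<longrightarrow> ev (1 :: 'n cpoly) x = 0" unfolding germ_ideal_def by blast
    then have "ev (1 :: 'n cpoly) z = 0" using bspec[OF _ z, of "\<lambda>x. dist x z < r \<longrightarrow> ev (1 :: 'n cpoly) x = 0"] by simp
    then show False by simp
  qed
  fix f g :: "'n cpoly" assume "f * g \<in> P"
  then obtain r where "r > 0" "\<And>x. x \<in> V \<Longrightarrow> dist x z < r \<Longrightarrow> ev (f * g) x = 0" unfolding germ_ideal_def by blast
  from local_integral_domain[OF this] show "f \<in> P \<or> g \<in> P" unfolding germ_ideal_def by blast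
qed

lemma projection_bounds:
  fixes \<pi> :: "complex ^ 'n ^ 'n"
  assumes inj: "\<And>x. x \<in> T \<Longrightarrow> \<pi> *v x = 0 \<Longrightarrow> x = 0"
  shows "\<exists>c>0. \<exists>K>0. (\<forall>x\<in>T. c * norm x \<le> norm (\<pi> *v x)) \<and> (\<forall>x. norm (\<pi> *v x) \<le> K * norm x)"
proof -
  obtain K where K: "K > 0" "\<And>x. norm (\<pi> *v x) \<le> K * norm x" using matrix_bound[of \<pi>] by auto
  note lin = linear_matrix_vector_mult[of \<pi>]
  have sub: "subspace T" by (rule vec_subspace_imp_subspace[OF tangent_space_subspace])
  have "\<exists>e>0. \<forall>x\<in>T. e * norm x \<le> norm (\<pi> *v x)"
    by (rule injective_imp_isometric[OF closed_subspace[OF sub] sub]) (use lin inj in \<open>auto simp: linear_conv_bounded_linear\<close>)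
  then show ?thesis using K by blast
qed

text \<open>
  On \<open>T\<close> the projection is bounded below, so the error of \<open>secant_near_tangent\<close> can be measured by the projected vector.
\<close>

lemma secant_projection:
  fixes \<pi> :: "complex ^ 'n ^ 'n"
  assumes inj: "\<And>x. x \<in> T \<Longrightarrow> \<pi> *v x = 0 \<Longrightarrow> x = 0" and e: "e > 0"
  shows "\<exists>\<delta>>0. \<forall>p\<in>V. \<forall>q\<in>V. dist p z < \<delta> \<longrightarrow> dist q z < \<delta> \<longrightarrow>
    (\<exists>\<tau>\<in>T. norm (q - p) \<le> 2 * norm \<tau> \<and> norm (\<pi> *v (q - p) - \<pi> *v \<tau>) \<le> e * norm (\<pi> *v \<tau>))"
proof -
  obtain c K where cK: "c > 0" "K > 0" "\<And>x. x \<in> T \<Longrightarrow> c * norm x \<le> norm (\<pi> *v x)" "\<And>x. norm (\<pi> *v x) \<le> K * norm x"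
    using projection_bounds[OF inj] by blast
  define \<epsilon> where "\<epsilon> = min (1/2) (e * c / (2 * K))"
  have \<epsilon>: "\<epsilon> > 0" "\<epsilon> \<le> 1/2" "\<epsilon> \<le> e * c / (2 * K)" using e cK by (auto simp: \<epsilon>_def)
  obtain \<delta> where \<delta>: "\<delta> > 0" "\<And>p q. p \<in> V \<Longrightarrow> q \<in> V \<Longrightarrow> dist p z < \<delta> \<Longrightarrow> dist q z < \<delta> \<Longrightarrow>
     \<exists>\<tau>\<in>T. norm (q - p - \<tau>) \<le> \<epsilon> * norm (q - p)" using secant_near_tangent[OF \<epsilon>(1)] by blast
  have "\<exists>\<tau>\<in>T. norm (q - p) \<le> 2 * norm \<tau> \<and> norm (\<pi> *v (q - p) - \<pi> *v \<tau>) \<le> e * norm (\<pi> *v \<tau>)"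
    if pq: "p \<in> V" "q \<in> V" "dist p z < \<delta>" "dist q z < \<delta>" for p q
  proof -
    obtain \<tau> where \<tau>: "\<tau> \<in> T" "norm (q - p - \<tau>) \<le> \<epsilon> * norm (q - p)" using \<delta>(2)[OF pq] by blast
    have "norm (q - p) \<le> norm \<tau> + norm (q - p - \<tau>)" using norm_triangle_ineq[of \<tau> "q - p - \<tau>"] by simp
    moreover have "\<epsilon> * norm (q - p) \<le> 1/2 * norm (q - p)" using \<epsilon>(2) by (intro mult_right_mono) auto
    ultimately have 1: "norm (q - p) \<le> 2 * norm \<tau>" using \<tau>(2) by linarith
    have "norm (\<pi> *v (q - p) - \<pi> *v \<tau>) = norm (\<pi> *v (q - p - \<tau>))" by (simp only: matrix_vector_mult_diff_distrib)
    also have "\<dots> \<le> K * norm (q - p - \<tau>)" by (rule cK(4))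
    also have "\<dots> \<le> K * (\<epsilon> * norm (q - p))" using \<tau>(2) cK(2) by (intro mult_left_mono) auto
    also have "\<dots> \<le> K * (\<epsilon> * (2 * norm \<tau>))" using 1 cK(2) \<epsilon>(1) by (intro mult_left_mono) auto
    also have "\<dots> \<le> K * (e * c / (2 * K) * (2 * norm \<tau>))" using \<epsilon>(3) cK(2) by (intro mult_left_mono mult_right_mono) auto
    also have "\<dots> = e * (c * norm \<tau>)" using cK(2) by simp
    also have "\<dots> \<le> e * norm (\<pi> *v \<tau>)" using cK(3)[OF \<tau>(1)] e by (intro mult_left_mono) auto
    finally show ?thesis using 1 \<tau>(1) by blast
  qed
  then show ?thesis using \<delta>(1) by blast
qed

lemma projection_injective_near:
  fixes \<pi> :: "complex ^ 'n ^ 'n"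
  assumes inj: "\<And>x. x \<in> T \<Longrightarrow> \<pi> *v x = 0 \<Longrightarrow> x = 0"
  shows "\<exists>\<delta>>0. \<forall>p\<in>V. \<forall>q\<in>V. dist p z < \<delta> \<longrightarrow> dist q z < \<delta> \<longrightarrow> \<pi> *v p = \<pi> *v q \<longrightarrow> p = q"
proof -
  have h: "(1/2 :: real) > 0" by simp
  obtain \<delta> where \<delta>: "\<delta> > 0" "\<And>p q. p \<in> V \<Longrightarrow> q \<in> V \<Longrightarrow> dist p z < \<delta> \<Longrightarrow> dist q z < \<delta> \<Longrightarrow>
     \<exists>\<tau>\<in>T. norm (q - p) \<le> 2 * norm \<tau> \<and> norm (\<pi> *v (q - p) - \<pi> *v \<tau>) \<le> 1/2 * norm (\<pi> *v \<tau>)"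
    using secant_projection[OF inj h] by blast
  have "p = q" if pq: "p \<in> V" "q \<in> V" "dist p z < \<delta>" "dist q z < \<delta>" "\<pi> *v p = \<pi> *v q" for p q
  proof -
    obtain \<tau> where \<tau>: "\<tau> \<in> T" "norm (q - p) \<le> 2 * norm \<tau>" "norm (\<pi> *v (q - p) - \<pi> *v \<tau>) \<le> 1/2 * norm (\<pi> *v \<tau>)"
      using \<delta>(2)[OF pq(1-4)] by blast
    have "\<pi> *v (q - p) = 0" using pq(5) by (simp add: matrix_vector_mult_diff_distrib)
    then have "norm (\<pi> *v \<tau>) \<le> 1/2 * norm (\<pi> *v \<tau>)" using \<tau>(3) by simp
    then have "\<pi> *v \<tau> = 0" using norm_ge_zero[of "\<pi> *v \<tau>"] by simp
    then have "\<tau> = 0" using inj[OF \<tau>(1)] by simp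
    then show "p = q" using \<tau>(2) by simp
  qed
  then show ?thesis using \<delta>(1) by blast
qed

lemma zeros_germ_ideal_near:
  assumes loc: "locally_closed_at V z"
  shows "\<exists>r>0. \<forall>w\<in>zeros P. dist w z < r \<longrightarrow> w \<in> V"
proof -
  have sub: "vanishing_polys V \<subseteq> P"
    unfolding vanishing_polys_def germ_ideal_def by (intro subsetI CollectI exI[of _ 1]) simp
  obtain r where r: "r > 0" "\<And>w. dist w z < r \<Longrightarrow> \<forall>f\<in>vanishing_polys V. ev f w = 0 \<Longrightarrow> w \<in> V"
    using loc unfolding locally_closed_at_def by blast
  have "w \<in> V" if "w \<in> zeros P" "dist w z < r" for w
  proof (rule r(2)[OF that(2)], rule ballI)
    fix f assume "f \<in> vanishing_polys V"
    then have "f \<in> P" using sub by (rule subsetD[rotated])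
    then show "ev f w = 0" using that(1) unfolding zeros_def by simp
  qed
  with r(1) show ?thesis by (intro exI[of _ r] conjI ballI impI)
qed

lemma center_in_zeros: "z \<in> zeros P"
  unfolding zeros_def
proof (intro CollectI ballI)
  fix f assume "f \<in> P"
  then obtain r where r: "r > 0" "\<And>x. x \<in> V \<Longrightarrow> dist x z < r \<Longrightarrow> ev f x = 0" unfolding germ_ideal_def by blast
  show "ev f z = 0" by (rule r(2)[OF z]) (simp add: r(1))
qed

text \<open>
  For \<open>y\<close> in the range of \<open>\<pi>\<close>, openness yields points of \<open>V\<close> near \<open>z\<close> whose projections differ from that of \<open>z\<close> by
  a small multiple of \<open>y\<close>. The corresponding secants are almost tangent, so \<open>y\<close> is in the closure of \<open>\<pi>(T)\<close>.
\<close>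

lemma projection_onto:
  assumes loc: "locally_closed_at V z" and N: "normalization P \<pi> e n"
    and inj: "\<And>x. x \<in> T \<Longrightarrow> \<pi> *v x = 0 \<Longrightarrow> x = 0" and sep: "normalization.separates P \<pi> u z"
  shows "range ((*v) \<pi>) = (*v) \<pi> ` T"
proof
  interpret normalization P \<pi> e n by (rule N)
  show "(*v) \<pi> ` T \<subseteq> range ((*v) \<pi>)" by auto
  note lin = linear_matrix_vector_mult[of \<pi>]
  have subT: "subspace T" by (rule vec_subspace_imp_subspace[OF tangent_space_subspace])
  have cl: "closed ((*v) \<pi> ` T)" by (intro closed_subspace linear_subspace_image lin subT)
  obtain r where r: "r > 0" "\<And>w. w \<in> zeros P \<Longrightarrow> dist w z < r \<Longrightarrow> w \<in> V"
    using zeros_germ_ideal_near[OF loc] by blast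
  show "range ((*v) \<pi>) \<subseteq> (*v) \<pi> ` T"
  proof
    fix y assume y: "y \<in> range ((*v) \<pi>)"
    then have py: "\<pi> *v y = y" using idem by (auto simp: matrix_vector_mul_assoc)
    have "\<exists>x\<in>(*v) \<pi> ` T. dist x y < \<epsilon>" if \<epsilon>: "\<epsilon> > 0" for \<epsilon>
    proof -
      define e' where "e' = min (1/2) (\<epsilon> / (2 * norm y + 1) / 2)"
      have pos: "2 * norm y + 1 > 0" using norm_ge_zero[of y] by linarith
      have e': "e' > 0" "e' \<le> 1/2" "e' \<le> \<epsilon> / (2 * norm y + 1) / 2"
      proof -
        show "e' > 0" using \<epsilon> pos by (simp add: e'_def)
        show "e' \<le> 1/2" unfolding e'_def by (rule min.cobounded1)
        show "e' \<le> \<epsilon> / (2 * norm y + 1) / 2" unfolding e'_def by (rule min.cobounded2)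
      qed
      obtain \<delta> where \<delta>: "\<delta> > 0" "\<And>p q. p \<in> V \<Longrightarrow> q \<in> V \<Longrightarrow> dist p z < \<delta> \<Longrightarrow> dist q z < \<delta> \<Longrightarrow>
        \<exists>\<tau>\<in>T. norm (q - p) \<le> 2 * norm \<tau> \<and> norm (\<pi> *v (q - p) - \<pi> *v \<tau>) \<le> e' * norm (\<pi> *v \<tau>)"
        using secant_projection[OF inj e'(1)] by blast
      have "min r \<delta> > 0" using r(1) \<delta>(1) by simp
      from open_at[OF center_in_zeros sep this]
      obtain \<eta> where \<eta>: "\<eta> > 0" "\<And>a. dist a z < \<eta> \<Longrightarrow> \<exists>w\<in>zeros P. \<pi> *v w = \<pi> *v a \<and> dist w z < min r \<delta>" by blast
      define s where "s = \<eta> / (2 * norm y + 1)"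
      have s: "s > 0" using \<eta>(1) pos by (simp add: s_def)
      have "norm (s *\<^sub>R y) < \<eta>"
      proof -
        have "s * norm y < s * (2 * norm y + 1)" using s norm_ge_zero[of y] by (intro mult_strict_left_mono) linarith+
        also have "\<dots> = \<eta>" using pos by (simp add: s_def)
        finally show ?thesis using s by simp
      qed
      then have "dist (z + s *\<^sub>R y) z < \<eta>" by (simp add: dist_norm)
      from \<eta>(2)[OF this] obtain w where w: "w \<in> zeros P" "\<pi> *v w = \<pi> *v (z + s *\<^sub>R y)" "dist w z < min r \<delta>" by blast
      have wV: "w \<in> V" using r(2) w by simp
      have "dist z z < \<delta>" "dist w z < \<delta>" using \<delta>(1) w(3) by simp_all
      from \<delta>(2)[OF z wV this] obtain \<tau> where \<tau>: "\<tau> \<in> T" "norm (\<pi> *v (w - z) - \<pi> *v \<tau>) \<le> e' * norm (\<pi> *v \<tau>)" by blast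
      have "\<pi> *v (w - z) = \<pi> *v (s *\<^sub>R y)"
        using w(2) by (simp add: matrix_vector_mult_diff_distrib matrix_vector_right_distrib)
      also have "\<dots> = s *\<^sub>R y" using linear_scale[OF lin, of s y] by (simp add: py)
      finally have st: "norm (s *\<^sub>R y - \<pi> *v \<tau>) \<le> e' * norm (\<pi> *v \<tau>)" using \<tau>(2) by simp
      have "norm (\<pi> *v \<tau>) \<le> norm (s *\<^sub>R y) + norm (s *\<^sub>R y - \<pi> *v \<tau>)"
        using norm_triangle_ineq4[of "s *\<^sub>R y" "s *\<^sub>R y - \<pi> *v \<tau>"] by simp
      moreover have "e' * norm (\<pi> *v \<tau>) \<le> 1/2 * norm (\<pi> *v \<tau>)" using e'(2) by (intro mult_right_mono) auto
      ultimately have b: "norm (\<pi> *v \<tau>) \<le> 2 * (s * norm y)" using st s by simp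
      have "s * norm (y - \<pi> *v ((1/s) *\<^sub>R \<tau>)) = norm (s *\<^sub>R (y - \<pi> *v ((1/s) *\<^sub>R \<tau>)))" using s by simp
      also have "s *\<^sub>R (y - \<pi> *v ((1/s) *\<^sub>R \<tau>)) = s *\<^sub>R y - \<pi> *v \<tau>"
        using s linear_scale[OF lin, of "1/s" \<tau>] by (simp add: scaleR_diff_right)
      also have "norm \<dots> \<le> e' * (2 * (s * norm y))" using st mult_left_mono[OF b, of e'] e'(1) by linarith
      finally have "s * norm (y - \<pi> *v ((1/s) *\<^sub>R \<tau>)) \<le> s * (e' * (2 * norm y))" by (simp add: algebra_simps)
      then have "norm (y - \<pi> *v ((1/s) *\<^sub>R \<tau>)) \<le> e' * (2 * norm y)" using s by simp
      also have "\<dots> \<le> e' * (2 * norm y + 1)" using e'(1) by (intro mult_left_mono) auto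
      also have "\<dots> \<le> (\<epsilon> / (2 * norm y + 1) / 2) * (2 * norm y + 1)" using e'(3) pos by (intro mult_right_mono) auto
      also have "\<dots> = \<epsilon> / 2"
      proof -
        have "(\<epsilon> / b / 2) * b = \<epsilon> / 2" if "b > 0" for b :: real using that by simp
        then show ?thesis using pos .
      qed
      also have "\<dots> < \<epsilon>" using \<epsilon> by simp
      finally have "dist (\<pi> *v ((1/s) *\<^sub>R \<tau>)) y < \<epsilon>" by (simp add: dist_norm norm_minus_commute)
      moreover have "(1/s) *\<^sub>R \<tau> \<in> T" by (rule subspace_scale[OF subT \<tau>(1)])
      ultimately show ?thesis by blast
    qed
    then have "y \<in> closure ((*v) \<pi> ` T)" by (simp add: closure_approachable)
    then show "y \<in> (*v) \<pi> ` T" using cl by (simp add: closure_closed)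
  qed
qed

lemma gradient_from_separating_form:
  assumes loc: "locally_closed_at V z" and N: "normalization P \<pi> e n"
    and inj: "\<And>x. x \<in> T \<Longrightarrow> \<pi> *v x = 0 \<Longrightarrow> x = 0" and onto: "range ((*v) \<pi>) = (*v) \<pi> ` T"
    and sep: "normalization.separates P \<pi> (linear_form \<xi>) z" and ann: "\<And>t. t \<in> T \<Longrightarrow> pairing \<xi> t = 0"
  shows "\<exists>G\<in>vanishing_polys V. has_gradient G z \<xi>"
proof -
  interpret normalization P \<pi> e n by (rule N)
  let ?u = "linear_form \<xi>"
  obtain Q where Q: "is_minpoly ?u Q" using ex_minpoly by blast
  then have Q': "coeffs_in (invariants \<pi>) Q" "poly Q ?u \<in> P" by (simp_all add: is_minpoly_def)
  obtain d where d: "d > 0" "\<And>p q. p \<in> V \<Longrightarrow> q \<in> V \<Longrightarrow> dist p z < d \<Longrightarrow> dist q z < d \<Longrightarrow> \<pi> *v p = \<pi> *v q \<Longrightarrow> p = q"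
    using projection_injective_near[OF inj] by blast
  obtain r where r: "r > 0" "\<And>w. w \<in> zeros P \<Longrightarrow> dist w z < r \<Longrightarrow> w \<in> V"
    using zeros_germ_ideal_near[OF loc] by blast
  define c where "c = poly (pderiv (evp z Q)) (ev ?u z)"
  have "c \<noteq> 0" unfolding c_def
  proof (rule simple_root[OF center_in_zeros sep Q, of "min d r"])
    show "min d r > 0" using d r by simp
    fix \<eta> :: real assume "\<eta> > 0"
    then have "min \<eta> d > 0" using d by simp
    have "\<exists>a\<in>V. dist a z < min \<eta> d \<and> ev (poly (pderiv Q) ?u) a \<noteq> 0"
    proof (rule ccontr)
      assume "\<not> ?thesis"
      then have "poly (pderiv Q) ?u \<in> P" unfolding germ_ideal_def
        using \<open>min \<eta> d > 0\<close> by (intro CollectI exI[of _ "min \<eta> d"] conjI) simp_all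
      then show False using minpoly_pderiv[OF Q] by contradiction
    qed
    then obtain a where a: "a \<in> V" "dist a z < min \<eta> d" "ev (poly (pderiv Q) ?u) a \<noteq> 0" by blast
    have "w = a" if w: "w \<in> zeros P" "dist w z < min d r" "\<pi> *v w = \<pi> *v a" for w
    proof (rule d(2)[OF _ a(1) _ _ w(3)])
      show "w \<in> V" by (rule r(2)[OF w(1)]) (use w(2) in simp)
      show "dist w z < d" "dist a z < d" using w(2) a(2) by simp_all
    qed
    then show "\<exists>a. dist a z < \<eta> \<and> ev (poly (pderiv Q) ?u) a \<noteq> 0 \<and>
        (\<forall>w\<in>zeros P. dist w z < min d r \<longrightarrow> \<pi> *v w = \<pi> *v a \<longrightarrow> w = a)"
      using a by (intro exI[of _ a]) simp
  qed
  obtain \<mu> where \<mu>: "has_gradient (poly Q ?u) z (c *s \<xi> + \<mu>)" "\<And>h. pairing \<mu> (\<pi> *v h) = pairing \<mu> h"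
    unfolding c_def using gradient_of_polynomial_in[OF idem Q'(1) has_gradient_linear_form] by blast
  have muT: "pairing \<mu> t = 0" if t: "t \<in> T" for t
    using gradient_annihilates_tangent[OF \<mu>(1) Q'(2) t] ann[OF t] by (simp add: pairing_simps)
  have "\<mu> = 0"
  proof (rule pairing_eqI)
    fix h
    have "\<pi> *v h \<in> (*v) \<pi> ` T" unfolding onto[symmetric] by (rule rangeI)
    then obtain t where t: "t \<in> T" "\<pi> *v h = \<pi> *v t" by auto
    have "pairing \<mu> h = pairing \<mu> (\<pi> *v t)" using \<mu>(2)[of h] t(2) by simp
    then show "pairing \<mu> h = pairing 0 h" using \<mu>(2)[of t] muT[OF t(1)] by (simp add: pairing_simps)
  qed
  then have grad: "has_gradient (poly Q ?u) z (c *s \<xi>)" using \<mu>(1) by simp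
  obtain h where h: "ev h z \<noteq> 0" "h * poly Q ?u \<in> vanishing_polys V"
    using local_vanishing_extends[OF z loc Q'(2)] by blast
  obtain \<beta> where \<beta>: "has_gradient h z \<beta>" using ex_gradient by blast
  have G0: "ev (poly Q ?u) z = 0" using center_in_zeros Q'(2) by (simp add: zeros_def)
  let ?k = "cconst (1 / (ev h z * c))"
  have "has_gradient (h * poly Q ?u) z (ev h z *s (c *s \<xi>) + ev (poly Q ?u) z *s \<beta>)"
    by (rule has_gradient_mult[OF \<beta> grad])
  then have "has_gradient (h * poly Q ?u) z ((ev h z * c) *s \<xi>)" by (simp add: G0)
  from has_gradient_mult[OF has_gradient_const[of "1 / (ev h z * c)"] this]
  have "has_gradient (?k * (h * poly Q ?u)) z \<xi>" using h(1) \<open>c \<noteq> 0\<close> by simp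
  moreover have "?k * (h * poly Q ?u) \<in> vanishing_polys V" by (rule ideal_mult[OF ideal_vanishing_polys h(2)])
  ultimately show ?thesis by blast
qed

text \<open>
  The conormal vectors that separate \<open>z\<close> from the rest of its fibre are generic, because the differences to the
  finitely many other points of the fibre lie in the kernel of \<open>\<pi>\<close> and hence outside \<open>T\<close>. With one of them, \<open>\<eta>\<close>, any \<open>\<xi>\<close> is the
  difference of \<open>\<xi> + s \<eta>\<close> and \<open>s \<eta>\<close>, and the first is separating for generic \<open>s\<close>.
\<close>

theorem conormal_is_gradient:
  assumes loc: "locally_closed_at V z" and ann: "\<And>t. t \<in> T \<Longrightarrow> pairing \<xi> t = 0"
  shows "\<exists>G\<in>vanishing_polys V. has_gradient G z \<xi>"
proof -
  have "\<exists>\<pi> e r. normalization P \<pi> e r \<and> (\<forall>x\<in>T. \<pi> *v x = 0 \<longrightarrow> x = 0)"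
    by (rule noether_normalization[OF prime_germ_ideal tangent_space_subspace])
      (rule germ_ideal_transversal_free)
  then obtain \<pi> e n where N: "normalization P \<pi> e n" and inj: "\<And>x. x \<in> T \<Longrightarrow> \<pi> *v x = 0 \<Longrightarrow> x = 0" by blast
  interpret normalization P \<pi> e n by (rule N)
  let ?\<Delta> = "(\<lambda>w. w - z) ` ({w \<in> zeros P. \<pi> *v w = \<pi> *v z} - {z})"
  have fin: "finite ?\<Delta>" using finite_fiber by simp
  have "?\<Delta> \<inter> T = {}"
  proof (rule ccontr)
    assume "?\<Delta> \<inter> T \<noteq> {}"
    then obtain w where "\<pi> *v w = \<pi> *v z" "w \<noteq> z" "w - z \<in> T" by blast
    then show False using inj[of "w - z"] by (simp add: matrix_vector_mult_diff_distrib)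
  qed
  from separating_functional[OF tangent_space_subspace fin this]
  obtain \<eta> where \<eta>: "\<forall>t\<in>T. pairing \<eta> t = 0" "\<forall>d\<in>?\<Delta>. pairing \<eta> d \<noteq> 0" by blast
  have sepI: "separates (linear_form \<zeta>) z" if "\<forall>d\<in>?\<Delta>. pairing \<zeta> d \<noteq> 0" for \<zeta>
    by (rule separates_linear_form) (use that in auto)
  have onto: "range ((*v) \<pi>) = (*v) \<pi> ` T"
    by (rule projection_onto[OF loc N _ sepI[OF \<eta>(2)]]) (rule inj)
  have grad: "\<exists>G\<in>vanishing_polys V. has_gradient G z \<zeta>"
    if "\<forall>d\<in>?\<Delta>. pairing \<zeta> d \<noteq> 0" "\<forall>t\<in>T. pairing \<zeta> t = 0" for \<zeta>
  proof (rule gradient_from_separating_form[OF loc N _ onto sepI[OF that(1)]])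
    show "x = 0" if "x \<in> T" "\<pi> *v x = 0" for x by (rule inj[OF that])
    show "pairing \<zeta> t = 0" if "t \<in> T" for t by (rule bspec[OF \<open>\<forall>t\<in>T. pairing \<zeta> t = 0\<close> that])
  qed
  obtain s where s: "\<forall>d\<in>?\<Delta>. pairing (\<xi> + s *s \<eta>) d \<noteq> 0"
    using generic_combination[OF fin, of \<eta> \<xi>] \<eta>(2) by blast
  have "\<forall>t\<in>T. pairing (\<xi> + s *s \<eta>) t = 0" using ann \<eta>(1) by (simp add: pairing_simps)
  from grad[OF s this] obtain G1 where G1: "G1 \<in> vanishing_polys V" "has_gradient G1 z (\<xi> + s *s \<eta>)" by blast
  from grad[OF \<eta>(2,1)] obtain G2 where G2: "G2 \<in> vanishing_polys V" "has_gradient G2 z \<eta>" by blast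
  have "has_gradient (G1 + cconst (- s) * G2) z ((\<xi> + s *s \<eta>) + (ev (cconst (- s)) z *s \<eta> + ev G2 z *s 0))"
    by (rule has_gradient_add[OF G1(2) has_gradient_mult[OF has_gradient_const G2(2)]])
  also have "(\<xi> + s *s \<eta>) + (ev (cconst (- s)) z *s \<eta> + ev G2 z *s 0) = \<xi>" by (simp add: vec_eq_iff)
  finally have "has_gradient (G1 + cconst (- s) * G2) z \<xi>" .
  moreover have "G1 + cconst (- s) * G2 \<in> vanishing_polys V"
    by (rule ideal_add[OF ideal_vanishing_polys G1(1) ideal_mult[OF ideal_vanishing_polys G2(1)]])
  ultimately show ?thesis by blast
qed

end


section \<open>Laurent polynomials\<close>

definition laurent_monomial :: "('n::finite \<Rightarrow>\<^sub>0 int) \<Rightarrow> complex ^ 'n \<Rightarrow> complex"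
  where "laurent_monomial a z = (\<Prod>j\<in>UNIV. (z $ j) powi Poly_Mapping.lookup a j)"

lemma laurent_eval_superset:
  assumes "finite A" "Poly_Mapping.keys f \<subseteq> A"
  shows "laurent_eval f z = (\<Sum>a\<in>A. Poly_Mapping.lookup f a * laurent_monomial a z)"
  unfolding laurent_eval_def laurent_monomial_def[symmetric]
  by (rule sum.mono_neutral_left) (use assms in \<open>auto simp: in_keys_iff\<close>)

lemma laurent_eval_add: "laurent_eval (f + g) z = laurent_eval f z + laurent_eval g z"
proof -
  let ?A = "Poly_Mapping.keys f \<union> Poly_Mapping.keys g"
  have "laurent_eval (f + g) z = (\<Sum>a\<in>?A. Poly_Mapping.lookup (f + g) a * laurent_monomial a z)"
    by (rule laurent_eval_superset) (use Poly_Mapping.keys_add[of f g] in auto)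
  also have "\<dots> = (\<Sum>a\<in>?A. Poly_Mapping.lookup f a * laurent_monomial a z) + (\<Sum>a\<in>?A. Poly_Mapping.lookup g a * laurent_monomial a z)"
    by (simp add: lookup_add distrib_right sum.distrib)
  also have "(\<Sum>a\<in>?A. Poly_Mapping.lookup f a * laurent_monomial a z) = laurent_eval f z"
    by (rule laurent_eval_superset[symmetric]) auto
  also have "(\<Sum>a\<in>?A. Poly_Mapping.lookup g a * laurent_monomial a z) = laurent_eval g z"
    by (rule laurent_eval_superset[symmetric]) auto
  finally show ?thesis .
qed

lemma laurent_eval_0 [simp]: "laurent_eval 0 z = 0" by (simp add: laurent_eval_def)

lemma laurent_eval_sum: "laurent_eval (sum f A) z = (\<Sum>i\<in>A. laurent_eval (f i) z)"
  by (induction A rule: infinite_finite_induct) (auto simp: laurent_eval_add)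

lemma laurent_eval_single: "laurent_eval (Poly_Mapping.single a c) z = c * laurent_monomial a z"
proof -
  have "laurent_eval (Poly_Mapping.single a c) z = (\<Sum>b\<in>{a}. Poly_Mapping.lookup (Poly_Mapping.single a c) b * laurent_monomial b z)"
    by (rule laurent_eval_superset) auto
  then show ?thesis by simp
qed

lemma laurent_monomial_add:
  "z \<in> torus \<Longrightarrow> laurent_monomial (a + b) z = laurent_monomial a z * laurent_monomial b z"
  unfolding laurent_monomial_def prod.distrib[symmetric]
  by (rule prod.cong) (auto simp: torus_def lookup_add power_int_add)

lemma laurent_sum_of_singles:
  fixes f :: "'n::finite laurent"
  shows "f = (\<Sum>a\<in>Poly_Mapping.keys f. Poly_Mapping.single a (Poly_Mapping.lookup f a))"
proof (rule poly_mapping_eqI)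
  fix b
  have "(\<Sum>a\<in>Poly_Mapping.keys f. Poly_Mapping.lookup (Poly_Mapping.single a (Poly_Mapping.lookup f a)) b)
    = (\<Sum>a\<in>Poly_Mapping.keys f. if a = b then Poly_Mapping.lookup f b else 0)"
    by (rule sum.cong) (auto simp: lookup_single when_def)
  also have "\<dots> = Poly_Mapping.lookup f b" by (simp add: in_keys_iff)
  finally show "Poly_Mapping.lookup f b = Poly_Mapping.lookup (\<Sum>a\<in>Poly_Mapping.keys f. Poly_Mapping.single a (Poly_Mapping.lookup f a)) b"
    by (simp add: lookup_sum)
qed

lemma laurent_eval_mult:
  fixes f g :: "'n::finite laurent"
  assumes z: "z \<in> torus"
  shows "laurent_eval (f * g) z = laurent_eval f z * laurent_eval g z"
proof -
  have "f * g = (\<Sum>a\<in>Poly_Mapping.keys f. \<Sum>b\<in>Poly_Mapping.keys g.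
      Poly_Mapping.single a (Poly_Mapping.lookup f a) * Poly_Mapping.single b (Poly_Mapping.lookup g b))"
    by (subst (1) laurent_sum_of_singles[of f], subst (1) laurent_sum_of_singles[of g]) (rule sum_product)
  also have "\<dots> = (\<Sum>a\<in>Poly_Mapping.keys f. \<Sum>b\<in>Poly_Mapping.keys g.
      Poly_Mapping.single (a + b) (Poly_Mapping.lookup f a * Poly_Mapping.lookup g b))"
    by (simp add: mult_single)
  finally have "laurent_eval (f * g) z = (\<Sum>a\<in>Poly_Mapping.keys f. \<Sum>b\<in>Poly_Mapping.keys g.
      (Poly_Mapping.lookup f a * laurent_monomial a z) * (Poly_Mapping.lookup g b * laurent_monomial b z))"
    by (simp add: laurent_eval_sum laurent_eval_single laurent_monomial_add[OF z] mult_ac)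
  also have "\<dots> = laurent_eval f z * laurent_eval g z"
    unfolding laurent_eval_def laurent_monomial_def[symmetric] by (rule sum_product[symmetric])
  finally show ?thesis .
qed

lemma cpoly_to_laurent:
  fixes G :: "'n::finite cpoly"
  shows "\<exists>F. \<forall>z\<in>torus. laurent_eval F z = ev G z"
proof (induction G rule: cpoly_induct)
  case (const c)
  show ?case by (intro exI[of _ "Poly_Mapping.single 0 c"]) (simp add: laurent_eval_single laurent_monomial_def)
next
  case (coord j)
  have "laurent_monomial (Poly_Mapping.single j 1) z = z $ j" for z :: "complex ^ 'n"
  proof -
    have "laurent_monomial (Poly_Mapping.single j 1) z = (\<Prod>i\<in>UNIV. if i = j then z $ j else 1)"
      unfolding laurent_monomial_def by (rule prod.cong) (auto simp: lookup_single when_def)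
    then show ?thesis by simp
  qed
  then show ?case by (intro exI[of _ "Poly_Mapping.single (Poly_Mapping.single j 1) 1"]) (simp add: laurent_eval_single)
next
  case (add f g)
  then obtain F F' where "\<forall>z\<in>torus. laurent_eval F z = ev f z" "\<forall>z\<in>torus. laurent_eval F' z = ev g z" by auto
  then show ?case by (intro exI[of _ "F + F'"]) (simp add: laurent_eval_add)
next
  case (mult f g)
  then obtain F F' where "\<forall>z\<in>torus. laurent_eval F z = ev f z" "\<forall>z\<in>torus. laurent_eval F' z = ev g z" by auto
  then show ?case by (intro exI[of _ "F * F'"]) (simp add: laurent_eval_mult)
qed

lemma ev_prod_coords: "\<exists>M. \<forall>z. ev M z = (\<Prod>j\<in>UNIV. z $ j ^ n j)"
proof -
  have "polynomial_fun (\<lambda>z. \<Prod>j\<in>UNIV. z $ j ^ n j)"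
    by (rule polynomial_fun_prod) (rule polynomial_fun_power[OF polynomial_fun_coord])
  from ev_Cpoly[OF this] show ?thesis by (intro exI[of _ "Cpoly (\<lambda>z. \<Prod>j\<in>UNIV. z $ j ^ n j)"]) simp
qed

lemma clear_denominators_monomial:
  fixes a :: "'n::finite \<Rightarrow>\<^sub>0 int"
  shows "\<exists>G M. \<forall>z\<in>torus. ev M z \<noteq> 0 \<and> ev G z = ev M z * laurent_monomial a z"
proof -
  let ?a = "Poly_Mapping.lookup a"
  obtain M where M: "\<And>z::complex ^ 'n. ev M z = (\<Prod>j\<in>UNIV. z $ j ^ nat (- ?a j))" using ev_prod_coords[of "\<lambda>j. nat (- ?a j)"] by auto
  obtain G where G: "\<And>z::complex ^ 'n. ev G z = (\<Prod>j\<in>UNIV. z $ j ^ nat (?a j))" using ev_prod_coords[of "\<lambda>j. nat (?a j)"] by auto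
  have "ev M z \<noteq> 0 \<and> ev G z = ev M z * laurent_monomial a z" if z: "z \<in> torus" for z :: "complex ^ 'n"
  proof
    show "ev M z \<noteq> 0" using z by (simp add: M torus_def)
    show "ev G z = ev M z * laurent_monomial a z"
      unfolding G M laurent_monomial_def prod.distrib[symmetric]
    proof (rule prod.cong[OF refl])
      fix j
      have "z $ j \<noteq> 0" using z by (simp add: torus_def)
      then show "z $ j ^ nat (?a j) = z $ j ^ nat (- ?a j) * z $ j powi ?a j"
        by (cases "?a j \<ge> 0") (auto simp: power_int_def power_inverse)
    qed
  qed
  then show ?thesis by blast
qed

text \<open>
  The multiplier \<open>M\<close> is a product of monomials that clear the negative exponents of the terms of \<open>F\<close>.
\<close>

lemma clear_denominators:
  fixes F :: "'n::finite laurent"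
  shows "\<exists>G M. \<forall>z\<in>torus. ev M z \<noteq> 0 \<and> ev G z = ev M z * laurent_eval F z"
proof -
  have "\<exists>G M. \<forall>z\<in>torus. ev M z \<noteq> 0 \<and> ev G z = ev M z * (\<Sum>a\<in>A. Poly_Mapping.lookup F a * laurent_monomial a z)"
    if "finite A" for A
    using that
  proof (induction A rule: finite_induct)
    case empty
    show ?case by (intro exI[of _ 0] exI[of _ 1]) simp
  next
    case (insert a A)
    obtain G M where G: "\<forall>z\<in>torus. ev M z \<noteq> 0 \<and> ev G z = ev M z * (\<Sum>a\<in>A. Poly_Mapping.lookup F a * laurent_monomial a z)"
      using insert.IH by blast
    obtain G' M' where G': "\<forall>z\<in>torus. ev M' z \<noteq> 0 \<and> ev G' z = ev M' z * laurent_monomial a z"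
      using clear_denominators_monomial by blast
    show ?case
    proof (intro exI ballI)
      fix z :: "complex ^ 'n" assume z: "z \<in> torus"
      show "ev (M * M') z \<noteq> 0 \<and> ev (M' * G + cconst (Poly_Mapping.lookup F a) * M * G') z
         = ev (M * M') z * (\<Sum>a\<in>insert a A. Poly_Mapping.lookup F a * laurent_monomial a z)"
        using bspec[OF G z] bspec[OF G' z] insert.hyps by (simp add: distrib_left mult_ac)
    qed
  qed
  from this[OF finite_keys] show ?thesis
    unfolding laurent_eval_def laurent_monomial_def[symmetric] .
qed

lemma open_torus: "open (torus :: (complex ^ 'n::finite) set)"
proof -
  have eq: "torus = (\<Inter>j. {z :: complex ^ 'n. z $ j \<noteq> 0})" by (auto simp: torus_def)
  have "open {z :: complex ^ 'n. z $ j \<noteq> 0}" for j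
    by (intro open_Collect_neq continuous_intros)
  then show ?thesis unfolding eq by (intro open_INT) auto
qed

definition laurent_gradient :: "'n::finite laurent \<Rightarrow> complex ^ 'n \<Rightarrow> complex ^ 'n"
  where "laurent_gradient F z = (\<chi> j. laurent_partial F j z)"

text \<open>
  On the torus a Laurent polynomial is a quotient of polynomial functions, so it is differentiable, and
  restriction to coordinate lines identifies its gradient.
\<close>

lemma has_derivative_laurent_eval:
  fixes F :: "'n::finite laurent"
  assumes z: "z \<in> torus"
  shows "(laurent_eval F has_derivative pairing (laurent_gradient F z)) (at z)"
proof -
  obtain G M where GM: "\<And>x. x \<in> torus \<Longrightarrow> ev M x \<noteq> 0" "\<And>x. x \<in> torus \<Longrightarrow> ev G x = ev M x * laurent_eval F x"
    using clear_denominators by blast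
  obtain g m where gm: "(ev G has_derivative pairing g) (at z)" "(ev M has_derivative pairing m) (at z)"
    using ex_gradient unfolding has_gradient_def by blast
  have "((\<lambda>x. ev G x / ev M x) has_derivative
      (\<lambda>h. - ev G z * (inverse (ev M z) * pairing m h * inverse (ev M z)) + pairing g h / ev M z)) (at z)"
    by (rule has_derivative_divide[OF gm GM(1)[OF z]])
  moreover have "(\<lambda>h. - ev G z * (inverse (ev M z) * pairing m h * inverse (ev M z)) + pairing g h / ev M z)
     = pairing ((1 / ev M z) *s g - (ev G z / (ev M z)\<^sup>2) *s m)"
    by (rule ext) (simp add: pairing_simps power2_eq_square divide_inverse)
  ultimately obtain \<eta> where "((\<lambda>x. ev G x / ev M x) has_derivative pairing \<eta>) (at z)" by auto
  then have \<eta>: "(laurent_eval F has_derivative pairing \<eta>) (at z)"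
    by (rule has_derivative_transform_within_open[OF _ open_torus z]) (simp add: GM)
  have "laurent_partial F j z = \<eta> $ j" for j
  proof -
    have e: "(\<chi> i. if i = j then t else z $ i) = (z - (z $ j) *s axis j 1) + t *s axis j 1" for t
      by (simp add: vec_eq_iff axis_def)
    have "((\<lambda>t::complex. t *s axis j (1::complex)) has_derivative (\<lambda>t. t *s axis j 1)) (at (z $ j))"
      by (rule bounded_linear_imp_has_derivative[OF bounded_linear_complex_scale])
    then have "((\<lambda>t. (z - (z $ j) *s axis j 1) + t *s axis j 1) has_derivative (\<lambda>s. s *s axis j 1)) (at (z $ j))"
      by (auto intro!: derivative_eq_intros)
    moreover have "(laurent_eval F has_derivative pairing \<eta>) (at ((z - (z $ j) *s axis j 1) + (z $ j) *s axis j 1))" using \<eta> by simp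
    ultimately have "((\<lambda>t. laurent_eval F ((z - (z $ j) *s axis j 1) + t *s axis j 1)) has_derivative (\<lambda>s. pairing \<eta> (s *s axis j 1))) (at (z $ j))"
      by (rule has_derivative_compose)
    then have "((\<lambda>t. laurent_eval F ((z - (z $ j) *s axis j 1) + t *s axis j 1)) has_field_derivative \<eta> $ j) (at (z $ j))"
      unfolding has_field_derivative_def pairing_simps pairing_axis mult.commute[of _ "\<eta> $ j"] .
    then show ?thesis unfolding laurent_partial_def e by (rule DERIV_imp_deriv)
  qed
  then have "laurent_gradient F z = \<eta>" by (simp add: laurent_gradient_def vec_eq_iff)
  then show ?thesis using \<eta> by simp
qed

section \<open>The conormal space of an algebraic set in the torus\<close>

lemma algebraic_set_locally_closed:
  assumes V: "algebraic_set V" and z: "z \<in> V"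
  shows "locally_closed_at V z"
proof -
  obtain S where S: "V = zero_locus S" using V unfolding algebraic_set_def by blast
  then have zt: "z \<in> torus" using z by (simp add: zero_locus_def)
  obtain r where r: "r > 0" "ball z r \<subseteq> torus" using open_torus zt open_contains_ball by blast
  have "w \<in> V" if w: "dist w z < r" "\<forall>f\<in>vanishing_polys V. ev f w = 0" for w
  proof -
    have wt: "w \<in> torus" by (rule subsetD[OF r(2)]) (use w(1) in \<open>simp add: dist_commute\<close>)
    have "laurent_eval F w = 0" if F: "F \<in> S" for F
    proof -
      obtain G M where GM: "\<And>x. x \<in> torus \<Longrightarrow> ev M x \<noteq> 0" "\<And>x. x \<in> torus \<Longrightarrow> ev G x = ev M x * laurent_eval F x"
        using clear_denominators by blast
      have "G \<in> vanishing_polys V" using F by (simp add: vanishing_polys_def S zero_locus_def GM(2))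
      then have "ev G w = 0" using w(2) by blast
      then show ?thesis using GM(1)[OF wt] GM(2)[OF wt] by simp
    qed
    then show ?thesis using wt by (simp add: S zero_locus_def)
  qed
  then show ?thesis unfolding locally_closed_at_def using r(1) by (intro exI[of _ r]) simp
qed

text \<open>
  A polynomial vanishing on \<open>V\<close> is a combination of the generators on the torus. As these vanish at \<open>z\<close>, its gradient at \<open>z\<close> is
  a linear combination of theirs.
\<close>

theorem gradients_span_conormal_space:
  fixes V :: "(complex ^ 'n::finite) set"
  assumes V: "algebraic_set V" and ideal: "vanishing_ideal V = ideal_generated_by l f"
    and z: "z \<in> regular_points V k"
  shows "vec.span ((\<lambda>i. laurent_gradient (f i) z) ` {..<l}) = {\<xi>. \<forall>t\<in>tangent_space V z. pairing \<xi> t = 0}"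
proof
  have zV: "z \<in> V" and sub: "submanifold_near V k z" using z by (simp_all add: regular_points_def)
  have Vt: "V \<subseteq> torus" using V by (auto simp: algebraic_set_def zero_locus_def)
  then have zt: "z \<in> torus" using zV by blast
  let ?N = "{\<xi>. \<forall>t\<in>tangent_space V z. pairing \<xi> t = 0}"
  have f_van: "laurent_eval (f i) x = 0" if i: "i < l" and x: "x \<in> V" for i x
  proof -
    have "(\<Sum>j<l. (if j = i then 1 else 0) * f j) = (\<Sum>j<l. if j = i then f i else 0)" by (rule sum.cong) auto
    also have "\<dots> = f i" using i by simp
    finally have "f i \<in> ideal_generated_by l f"
      unfolding ideal_generated_by_def by (intro CollectI exI[of _ "\<lambda>j. if j = i then 1 else 0"]) simp
    then show ?thesis using x unfolding ideal[symmetric] vanishing_ideal_def by simp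
  qed
  show "vec.span ((\<lambda>i. laurent_gradient (f i) z) ` {..<l}) \<subseteq> ?N"
  proof (rule vec.span_minimal)
    show "vec.subspace ?N" unfolding vec.subspace_def by (simp add: pairing_simps)
    show "(\<lambda>i. laurent_gradient (f i) z) ` {..<l} \<subseteq> ?N"
    proof (intro image_subsetI CollectI ballI)
      fix i t assume i: "i \<in> {..<l}" and t: "t \<in> tangent_space V z"
      show "pairing (laurent_gradient (f i) z) t = 0"
        by (rule derivative_annihilates_tangent[OF has_derivative_laurent_eval[OF zt] zero_less_one _ t])
          (use i f_van in simp)
    qed
  qed
  show "?N \<subseteq> vec.span ((\<lambda>i. laurent_gradient (f i) z) ` {..<l})"
  proof
    fix \<xi> assume \<xi>: "\<xi> \<in> ?N"
    obtain U \<phi> \<psi> J A A' where "submanifold_chart V z U \<phi> \<psi> J A A'" using submanifold_near_chart[OF zV sub] by blast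
    then interpret submanifold_chart V z U \<phi> \<psi> J A A' .
    obtain G where G: "G \<in> vanishing_polys V" "has_gradient G z \<xi>"
      using conormal_is_gradient[OF algebraic_set_locally_closed[OF V zV]] \<xi> by blast
    obtain F where F: "\<And>x. x \<in> torus \<Longrightarrow> laurent_eval F x = ev G x" using cpoly_to_laurent by blast
    have "F \<in> vanishing_ideal V" using G(1) F Vt by (auto simp: vanishing_ideal_def vanishing_polys_def)
    then obtain h where h: "F = (\<Sum>i<l. h i * f i)" unfolding ideal ideal_generated_by_def by blast
    have "((\<lambda>x. \<Sum>i<l. laurent_eval (h i) x * laurent_eval (f i) x) has_derivative
       (\<lambda>v. \<Sum>i<l. laurent_eval (h i) z * pairing (laurent_gradient (f i) z) v + pairing (laurent_gradient (h i) z) v * laurent_eval (f i) z)) (at z)"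
      by (intro has_derivative_sum has_derivative_mult has_derivative_laurent_eval zt)
    moreover have "(\<lambda>v. \<Sum>i<l. laurent_eval (h i) z * pairing (laurent_gradient (f i) z) v + pairing (laurent_gradient (h i) z) v * laurent_eval (f i) z)
      = pairing (\<Sum>i<l. laurent_eval (h i) z *s laurent_gradient (f i) z)"
    proof (rule ext)
      fix v :: "complex ^ 'n"
      have "pairing (sum g A) v = (\<Sum>i\<in>A. pairing (g i) v)" for g :: "nat \<Rightarrow> complex ^ 'n" and A
        by (induction A rule: infinite_finite_induct) (auto simp: pairing_simps)
      then show "(\<Sum>i<l. laurent_eval (h i) z * pairing (laurent_gradient (f i) z) v + pairing (laurent_gradient (h i) z) v * laurent_eval (f i) z)
        = pairing (\<Sum>i<l. laurent_eval (h i) z *s laurent_gradient (f i) z) v"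
        by (simp add: pairing_simps f_van[OF _ zV])
    qed
    ultimately have "((\<lambda>x. \<Sum>i<l. laurent_eval (h i) x * laurent_eval (f i) x) has_derivative
        pairing (\<Sum>i<l. laurent_eval (h i) z *s laurent_gradient (f i) z)) (at z)" by simp
    then have "(ev G has_derivative pairing (\<Sum>i<l. laurent_eval (h i) z *s laurent_gradient (f i) z)) (at z)"
    proof (rule has_derivative_transform_within_open[OF _ open_torus zt])
      fix x :: "complex ^ 'n" assume x: "x \<in> torus"
      show "(\<Sum>i<l. laurent_eval (h i) x * laurent_eval (f i) x) = ev G x"
        unfolding F[OF x, symmetric] h laurent_eval_sum laurent_eval_mult[OF x] ..
    qed
    then have "\<xi> = (\<Sum>i<l. laurent_eval (h i) z *s laurent_gradient (f i) z)"
      using has_gradient_unique[OF G(2)] unfolding has_gradient_def by blast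
    also have "\<dots> \<in> vec.span ((\<lambda>i. laurent_gradient (f i) z) ` {..<l})"
      by (intro vec.span_sum vec.span_scale vec.span_base imageI)
    finally show "\<xi> \<in> vec.span ((\<lambda>i. laurent_gradient (f i) z) ` {..<l})" .
  qed
qed


section \<open>Annihilators, real points and real parts\<close>

definition annihilator :: "(complex ^ 'n::finite) set \<Rightarrow> (complex ^ 'n) set"
  where "annihilator S = {\<eta>. \<forall>t\<in>S. pairing \<eta> t = 0}"

definition vec_cnj :: "complex ^ 'n \<Rightarrow> complex ^ 'n::finite"
  where "vec_cnj x = (\<chi> j. cnj (x $ j))"

definition vec_Re :: "complex ^ 'n \<Rightarrow> real ^ 'n::finite"
  where "vec_Re x = (\<chi> j. Re (x $ j))"

definition vec_of_real :: "real ^ 'n \<Rightarrow> complex ^ 'n::finite"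
  where "vec_of_real x = (\<chi> j. complex_of_real (x $ j))"

lemma vec_cnj_simps: "vec_cnj (vec_cnj x) = x" "vec_cnj (x + y) = vec_cnj x + vec_cnj y"
  "vec_cnj (c *s x) = cnj c *s vec_cnj x" "vec_cnj 0 = 0"
  by (simp_all add: vec_cnj_def vec_eq_iff)

lemma subspace_annihilator: "vec.subspace (annihilator S)"
  unfolding vec.subspace_def annihilator_def by (simp add: pairing_simps)

lemma subspace_vec_cnj: assumes S: "vec.subspace S" shows "vec.subspace (vec_cnj ` S)"
  unfolding vec.subspace_def
proof (intro conjI ballI allI)
  show "0 \<in> vec_cnj ` S" using vec.subspace_0[OF S] vec_cnj_simps(4) by (metis imageI)
  show "x + y \<in> vec_cnj ` S" if xy: "x \<in> vec_cnj ` S" "y \<in> vec_cnj ` S" for x y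
  proof -
    obtain a b where ab: "a \<in> S" "b \<in> S" "x = vec_cnj a" "y = vec_cnj b" using xy by blast
    have "x + y = vec_cnj (a + b)" by (simp add: ab vec_cnj_simps)
    then show ?thesis using vec.subspace_add[OF S ab(1,2)] by blast
  qed
  show "c *s x \<in> vec_cnj ` S" if x: "x \<in> vec_cnj ` S" for c x
  proof -
    obtain a where a: "a \<in> S" "x = vec_cnj a" using x by blast
    have "c *s x = vec_cnj (cnj c *s a)" by (simp add: a vec_cnj_simps)
    then show ?thesis using vec.subspace_scale[OF S a(1)] by blast
  qed
qed

lemma dim_vec_cnj_le: "vec.dim (vec_cnj ` S) \<le> vec.dim S"
proof -
  obtain b where b: "b \<subseteq> S" "vec.independent b" "S \<subseteq> vec.span b" "card b = vec.dim S" using vec.basis_exists by blast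
  have fin: "finite b" using b(2) vec.finiteI_independent by blast
  have "vec.span b \<subseteq> {x. vec_cnj x \<in> vec.span (vec_cnj ` b)}"
  proof (rule vec.span_minimal)
    show "b \<subseteq> {x. vec_cnj x \<in> vec.span (vec_cnj ` b)}" by (auto intro: vec.span_base)
    show "vec.subspace {x. vec_cnj x \<in> vec.span (vec_cnj ` b)}"
      unfolding vec.subspace_def by (simp add: vec_cnj_simps vec.span_zero vec.span_add vec.span_scale)
  qed
  then have "vec_cnj ` S \<subseteq> vec.span (vec_cnj ` b)" using b(3) by blast
  then have "vec.dim (vec_cnj ` S) \<le> card (vec_cnj ` b)" by (rule vec.dim_le_card) (simp add: fin)
  also have "\<dots> \<le> card b" by (rule card_image_le[OF fin])
  finally show ?thesis by (simp add: b(4))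
qed

lemma dim_vec_cnj: "vec.dim (vec_cnj ` S) = vec.dim S"
proof (rule antisym[OF dim_vec_cnj_le])
  have "vec_cnj ` vec_cnj ` S = S" by (simp add: image_image vec_cnj_simps)
  then show "vec.dim S \<le> vec.dim (vec_cnj ` S)" using dim_vec_cnj_le[of "vec_cnj ` S"] by simp
qed

lemma Re_pairing: "Re (pairing a x) = inner (vec_cnj a) x"
  using Re_pairing_cnj[of "vec_cnj a" x] by (simp add: vec_cnj_def)

text \<open>
  The annihilator is the Hermitian orthogonal complement of the conjugate space, which has the dimension of \<open>S\<close>.
\<close>

lemma dim_annihilator:
  fixes S :: "(complex ^ 'n::finite) set"
  assumes S: "vec.subspace S"
  shows "vec.dim (annihilator S) + vec.dim S = CARD('n)"
proof -
  let ?C = "vec_cnj ` S" and ?E = "annihilator S"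
  have C: "vec.subspace ?C" by (rule subspace_vec_cnj[OF S])
  have "{x + y | x y. x \<in> ?E \<and> y \<in> ?C} = UNIV"
  proof (intro UNIV_eq_I[symmetric] CollectI)
    fix x :: "complex ^ 'n"
    have sp: "span ?C = ?C" using vec_subspace_imp_subspace[OF C] by (simp add: span_eq_iff)
    obtain y n where yn: "y \<in> ?C" "\<And>w. w \<in> ?C \<Longrightarrow> orthogonal n w" "x = y + n"
      using orthogonal_subspace_decomp_exists[of ?C x] unfolding sp by metis
    have "n \<in> ?E" unfolding annihilator_def
    proof (intro CollectI ballI)
      fix t assume t: "t \<in> S"
      have re: "Re (pairing n s) = 0" if s: "s \<in> S" for s
      proof -
        have "Re (pairing n s) = Re (pairing s n)" by (simp add: pairing_def mult.commute)
        also have "\<dots> = inner (vec_cnj s) n" by (rule Re_pairing)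
        also have "\<dots> = 0" using yn(2)[of "vec_cnj s"] s by (simp add: orthogonal_def inner_commute)
        finally show ?thesis .
      qed
      have "Re (pairing n (\<i> *s t)) = 0" by (rule re[OF vec.subspace_scale[OF S t]])
      then have "Im (pairing n t) = 0" by (simp add: pairing_simps)
      then show "pairing n t = 0" using re[OF t] by (simp add: complex_eq_iff)
    qed
    then show "\<exists>a b. x = a + b \<and> a \<in> ?E \<and> b \<in> ?C" using yn(1,3) by (intro exI[of _ n] exI[of _ y]) simp
  qed
  moreover have "?E \<inter> ?C = {0}"
  proof
    show "?E \<inter> ?C \<subseteq> {0}"
    proof
      fix x assume "x \<in> ?E \<inter> ?C"
      then obtain t where t: "t \<in> S" "x = vec_cnj t" "pairing x t = 0" unfolding annihilator_def by blast
      have "inner t t = Re (pairing (vec_cnj t) t)" by (simp add: Re_pairing vec_cnj_simps)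
      then have "t = 0" using t by simp
      then show "x \<in> {0}" by (simp add: t(2) vec_cnj_simps)
    qed
    show "{0} \<subseteq> ?E \<inter> ?C" using vec.subspace_0[OF C] vec.subspace_0[OF subspace_annihilator] by blast
  qed
  ultimately have "vec.dim (UNIV :: (complex ^ 'n) set) + vec.dim {0 :: complex ^ 'n} = vec.dim ?E + vec.dim ?C"
    using vec.dim_sums_Int[OF subspace_annihilator C, of S] by simp
  moreover have "vec.dim {0 :: complex ^ 'n} = 0" by simp
  ultimately show ?thesis by (simp only: vec_dim_card dim_vec_cnj)
qed

lemma linear_vec_Re: "linear vec_Re" and linear_vec_of_real: "linear vec_of_real"
  unfolding vec_Re_def vec_of_real_def
  by (rule linearI; simp add: vec_eq_iff scaleR_conv_of_real[where 'a = complex])+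

lemma subspace_vec_Re: "vec.subspace S \<Longrightarrow> subspace (vec_Re ` S)"
  by (intro linear_subspace_image linear_vec_Re vec_subspace_imp_subspace)

lemma decompose_Re_Im: "x = vec_of_real (vec_Re x) + (- \<i>) *s vec_of_real (vec_Re (\<i> *s x) )"
  by (simp add: vec_eq_iff vec_of_real_def vec_Re_def complex_eq_iff)

text \<open>
  The imaginary part of a vector of \<open>S\<close> is up to sign the real part of its multiple by the imaginary unit, so \<open>S\<close> lies in the
  complex span of its real parts.
\<close>

lemma dim_le_dim_vec_Re:
  fixes S :: "(complex ^ 'n::finite) set"
  assumes S: "vec.subspace S"
  shows "vec.dim S \<le> dim (vec_Re ` S)"
proof -
  obtain b where b: "b \<subseteq> vec_Re ` S" "independent b" "vec_Re ` S \<subseteq> span b" "card b = dim (vec_Re ` S)"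
    using basis_exists by blast
  have fin: "finite b" using b(2) by (rule independent_imp_finite)
  have "span b \<subseteq> {x. vec_of_real x \<in> vec.span (vec_of_real ` b)}"
  proof (rule span_minimal)
    show "b \<subseteq> {x. vec_of_real x \<in> vec.span (vec_of_real ` b)}" by (auto intro: vec.span_base)
    show "subspace {x. vec_of_real x \<in> vec.span (vec_of_real ` b)}"
      unfolding subspace_def
      by (simp add: linear_0[OF linear_vec_of_real] linear_add[OF linear_vec_of_real] linear_scale[OF linear_vec_of_real]
        scaleR_complex_vec vec.span_zero vec.span_add vec.span_scale)
  qed
  then have re: "vec_of_real (vec_Re x) \<in> vec.span (vec_of_real ` b)" if "x \<in> S" for x using b(3) that by blast
  have "S \<subseteq> vec.span (vec_of_real ` b)"
  proof
    fix x assume x: "x \<in> S"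
    show "x \<in> vec.span (vec_of_real ` b)"
      by (subst decompose_Re_Im[of x]) (intro vec.span_add vec.span_scale re x vec.subspace_scale[OF S])
  qed
  then have "vec.dim S \<le> card (vec_of_real ` b)" by (rule vec.dim_le_card) (simp add: fin)
  also have "\<dots> \<le> card b" by (rule card_image_le[OF fin])
  finally show ?thesis by (simp add: b(4))
qed

lemma real_points_annihilator:
  fixes S :: "(complex ^ 'n::finite) set"
  assumes S: "vec.subspace S"
  shows "annihilator S \<inter> real_points = vec_of_real ` {x. \<forall>y\<in>vec_Re ` S. orthogonal y x}"
proof -
  have re: "Re (pairing (vec_of_real x) t) = inner (vec_Re t) x" for x t
    by (simp add: pairing_def vec_of_real_def vec_Re_def inner_vec_def mult.commute)
  have iff: "vec_of_real x \<in> annihilator S \<longleftrightarrow> (\<forall>y\<in>vec_Re ` S. orthogonal y x)" for x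
  proof
    assume "vec_of_real x \<in> annihilator S"
    then show "\<forall>y\<in>vec_Re ` S. orthogonal y x"
      unfolding annihilator_def orthogonal_def by (auto simp: re[symmetric])
  next
    assume h: "\<forall>y\<in>vec_Re ` S. orthogonal y x"
    have z: "Re (pairing (vec_of_real x) t) = 0" if "t \<in> S" for t
      using h that by (simp add: re orthogonal_def)
    have "pairing (vec_of_real x) t = 0" if t: "t \<in> S" for t
    proof -
      have "Re (pairing (vec_of_real x) (\<i> *s t)) = 0" by (rule z[OF vec.subspace_scale[OF S t]])
      then have "Im (pairing (vec_of_real x) t) = 0" by (simp add: pairing_simps)
      then show ?thesis using z[OF t] by (simp add: complex_eq_iff)
    qed
    then show "vec_of_real x \<in> annihilator S" by (simp add: annihilator_def)
  qed
  have rp: "(real_points :: (complex ^ 'n) set) = range vec_of_real"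
  proof
    show "range vec_of_real \<subseteq> real_points" by (auto simp: real_points_def vec_of_real_def)
    show "(real_points :: (complex ^ 'n) set) \<subseteq> range vec_of_real"
    proof
      fix v :: "complex ^ 'n" assume v: "v \<in> real_points"
      have "v = vec_of_real (vec_Re v)"
        using v by (simp add: real_points_def vec_of_real_def vec_Re_def vec_eq_iff of_real_Re)
      then show "v \<in> range vec_of_real" by (rule range_eqI)
    qed
  qed
  show ?thesis unfolding rp using iff by blast
qed

lemma dim_real_points_annihilator:
  fixes S :: "(complex ^ 'n::finite) set"
  assumes S: "vec.subspace S"
  shows "dim (annihilator S \<inter> real_points) + dim (vec_Re ` S) = CARD('n)"
proof -
  let ?W = "{x. \<forall>y\<in>vec_Re ` S. orthogonal y x}"
  have "inj vec_of_real" by (rule injI) (simp add: vec_of_real_def vec_eq_iff)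
  then have "dim (vec_of_real ` ?W) = dim ?W"
    by (intro dim_image_eq linear_vec_of_real) (rule inj_on_subset[OF _ subset_UNIV])
  moreover have "dim ?W + dim (vec_Re ` S) = CARD('n)"
    using dim_subspace_orthogonal_to_vectors[OF subspace_vec_Re[OF S] subspace_UNIV subset_UNIV] by simp
  ultimately show ?thesis by (simp add: real_points_annihilator[OF S])
qed

section \<open>Rank of the logarithmic map and the logarithmic Gauss map\<close>

definition log_scale :: "complex ^ 'n \<Rightarrow> complex ^ 'n \<Rightarrow> complex ^ 'n::finite"
  where "log_scale z v = (\<chi> j. v $ j / z $ j)"

lemma has_derivative_ln_cmod:
  assumes "w \<noteq> 0"
  shows "((\<lambda>w. ln (cmod w)) has_derivative (\<lambda>h. Re (h / w))) (at w)"
proof -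
  have 1: "(cmod has_derivative (\<lambda>h. inner (sgn w) h)) (at w)" 
    using has_derivative_norm[OF assms] by (simp add: inner_commute)
  have "(ln has_field_derivative inverse (cmod w)) (at (cmod w))"
    using assms by (intro DERIV_ln) simp
  then have "(ln has_derivative (\<lambda>h. inverse (cmod w) * h)) (at (cmod w))" by (simp add: has_field_derivative_def)
  from diff_chain_at[OF 1 this]
  have "((\<lambda>w. ln (cmod w)) has_derivative (\<lambda>h. inverse (cmod w) * inner (sgn w) h)) (at w)" by (simp add: o_def)
  moreover have "inverse (cmod w) * inner (sgn w) h = Re (h / w)" for h
  proof -
    have "Re (h / w) = inner w h / (cmod w)\<^sup>2"
      by (simp add: Re_divide inner_complex_def cmod_power2 algebra_simps)
    then show ?thesis using assms by (simp add: sgn_div_norm divide_inverse power2_eq_square)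
  qed
  ultimately show ?thesis by simp
qed

text \<open>
  The logarithm of the modulus is the real part of a local holomorphic logarithm.
\<close>

lemma has_derivative_Log_map:
  fixes z :: "complex ^ 'n::finite"
  assumes z: "z \<in> torus"
  shows "(Log_map has_derivative (\<lambda>h. vec_Re (log_scale z h))) (at z)"
proof -
  have "((\<lambda>x. inner (Log_map x) b) has_derivative (\<lambda>h. inner (vec_Re (log_scale z h)) b)) (at z)"
    if b: "b \<in> Basis" for b :: "real ^ 'n"
  proof -
    obtain j where j: "b = axis j 1" using b by (auto simp: Basis_vec_def)
    have "z $ j \<noteq> 0" using z by (simp add: torus_def)
    from diff_chain_at[OF bounded_linear_imp_has_derivative[OF bounded_linear_vec_nth] has_derivative_ln_cmod[OF this]]
    have "((\<lambda>x. ln (cmod (x $ j))) has_derivative (\<lambda>h. Re (h $ j / z $ j))) (at z)" by (simp add: o_def)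
    then show ?thesis by (simp add: j inner_axis Log_map_def vec_Re_def log_scale_def)
  qed
  then show ?thesis using has_derivative_componentwise_within[of Log_map _ z UNIV] by blast
qed

lemma Log_rank_eq:
  assumes "z \<in> torus"
  shows "Log_rank V z = dim (vec_Re ` log_scale z ` tangent_space V z)"
  unfolding Log_rank_def frechet_derivative_at[OF has_derivative_Log_map[OF assms], symmetric] by (simp add: image_image)

text \<open>
  The rows of the Gauss matrix are the gradients of the generators with coordinates multiplied by \<open>z\<^sub>j\<close>, and this scaling is dual
  to \<open>log_scale\<close>.
\<close>

lemma log_gauss_eq_annihilator:
  fixes V :: "(complex ^ 'n::finite) set"
  assumes V: "algebraic_set V" and ideal: "vanishing_ideal V = ideal_generated_by l f"
    and z: "z \<in> regular_points V k" and zt: "z \<in> torus"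
  shows "log_gauss l f z = annihilator (log_scale z ` tangent_space V z)"
proof -
  let ?D = "\<lambda>\<eta>. (\<chi> j. z $ j * \<eta> $ j) :: complex ^ 'n"
  have row: "log_gauss_row f z i = ?D (laurent_gradient (f i) z)" for i
    by (simp add: log_gauss_row_def laurent_gradient_def vec_eq_iff)
  have lin: "Vector_Spaces.linear (*s) (*s) ?D"
    by unfold_locales (simp_all add: vec_eq_iff algebra_simps)
  have "log_gauss l f z = vec.span (?D ` (\<lambda>i. laurent_gradient (f i) z) ` {..<l})"
    by (simp add: log_gauss_def row image_image)
  also have "\<dots> = ?D ` vec.span ((\<lambda>i. laurent_gradient (f i) z) ` {..<l})"
    by (rule vec.linear_span_image[OF lin])
  also have "\<dots> = ?D ` {\<xi>. \<forall>t\<in>tangent_space V z. pairing \<xi> t = 0}"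
    by (simp only: gradients_span_conormal_space[OF V ideal z])
  also have "\<dots> = annihilator (log_scale z ` tangent_space V z)"
  proof -
    have nz: "z $ j \<noteq> 0" for j using zt by (simp add: torus_def)
    have p: "pairing (?D \<xi>) (log_scale z t) = pairing \<xi> t" for \<xi> t
      unfolding pairing_def log_scale_def by (rule sum.cong) (simp_all add: nz)
    have s: "\<eta> = ?D (\<chi> j. \<eta> $ j / z $ j)" for \<eta> :: "complex ^ 'n" by (simp add: vec_eq_iff nz)
    show ?thesis
    proof
      show "?D ` {\<xi>. \<forall>t\<in>tangent_space V z. pairing \<xi> t = 0} \<subseteq> annihilator (log_scale z ` tangent_space V z)"
        by (auto simp: annihilator_def p)
      show "annihilator (log_scale z ` tangent_space V z) \<subseteq> ?D ` {\<xi>. \<forall>t\<in>tangent_space V z. pairing \<xi> t = 0}"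
      proof
        fix \<eta> assume \<eta>: "\<eta> \<in> annihilator (log_scale z ` tangent_space V z)"
        have "pairing (\<chi> j. \<eta> $ j / z $ j) t = 0" if t: "t \<in> tangent_space V z" for t
        proof -
          have "pairing \<eta> (log_scale z t) = 0" using \<eta> t by (simp add: annihilator_def)
          then show ?thesis by (subst (asm) s) (simp only: p)
        qed
        then have "(\<chi> j. \<eta> $ j / z $ j) \<in> {\<xi>. \<forall>t\<in>tangent_space V z. pairing \<xi> t = 0}" by simp
        with s[of \<eta>] show "\<eta> \<in> ?D ` {\<xi>. \<forall>t\<in>tangent_space V z. pairing \<xi> t = 0}" by (rule image_eqI)
      qed
    qed
  qed
  finally show ?thesis .
qed

lemma regular_point_dimensions:
  fixes V :: "(complex ^ 'n::finite) set"
  assumes V: "algebraic_set V" and ideal: "vanishing_ideal V = ideal_generated_by l f"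
    and reg: "z \<in> regular_points V k"
  shows "k \<le> CARD('n)" "log_gauss l f z \<in> grassmannian (CARD('n) - k)"
    "dim (log_gauss l f z \<inter> real_points) + Log_rank V z = CARD('n)" "k \<le> Log_rank V z"
proof -
  have zV: "z \<in> V" and sub: "submanifold_near V k z" using reg by (simp_all add: regular_points_def)
  have zt: "z \<in> torus" using V zV by (auto simp: algebraic_set_def zero_locus_def)
  obtain U \<phi> \<psi> J A A' where "submanifold_chart V z U \<phi> \<psi> J A A'" and J: "card J = k"
    using submanifold_near_chart[OF zV sub] by blast
  then interpret submanifold_chart V z U \<phi> \<psi> J A A' by simp
  show k: "k \<le> CARD('n)" unfolding J[symmetric] by (rule card_mono) auto
  let ?S = "log_scale z ` T"
  have nz: "z $ j \<noteq> 0" for j using zt by (simp add: torus_def)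
  have lin: "Vector_Spaces.linear (*s) (*s) (log_scale z)"
    by unfold_locales (simp_all add: log_scale_def vec_eq_iff add_divide_distrib)
  have inj: "inj (log_scale z)" by (rule injI) (simp add: log_scale_def vec_eq_iff nz)
  have S: "vec.subspace ?S" by (rule vec.linear_subspace_image[OF lin tangent_space_subspace])
  have dS: "vec.dim ?S = k"
    unfolding J[symmetric] tangent_space_dim[symmetric]
    by (rule vec.dim_image_eq[OF lin]) (rule inj_on_subset[OF inj subset_UNIV])
  have E: "log_gauss l f z = annihilator ?S" by (rule log_gauss_eq_annihilator[OF V ideal reg zt])
  have "vec.dim (log_gauss l f z) = CARD('n) - k"
    using dim_annihilator[OF S] unfolding E dS by simp
  then show "log_gauss l f z \<in> grassmannian (CARD('n) - k)"
    using subspace_annihilator[of ?S] by (simp add: grassmannian_def E)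
  show "dim (log_gauss l f z \<inter> real_points) + Log_rank V z = CARD('n)"
    unfolding E Log_rank_eq[OF zt] by (rule dim_real_points_annihilator[OF S])
  show "k \<le> Log_rank V z"
    unfolding Log_rank_eq[OF zt] using dim_le_dim_vec_Re[OF S] by (simp only: dS)
qed

theorem theorem3p2:
  fixes V :: "(complex ^ 'n::finite) set"
    and k l :: nat
    and f :: "nat \<Rightarrow> 'n laurent"
  assumes "algebraic_set V"
    and "has_dimension V k"
    and "vanishing_ideal V = ideal_generated_by l f"
  shows "(CARD('n) \<ge> 2 * k \<longrightarrow>
            Critp_Log V k =
              (\<Union>j\<in>{1..k}. log_gauss_preimage V k l f (sigma_stratum (CARD('n) - k) (CARD('n) - 2 * k + j))))
       \<and> (CARD('n) < 2 * k \<longrightarrow>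
            Critp_Log V k =
              (\<Union>j\<in>{1..CARD('n) - k}. log_gauss_preimage V k l f (sigma_stratum (CARD('n) - k) j)))"
proof (intro conjI impI)
  note D = regular_point_dimensions[OF assms(1,3)]
  let ?n = "CARD('n)" and ?m = "\<lambda>z. dim (log_gauss l f z \<inter> real_points)"
  have pre: "z \<in> log_gauss_preimage V k l f (sigma_stratum (?n - k) m) \<longleftrightarrow> z \<in> regular_points V k \<and> ?m z = m" for z m
    using D(2)[of z k] by (auto simp: log_gauss_preimage_def sigma_stratum_def)
  {
    assume n: "2 * k \<le> ?n"
    show "Critp_Log V k = (\<Union>j\<in>{1..k}. log_gauss_preimage V k l f (sigma_stratum (?n - k) (?n - 2 * k + j)))"
    proof (rule set_eqI)
      fix z
      have "Log_rank V z < min ?n (2 * k) \<longleftrightarrow> (\<exists>j\<in>{1..k}. ?m z = ?n - 2 * k + j)" if z: "z \<in> regular_points V k"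
      proof
        assume "Log_rank V z < min ?n (2 * k)"
        then show "\<exists>j\<in>{1..k}. ?m z = ?n - 2 * k + j"
          using D(3)[OF z] D(4)[OF z] n by (intro bexI[of _ "2 * k - Log_rank V z"]) auto
      next
        assume "\<exists>j\<in>{1..k}. ?m z = ?n - 2 * k + j"
        then show "Log_rank V z < min ?n (2 * k)" using D(3)[OF z] n by auto
      qed
      then show "z \<in> Critp_Log V k \<longleftrightarrow> z \<in> (\<Union>j\<in>{1..k}. log_gauss_preimage V k l f (sigma_stratum (?n - k) (?n - 2 * k + j)))"
        unfolding UN_iff pre Critp_Log_def mem_Collect_eq by blast
    qed
  next
    assume n: "?n < 2 * k"
    show "Critp_Log V k = (\<Union>j\<in>{1..?n - k}. log_gauss_preimage V k l f (sigma_stratum (?n - k) j))"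
    proof (rule set_eqI)
      fix z
      have "Log_rank V z < min ?n (2 * k) \<longleftrightarrow> (\<exists>j\<in>{1..?n - k}. ?m z = j)" if z: "z \<in> regular_points V k"
        using D(1)[OF z] D(3)[OF z] D(4)[OF z] n by auto
      then show "z \<in> Critp_Log V k \<longleftrightarrow> z \<in> (\<Union>j\<in>{1..?n - k}. log_gauss_preimage V k l f (sigma_stratum (?n - k) j))"
        unfolding UN_iff pre Critp_Log_def mem_Collect_eq by blast
    qed
  }
qed


end
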